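(* Let $G$ be a profinite group which is virtually $\mathbb{Z}_p$ for some prime $p$, and let $Z$ be an open normal subgroup of $G$ topologically isomorphic to $\mathbb{Z}_p$. Suppose that $\mathcal{S}(G)$ is uncountable. Then $\mathcal{S}(G)$ is homeomorphic to $P\oplus(\omega n+1)$, where $n=|\mathcal{S}(C_G(Z))'|$ and $P$ is Pełczyński space.
   Context: For a profinite group $G$, $\mathcal{S}(G)$ is the set of closed subgroups of $G$ with its natural profinite topology: a base of open neighbourhoods of $H\in\mathcal{S}(G)$ is given by the sets $B(H,N)=\{K \text{ closed subgroup of } G \mid KN=HN\}$, with $N$ ranging over the open normal subgroups of $G$. For a space $X$, $X'$ denotes $X$ minus its isolated points. "Virtually $\mathbb{Z}_p$" means having an open normal subgroup topologically isomorphic to the $p$-adic integers $\mathbb{Z}_p$. $C_G(Z)$ is the centralizer of $Z$ in $G$. $\oplus$ denotes topological disjoint union, and the ordinal $\omega n+1$ has the order topology. Pełczyński space $P$ is the subspace of $[0,1]$ consisting of the middle-third Cantor set together with the midpoints of all the open intervals deleted in its construction. *)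

theory Defs
  imports "HOL-Analysis.Analysis" "HOL-Algebra.Product_Groups" "HOL-Algebra.Elementary_Groups"
begin

section \<open>Profinite groups\<close>

definition topological_group :: "('a, 'b) monoid_scheme \<Rightarrow> 'a topology \<Rightarrow> bool" where
  "topological_group G T \<longleftrightarrow>
     group G \<and> topspace T = carrier G \<and>
     continuous_map (prod_topology T T) T (\<lambda>(x, y). x \<otimes>\<^bsub>G\<^esub> y) \<and>
     continuous_map T T (\<lambda>x. inv\<^bsub>G\<^esub> x)"

definition profinite_group :: "('a, 'b) monoid_scheme \<Rightarrow> 'a topology \<Rightarrow> bool" where
  "profinite_group G T \<longleftrightarrow>
     topological_group G T \<and> compact_space T \<and> Hausdorff_space T \<and>
     (\<forall>C. connectedin T C \<longrightarrow> (\<forall>x\<in>C. \<forall>y\<in>C. x = y))"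

definition open_normal :: "('a, 'b) monoid_scheme \<Rightarrow> 'a topology \<Rightarrow> 'a set \<Rightarrow> bool" where
  "open_normal G T N \<longleftrightarrow> N \<lhd> G \<and> openin T N"

definition topologically_isomorphic ::
  "('a, 'b) monoid_scheme \<Rightarrow> 'a topology \<Rightarrow> ('c, 'd) monoid_scheme \<Rightarrow> 'c topology \<Rightarrow> bool" where
  "topologically_isomorphic G T H U \<longleftrightarrow> (\<exists>f \<in> iso G H. homeomorphic_map T U f)"

definition group_centralizer :: "('a, 'b) monoid_scheme \<Rightarrow> 'a set \<Rightarrow> 'a set" where
  "group_centralizer G Z = {g \<in> carrier G. \<forall>z\<in>Z. g \<otimes>\<^bsub>G\<^esub> z = z \<otimes>\<^bsub>G\<^esub> g}"


section \<open>The additive group of p-adic integers\<close>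

text \<open>The inverse limit of the groups of integers modulo \<open>p ^ k\<close>, as a topological
  subgroup of the product of these finite discrete groups.\<close>

definition padic_carrier :: "nat \<Rightarrow> (nat \<Rightarrow> int) set" where
  "padic_carrier p =
     {x \<in> carrier (product_group UNIV (\<lambda>k. integer_mod_group (p ^ k))).
        \<forall>k. x (Suc k) mod int (p ^ k) = x k}"

definition padic_group :: "nat \<Rightarrow> (nat \<Rightarrow> int) monoid" where
  "padic_group p =
     (product_group UNIV (\<lambda>k. integer_mod_group (p ^ k)))\<lparr>carrier := padic_carrier p\<rparr>"

definition padic_topology :: "nat \<Rightarrow> (nat \<Rightarrow> int) topology" where
  "padic_topology p =
     subtopology
       (product_topology (\<lambda>k. discrete_topology (carrier (integer_mod_group (p ^ k)))) UNIV)
       (padic_carrier p)"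

definition subgroup_is_padic ::
  "nat \<Rightarrow> ('a, 'b) monoid_scheme \<Rightarrow> 'a topology \<Rightarrow> 'a set \<Rightarrow> bool" where
  "subgroup_is_padic p G T Z \<longleftrightarrow>
     topologically_isomorphic (G\<lparr>carrier := Z\<rparr>) (subtopology T Z)
       (padic_group p) (padic_topology p)"

definition virtually_padic :: "nat \<Rightarrow> ('a, 'b) monoid_scheme \<Rightarrow> 'a topology \<Rightarrow> bool" where
  "virtually_padic p G T \<longleftrightarrow> (\<exists>Z. open_normal G T Z \<and> subgroup_is_padic p G T Z)"


section \<open>The space of closed subgroups\<close>

definition closed_subgroups :: "('a, 'b) monoid_scheme \<Rightarrow> 'a topology \<Rightarrow> 'a set set" where
  "closed_subgroups G T = {H. subgroup H G \<and> closedin T H}"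

definition subgroup_nhd ::
  "('a, 'b) monoid_scheme \<Rightarrow> 'a topology \<Rightarrow> 'a set \<Rightarrow> 'a set \<Rightarrow> 'a set set" where
  "subgroup_nhd G T H N = {K \<in> closed_subgroups G T. K <#>\<^bsub>G\<^esub> N = H <#>\<^bsub>G\<^esub> N}"

definition subgroup_space :: "('a, 'b) monoid_scheme \<Rightarrow> 'a topology \<Rightarrow> 'a set topology" where
  "subgroup_space G T =
     topology_generated_by
       {subgroup_nhd G T H N | H N. H \<in> closed_subgroups G T \<and> open_normal G T N}"

text \<open>The generating sets are a base, not only a subbase: the sets \<open>subgroup_nhd G T H N\<close>
  with \<open>H\<close> fixed form a base of open neighbourhoods of \<open>H\<close>.\<close>

lemma subgroup_nhd_Int:
  assumes "group G" "open_normal G T M" "open_normal G T N"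
    and "H \<in> closed_subgroups G T"
  shows "open_normal G T (M \<inter> N)"
    and "subgroup_nhd G T H (M \<inter> N) \<subseteq> subgroup_nhd G T H M \<inter> subgroup_nhd G T H N"
proof -
  interpret group G by fact
  have M: "M \<lhd> G" and N: "N \<lhd> G" and MN: "M \<inter> N \<lhd> G"
    using assms normal_subgroup_intersect unfolding open_normal_def by blast+
  show "open_normal G T (M \<inter> N)"
    using MN assms by (simp add: open_normal_def openin_Int)
  have abs: "(A <#>\<^bsub>G\<^esub> (M \<inter> N)) <#>\<^bsub>G\<^esub> L = A <#>\<^bsub>G\<^esub> L"
    if "L \<lhd> G" "M \<inter> N \<subseteq> L" "A \<subseteq> carrier G" for A L
  proof -
    have L: "subgroup L G" "subgroup (M \<inter> N) G"
      using that MN normal_imp_subgroup by auto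
    have "(M \<inter> N) <#>\<^bsub>G\<^esub> L = L"
    proof
      show "(M \<inter> N) <#>\<^bsub>G\<^esub> L \<subseteq> L"
        using L(1) that(2) by (auto simp: set_mult_def intro: subgroup.m_closed)
      show "L \<subseteq> (M \<inter> N) <#>\<^bsub>G\<^esub> L"
        using subgroup.one_closed[OF L(2)] subgroup.mem_carrier[OF L(1)]
        by (force simp: set_mult_def)
    qed
    then show ?thesis
      using set_mult_assoc[OF that(3) subgroup.subset[OF L(2)] subgroup.subset[OF L(1)]] by simp
  qed
  show "subgroup_nhd G T H (M \<inter> N) \<subseteq> subgroup_nhd G T H M \<inter> subgroup_nhd G T H N"
  proof
    fix K assume K: "K \<in> subgroup_nhd G T H (M \<inter> N)"
    then have c: "K \<subseteq> carrier G" "H \<subseteq> carrier G" "K <#>\<^bsub>G\<^esub> (M \<inter> N) = H <#>\<^bsub>G\<^esub> (M \<inter> N)"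
      using assms(4) subgroup.subset by (auto simp: subgroup_nhd_def closed_subgroups_def)
    have "K <#>\<^bsub>G\<^esub> M = H <#>\<^bsub>G\<^esub> M"
      using abs[OF M Int_lower1 c(1)] abs[OF M Int_lower1 c(2)] c(3) by simp
    moreover have "K <#>\<^bsub>G\<^esub> N = H <#>\<^bsub>G\<^esub> N"
      using abs[OF N Int_lower2 c(1)] abs[OF N Int_lower2 c(2)] c(3) by simp
    ultimately show "K \<in> subgroup_nhd G T H M \<inter> subgroup_nhd G T H N"
      using K by (auto simp: subgroup_nhd_def)
  qed
qed

lemma subgroup_nhd_eq:
  "K \<in> subgroup_nhd G T H N \<Longrightarrow> subgroup_nhd G T K N = subgroup_nhd G T H N"
  by (auto simp: subgroup_nhd_def)

lemma openin_subgroup_space: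
  assumes "topological_group G T"
  shows "openin (subgroup_space G T) U \<longleftrightarrow>
     U \<subseteq> closed_subgroups G T \<and>
     (\<forall>H\<in>U. \<exists>N. open_normal G T N \<and> subgroup_nhd G T H N \<subseteq> U)"
proof -
  let ?B = "{subgroup_nhd G T H N | H N. H \<in> closed_subgroups G T \<and> open_normal G T N}"
  interpret group G using assms by (simp add: topological_group_def)
  have refl: "H \<in> subgroup_nhd G T H N" if "H \<in> closed_subgroups G T" for H N
    using that by (simp add: subgroup_nhd_def)
  have "carrier G \<lhd> G"
    unfolding normal_inv_iff using subgroup_self by simp
  then have top: "open_normal G T (carrier G)"
    using assms by (metis open_normal_def topological_group_def openin_topspace)
  have "U \<subseteq> closed_subgroups G T \<and>
      (\<forall>H\<in>U. \<exists>N. open_normal G T N \<and> subgroup_nhd G T H N \<subseteq> U)"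
    if "generate_topology_on ?B U" for U
    using that
  proof induction
    case Empty
    then show ?case by simp
  next
    case (Int a b)
    show ?case
    proof (intro conjI ballI)
      show "a \<inter> b \<subseteq> closed_subgroups G T" using Int by auto
    next
      fix H assume H: "H \<in> a \<inter> b"
      obtain M where M: "open_normal G T M" "subgroup_nhd G T H M \<subseteq> a"
        using Int.IH(1) H by (meson IntD1)
      obtain N where N: "open_normal G T N" "subgroup_nhd G T H N \<subseteq> b"
        using Int.IH(2) H by (meson IntD2)
      have "H \<in> closed_subgroups G T" using Int.IH(1) H by (meson IntD1 subsetD)
      note MN = subgroup_nhd_Int[OF is_group M(1) N(1) this]
      show "\<exists>N. open_normal G T N \<and> subgroup_nhd G T H N \<subseteq> a \<inter> b"
        using MN(1) order_trans[OF MN(2) Int_mono[OF M(2) N(2)]] by blast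
    qed
  next
    case (UN K)
    show ?case
    proof (intro conjI ballI)
      show "\<Union>K \<subseteq> closed_subgroups G T" using UN by blast
    next
      fix H assume "H \<in> \<Union>K"
      then obtain k where "k \<in> K" "H \<in> k" by blast
      then obtain N where "open_normal G T N" "subgroup_nhd G T H N \<subseteq> k"
        using UN.IH by meson
      then show "\<exists>N. open_normal G T N \<and> subgroup_nhd G T H N \<subseteq> \<Union>K"
        using \<open>k \<in> K\<close> by blast
    qed
  next
    case (Basis s)
    then obtain H N where s: "s = subgroup_nhd G T H N" "open_normal G T N" by blast
    have "s \<subseteq> closed_subgroups G T"
      unfolding s(1) subgroup_nhd_def by blast
    moreover have "subgroup_nhd G T K N \<subseteq> s" if "K \<in> s" for K
      using subgroup_nhd_eq that unfolding s(1) by blast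
    ultimately show ?case
      using s(2) by blast
  qed
  moreover have "generate_topology_on ?B U"
    if U: "U \<subseteq> closed_subgroups G T"
      "\<forall>H\<in>U. \<exists>N. open_normal G T N \<and> subgroup_nhd G T H N \<subseteq> U"
  proof -
    have "U = \<Union>{V \<in> ?B. V \<subseteq> U}"
    proof (intro equalityI subsetI)
      fix H assume H: "H \<in> U"
      then obtain N where N: "open_normal G T N" "subgroup_nhd G T H N \<subseteq> U"
        using U(2) by meson
      have "H \<in> closed_subgroups G T"
        using H U(1) by blast
      then have "subgroup_nhd G T H N \<in> {V \<in> ?B. V \<subseteq> U}" "H \<in> subgroup_nhd G T H N"
        using N refl by auto
      then show "H \<in> \<Union>{V \<in> ?B. V \<subseteq> U}"
        by (rule UnionI)
    qed blast
    moreover have "generate_topology_on ?B (\<Union>{V \<in> ?B. V \<subseteq> U})"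
      by (rule generate_topology_on.UN) (auto intro: generate_topology_on.Basis)
    ultimately show ?thesis by simp
  qed
  ultimately show ?thesis
    unfolding subgroup_space_def openin_topology_generated_by_iff by blast
qed


section \<open>Topological notions\<close>

definition non_isolated_points :: "'a topology \<Rightarrow> 'a set" where
  "non_isolated_points X = topspace X - {x. openin X {x}}"

lemma non_isolated_points_eq_derived_set:
  "non_isolated_points X = X derived_set_of topspace X"
proof (intro equalityI subsetI)
  fix x assume x: "x \<in> non_isolated_points X"
  show "x \<in> X derived_set_of topspace X"
    unfolding in_derived_set_of
  proof (intro conjI allI impI)
    show "x \<in> topspace X" using x by (simp add: non_isolated_points_def)
  next
    fix T assume T: "x \<in> T \<and> openin X T"
    then have "T \<noteq> {x}" using x by (auto simp: non_isolated_points_def)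
    then show "\<exists>y\<noteq>x. y \<in> topspace X \<and> y \<in> T"
      using T openin_subset by fastforce
  qed
qed (force simp: non_isolated_points_def in_derived_set_of)

definition disjoint_union_topology :: "'a topology \<Rightarrow> 'b topology \<Rightarrow> ('a + 'b) topology" where
  "disjoint_union_topology X Y =
     topology (\<lambda>U. openin X (Inl -` U) \<and> openin Y (Inr -` U))"

lemma openin_disjoint_union_topology:
  "openin (disjoint_union_topology X Y) U \<longleftrightarrow> openin X (Inl -` U) \<and> openin Y (Inr -` U)"
proof -
  have "istopology (\<lambda>U. openin X (Inl -` U) \<and> openin Y (Inr -` U))"
    unfolding istopology_def
    by (intro conjI allI impI) (simp_all only: vimage_Int vimage_Union, auto)
  then show ?thesis
    by (simp only: disjoint_union_topology_def topology_inverse')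
qed

text \<open>The order topology on \<open>A\<close> for a strict linear order \<open>r\<close>, restricted to \<open>A\<close>.\<close>

definition order_topology_on :: "'a set \<Rightarrow> ('a \<times> 'a) set \<Rightarrow> 'a topology" where
  "order_topology_on A r =
     topology_generated_by
       ({A} \<union> {{x \<in> A. (x, a) \<in> r} | a. a \<in> A} \<union> {{x \<in> A. (a, x) \<in> r} | a. a \<in> A})"

text \<open>The ordinal \<open>\<omega>n + 1\<close>, i.e. the set of ordinals \<open>\<le> \<omega>n\<close>:
  the pair \<open>(i, j)\<close> stands for \<open>\<omega>i + j\<close>, so that the order is lexicographic.\<close>

definition omega_mult_plus_one :: "nat \<Rightarrow> (nat \<times> nat) topology" where
  "omega_mult_plus_one n =
     order_topology_on ({..<n} \<times> UNIV \<union> {(n, 0)}) (less_than <*lex*> less_than)"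


section \<open>Pelczynski space\<close>

text \<open>The endpoints of the closed intervals left at stage \<open>k\<close> of the middle-third
  construction.\<close>

fun cantor_intervals :: "nat \<Rightarrow> (real \<times> real) set" where
  "cantor_intervals 0 = {(0, 1)}"
| "cantor_intervals (Suc k) =
     (\<Union>(a, b) \<in> cantor_intervals k. {(a, a + (b - a) / 3), (b - (b - a) / 3, b)})"

text \<open>The endpoints of all the open intervals deleted.\<close>

definition cantor_gaps :: "(real \<times> real) set" where
  "cantor_gaps =
     (\<Union>k. (\<lambda>(a, b). (a + (b - a) / 3, b - (b - a) / 3)) ` cantor_intervals k)"

definition cantor_set :: "real set" where
  "cantor_set = {0..1} - (\<Union>(l, r) \<in> cantor_gaps. {l<..<r})"

definition pelczynski_space :: "real topology" where
  "pelczynski_space =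
     subtopology euclidean (cantor_set \<union> (\<lambda>(l, r). midpoint l r) ` cantor_gaps)"

end

theory Submission
  imports Defs "HOL-Algebra.Zassenhaus"
begin

text \<open>
  Write \<open>N k\<close> for the subgroup of \<open>Z\<close> that corresponds to \<open>p\<^sup>k \<int>\<^sub>p\<close>. A closed subgroup \<open>H\<close> that meets
  \<open>Z\<close> nontrivially contains some \<open>N k\<close> and is an isolated point of \<open>S(G)\<close>; if \<open>H \<inter> Z = 1\<close>, then \<open>H\<close> is the
  limit of the open subgroups \<open>H N k\<close>. So the isolated points are dense, and the derived set
  consists of the \<open>H\<close> with \<open>H \<inter> Z = 1\<close>. Such an \<open>H\<close> inside the centralizer of \<open>Z\<close> is determined
  by \<open>H Z\<close>, because \<open>Z\<close> is torsion-free; hence there are finitely many of these, \<open>n\<close> say, and they are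
  isolated in the derived set. If \<open>H\<close> does not centralize \<open>Z\<close>, its conjugates by elements of \<open>N k\<close>
  converge to \<open>H\<close> without being equal to it. So the derived set is a perfect set together with \<open>n\<close>
  further points, and \<open>S(G)\<close> being uncountable makes the perfect set nonempty. Compact Hausdorff
  spaces with a countable clopen base, dense isolated points and such a derived set are classified
  by \<open>n\<close>: match clopen subsets by a back-and-forth construction.
\<close>

section \<open>Back-and-forth for spaces with a clopen base\<close>

text \<open>On the group side three facts about \<open>Z\<close> carry the argument. Each
  \<open>N k\<close> is normal in \<open>G\<close>, because it is the set of \<open>p ^ k\<close>-th
  powers of \<open>Z\<close>. A closed subgroup containing an element of \<open>Z\<close> outside
  \<open>N (Suc k)\<close> contains \<open>N k\<close>. And \<open>Z\<close> is commutative and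
  torsion-free, so roots in it are unique. A conjugate of \<open>H\<close> by an element of
  \<open>N k\<close> that does not commute with \<open>H\<close> differs from \<open>H\<close>,
  since otherwise a nontrivial commutator would lie in both \<open>H\<close> and \<open>Z\<close>.

  On the topological side the obstacle is to choose invariants of clopen pieces that survive every
  cut: whether the piece meets the perfect set, how many of the \<open>n\<close> extra points it
  contains, and, when it is finite, its size. Perfectness allows a cut in which both halves meet the
  perfect set; density of the isolated points supplies the finite pieces.

  The number \<open>n\<close> is defined through the space of the group C_G(Z), not through that of
  \<open>G\<close>. It is reached by running the same analysis on C_G(Z), which contains
  \<open>Z\<close> and carries the same filtration: the derived set found there consists exactly of
  the \<open>n\<close> extra points.\<close>

lemma back_and_forth_homeomorphic_space:
  fixes X :: "'a topology" and Y :: "'b topology"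
  assumes cX: "compact_space X" and hX: "Hausdorff_space X" and cY: "compact_space Y" and hY: "Hausdorff_space Y"
    and BX: "countable BX" "\<And>U x. openin X U \<Longrightarrow> x \<in> U \<Longrightarrow> \<exists>B\<in>BX. x \<in> B \<and> B \<subseteq> U"
    and BY: "countable BY" "\<And>U x. openin Y U \<Longrightarrow> x \<in> U \<Longrightarrow> \<exists>B\<in>BY. x \<in> B \<and> B \<subseteq> U"
    and R0: "R (topspace X) (topspace Y)"
    and clopen: "\<And>A B. R A B \<Longrightarrow> openin X A \<and> closedin X A \<and> openin Y B \<and> closedin Y B"
    and empty: "\<And>A B. R A B \<Longrightarrow> A = {} \<longleftrightarrow> B = {}"
    and to: "\<And>A B U. R A B \<Longrightarrow> U \<in> BX \<Longrightarrow> \<exists>V. R (A \<inter> U) (B \<inter> V) \<and> R (A - U) (B - V)"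
    and fro: "\<And>A B V. R A B \<Longrightarrow> V \<in> BY \<Longrightarrow> \<exists>U. R (A \<inter> U) (B \<inter> V) \<and> R (A - U) (B - V)"
  shows "X homeomorphic_space Y"
proof (cases "topspace X = {} \<or> topspace Y = {}")
  case True
  with empty[OF R0] show ?thesis
    by (metis homeomorphic_empty_space_eq null_topspace_iff_trivial)
next
  case ne: False
  text \<open>The requirement \<open>w n\<close> asks that step \<open>n\<close> splits every matched pair along a given base set of \<open>X\<close>
    or of \<open>Y\<close>. The pairs obtained form a binary tree: \<open>A l\<close> and \<open>B l\<close> are matched at the node whose
    path to the root is \<open>l\<close>.\<close>
  define W where "W = Inl ` BX \<union> Inr ` BY"
  have "BX \<noteq> {}" using BX(2)[OF openin_topspace] ne by blast
  then have W: "countable W" "W \<noteq> {}" using BX(1) BY(1) by (auto simp: W_def)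
  define w where "w = from_nat_into W"
  have w: "w n \<in> W" for n by (simp add: W(2) from_nat_into w_def)
  have wsurj: "\<exists>n. w n = y" if "y \<in> W" for y
    using from_nat_into_surj[OF W(1) that] by (auto simp: w_def)
  \<comment> \<open>The requirement \<open>w n\<close> prescribes one component of
    \<open>UV\<close>; \<open>to\<close> or \<open>fro\<close> supplies the other.\<close>
  define good where "good A B n UV \<longleftrightarrow> R (A \<inter> fst UV) (B \<inter> snd UV) \<and> R (A - fst UV) (B - snd UV)
     \<and> (w n = Inl (fst UV) \<or> w n = Inr (snd UV))" for A B n UV
  define sp where "sp A B n = (SOME UV. good A B n UV)" for A B n
  have sp: "good A B n (sp A B n)" if "R A B" for A B n
  proof -
    have "\<exists>UV. good A B n UV"
      using w[of n] to[OF that] fro[OF that] unfolding W_def good_def by fastforce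
    then show ?thesis unfolding sp_def by (rule someI_ex)
  qed
  \<comment> \<open>The latest decision is the head of the list, so \<open>length l\<close> is both
    the depth of the node and the index of the requirement treated there.\<close>
  define c where "c = rec_list (topspace X, topspace Y)
     (\<lambda>b l AB. let UV = sp (fst AB) (snd AB) (length l) in
        if b then (fst AB \<inter> fst UV, snd AB \<inter> snd UV) else (fst AB - fst UV, snd AB - snd UV))"
  define A where "A l = fst (c l)" for l
  define B where "B l = snd (c l)" for l
  define UV where "UV l = sp (A l) (B l) (length l)" for l
  have c0: "A [] = topspace X" "B [] = topspace Y" by (simp_all add: A_def B_def c_def)
  have cS: "A (b # l) = (if b then A l \<inter> fst (UV l) else A l - fst (UV l))"
      "B (b # l) = (if b then B l \<inter> snd (UV l) else B l - snd (UV l))" for b l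
    by (simp_all add: A_def B_def c_def UV_def Let_def)
  have R: "R (A l) (B l)" for l
  proof (induction l)
    case (Cons b l)
    then show ?case using sp[OF Cons, of "length l"] by (simp add: cS UV_def good_def)
  qed (simp add: c0 R0)
  have g: "good (A l) (B l) (length l) (UV l)" for l
    unfolding UV_def using sp R by blast
  \<comment> \<open>The address of a point: \<open>lx x n\<close> is the only node of depth
    \<open>n\<close> whose \<open>A\<close>-set contains \<open>x\<close>, and \<open>ly\<close>
    plays the same part for \<open>B\<close>.\<close>
  define lx where "lx x = rec_nat [] (\<lambda>_ l. (x \<in> A (True # l)) # l)" for x
  define ly where "ly y = rec_nat [] (\<lambda>_ l. (y \<in> B (True # l)) # l)" for y
  have len: "length (lx x n) = n" "length (ly y n) = n" for x y n
    by (induction n) (simp_all add: lx_def ly_def)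
  have lxS: "lx x (Suc n) = (x \<in> A (True # lx x n)) # lx x n" for x n by (simp add: lx_def)
  have lyS: "ly y (Suc n) = (y \<in> B (True # ly y n)) # ly y n" for y n by (simp add: ly_def)
  have inA: "x \<in> A (lx x n)" if "x \<in> topspace X" for x n
    using that by (induction n) (auto simp: lxS c0 cS, simp add: lx_def c0)
  have inB: "y \<in> B (ly y n)" if "y \<in> topspace Y" for y n
    using that by (induction n) (auto simp: lyS c0 cS, simp add: ly_def c0)
  have uniqA: "l = lx x (length l)" if "x \<in> A l" for x l
    using that by (induction l) (auto simp: lxS cS lx_def split: if_splits)
  have uniqB: "l = ly y (length l)" if "y \<in> B l" for y l
    using that by (induction l) (auto simp: lyS cS ly_def split: if_splits)
  have Asub: "A l \<subseteq> topspace X" "B l \<subseteq> topspace Y" for l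
    using clopen[OF R[of l]] closedin_subset by auto
  \<comment> \<open>The cut made for requirement \<open>n\<close> at depth \<open>n\<close> is
    inherited by all descendants, whose sets only shrink.\<close>
  have decideX: "A l \<subseteq> U \<or> A l \<inter> U = {}" if "w n = Inl U" "n < length l" for l n U
    using that
  proof (induction l)
    case (Cons b l)
    show ?case
    proof (cases "n < length l")
      case True
      with Cons have "A l \<subseteq> U \<or> A l \<inter> U = {}" by simp
      then show ?thesis by (auto simp: cS)
    next
      case False
      with Cons.prems have "n = length l" by simp
      with g[of l] Cons.prems have "fst (UV l) = U" by (auto simp: good_def)
      then show ?thesis by (auto simp: cS)
    qed
  qed simp
  have decideY: "B l \<subseteq> U \<or> B l \<inter> U = {}" if "w n = Inr U" "n < length l" for l n U
    using that
  proof (induction l)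
    case (Cons b l)
    show ?case
    proof (cases "n < length l")
      case True
      with Cons have "B l \<subseteq> U \<or> B l \<inter> U = {}" by simp
      then show ?thesis by (auto simp: cS)
    next
      case False
      with Cons.prems have "n = length l" by simp
      with g[of l] Cons.prems have "snd (UV l) = U" by (auto simp: good_def)
      then show ?thesis by (auto simp: cS)
    qed
  qed simp
  \<comment> \<open>The \<open>B\<close>-sets along the address of \<open>x\<close> are nested,
    closed and, being matched with sets containing \<open>x\<close>, nonempty; compactness gives a
    common point.\<close>
  have exY: "\<exists>y. \<forall>n. y \<in> B (lx x n)" if "x \<in> topspace X" for x
  proof -
    have "(\<Inter>n. B (lx x n)) \<noteq> {}"
    proof (rule compact_space_imp_nest[OF cY])
      show "closedin Y (B (lx x n))" for n using clopen[OF R] by blast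
      show "B (lx x n) \<noteq> {}" for n using empty[OF R[of "lx x n"]] inA[OF that] by blast
      show "decseq (\<lambda>n. B (lx x n))" by (rule decseq_SucI) (auto simp: lxS cS)
    qed
    then show ?thesis by auto
  qed
  have exX: "\<exists>x. \<forall>n. x \<in> A (ly y n)" if "y \<in> topspace Y" for y
  proof -
    have "(\<Inter>n. A (ly y n)) \<noteq> {}"
    proof (rule compact_space_imp_nest[OF cX])
      show "closedin X (A (ly y n))" for n using clopen[OF R] by blast
      show "A (ly y n) \<noteq> {}" for n using empty[OF R[of "ly y n"]] inB[OF that] by blast
      show "decseq (\<lambda>n. A (ly y n))" by (rule decseq_SucI) (auto simp: lyS cS)
    qed
    then show ?thesis by auto
  qed
  \<comment> \<open>\<open>f\<close> sends a point to one with the same address. The choice is in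
    fact forced, because \<open>sepY\<close> shows that an address determines its point.\<close>
  define f where "f x = (SOME y. \<forall>n. y \<in> B (lx x n))" for x
  have f: "f x \<in> B (lx x n)" if "x \<in> topspace X" for x n
    using someI_ex[OF exY[OF that]] by (auto simp: f_def)
  have lyf: "ly (f x) n = lx x n" if "x \<in> topspace X" for x n
    using uniqB[OF f[OF that, of n]] by (simp add: len)
  have sepY: "y = y'" if y: "y \<in> topspace Y" "y' \<in> topspace Y" "\<And>n. ly y n = ly y' n" for y y'
  proof (rule ccontr)
    assume "y \<noteq> y'"
    then obtain U where U: "openin Y U" "y \<in> U" "y' \<notin> U"
      using hY y unfolding Hausdorff_space_def disjnt_def by (metis disjoint_iff)
    then obtain V where V: "V \<in> BY" "y \<in> V" "V \<subseteq> U" using BY(2) by blast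
    then obtain n where n: "w n = Inr V" using wsurj[of "Inr V"] by (auto simp: W_def)
    have "B (ly y (Suc n)) \<subseteq> V \<or> B (ly y (Suc n)) \<inter> V = {}"
      by (rule decideY[OF n]) (simp add: len)
    with inB[OF y(1), of "Suc n"] inB[OF y(2), of "Suc n"] y(3)[of "Suc n"] V U show False by auto
  qed
  have sepX: "x = x'" if x: "x \<in> topspace X" "x' \<in> topspace X" "\<And>n. lx x n = lx x' n" for x x'
  proof (rule ccontr)
    assume "x \<noteq> x'"
    then obtain U where U: "openin X U" "x \<in> U" "x' \<notin> U"
      using hX x unfolding Hausdorff_space_def disjnt_def by (metis disjoint_iff)
    then obtain V where V: "V \<in> BX" "x \<in> V" "V \<subseteq> U" using BX(2) by blast
    then obtain n where n: "w n = Inl V" using wsurj[of "Inl V"] by (auto simp: W_def)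
    have "A (lx x (Suc n)) \<subseteq> V \<or> A (lx x (Suc n)) \<inter> V = {}"
      by (rule decideX[OF n]) (simp add: len)
    with inA[OF x(1), of "Suc n"] inA[OF x(2), of "Suc n"] x(3)[of "Suc n"] V U show False by auto
  qed
  have fY: "f x \<in> topspace Y" if "x \<in> topspace X" for x
    using f[OF that] Asub(2) by blast
  have "homeomorphic_map X Y f"
  proof (rule continuous_imp_homeomorphic_map[OF _ cX hY])
    show "continuous_map X Y f"
      unfolding continuous_map_def
    proof (intro conjI allI impI)
      show "f \<in> topspace X \<rightarrow> topspace Y" using fY by blast
    next
      fix U assume U: "openin Y U"
      show "openin X {x \<in> topspace X. f x \<in> U}"
      proof (subst openin_subopen, intro ballI)
        fix x assume "x \<in> {x \<in> topspace X. f x \<in> U}"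
        then have x: "x \<in> topspace X" "f x \<in> U" by auto
        then obtain V where V: "V \<in> BY" "f x \<in> V" "V \<subseteq> U" using BY(2)[OF U] by blast
        then obtain n where n: "w n = Inr V" using wsurj[of "Inr V"] by (auto simp: W_def)
        let ?l = "lx x (Suc n)"
        have "B ?l \<subseteq> V \<or> B ?l \<inter> V = {}" by (rule decideY[OF n]) (simp add: len)
        then have BU: "B ?l \<subseteq> U" using f[OF x(1), of "Suc n"] V by blast
        \<comment> \<open>All points of \<open>A ?l\<close> share the first \<open>Suc n\<close>
          decisions, so their images stay in \<open>B ?l\<close>; this is the continuity of
          \<open>f\<close>.\<close>
        have "A ?l \<subseteq> {x \<in> topspace X. f x \<in> U}"
        proof
          fix z assume z: "z \<in> A ?l"
          then have "?l = lx z (Suc n)" using uniqA[OF z] by (simp add: len)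
          moreover have "z \<in> topspace X" using z Asub by blast
          ultimately show "z \<in> {x \<in> topspace X. f x \<in> U}" using f[of z "Suc n"] BU by auto
        qed
        then show "\<exists>T. openin X T \<and> x \<in> T \<and> T \<subseteq> {x \<in> topspace X. f x \<in> U}"
          using inA[OF x(1)] clopen[OF R] by blast
      qed
    qed
    show "f ` topspace X = topspace Y"
    proof
      show "f ` topspace X \<subseteq> topspace Y" using fY by blast
      show "topspace Y \<subseteq> f ` topspace X"
      proof
        fix y assume y: "y \<in> topspace Y"
        then obtain x where x: "\<And>n. x \<in> A (ly y n)" using exX by blast
        then have xX: "x \<in> topspace X" using Asub by blast
        have "ly (f x) n = ly y n" for n
          using uniqA[OF x[of n]] lyf[OF xX] by (simp add: len)
        then show "y \<in> f ` topspace X" using sepY[OF fY[OF xX] y] xX by blast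
      qed
    qed
    show "inj_on f (topspace X)"
    proof (rule inj_onI)
      fix x x' assume a: "x \<in> topspace X" "x' \<in> topspace X" "f x = f x'"
      have "lx x n = lx x' n" for n using lyf[OF a(1), of n] lyf[OF a(2), of n] a(3) by simp
      then show "x = x'" using sepX[OF a(1,2)] by blast
    qed
  qed
  then show ?thesis using homeomorphic_map_imp_homeomorphic_space by blast
qed

section \<open>Spaces whose derived set is perfect up to finitely many points\<close>

text \<open>\<open>K\<close> is the perfect part of the derived set and \<open>F\<close> the finite
  remainder. \<open>K\<close> may be empty, so that \<omega>n + 1 also fits and the type is closed
  under topological sums; the uniqueness theorem asks separately for nonempty
  \<open>K\<close>.\<close>

locale pelczynski_type =
  fixes X :: "'a topology" and K F :: "'a set"
  assumes compact: "compact_space X" and Hausdorff: "Hausdorff_space X"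
    and clopen_base: "\<exists>B. countable B \<and> (\<forall>U\<in>B. openin X U \<and> closedin X U) \<and>
      (\<forall>U x. openin X U \<longrightarrow> x \<in> U \<longrightarrow> (\<exists>V\<in>B. x \<in> V \<and> V \<subseteq> U))"
    and derived: "non_isolated_points X = K \<union> F" and disjoint: "K \<inter> F = {}" and finite_F: "finite F"
    and closed_K: "closedin X K"
    and dense_isolated: "\<And>U. openin X U \<Longrightarrow> U \<noteq> {} \<Longrightarrow> \<exists>x\<in>U. openin X {x}"
    and perfect: "\<And>U x. openin X U \<Longrightarrow> x \<in> U \<Longrightarrow> x \<in> K \<Longrightarrow> \<exists>y\<in>U \<inter> K. y \<noteq> x"
begin

lemma isolated_iff: "x \<in> topspace X \<Longrightarrow> openin X {x} \<longleftrightarrow> x \<notin> K \<union> F"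
  using derived by (auto simp: non_isolated_points_def)

lemma sub_topspace: "K \<union> F \<subseteq> topspace X"
  using derived by (auto simp: non_isolated_points_def)

lemma closed_finite: "finite S \<Longrightarrow> S \<subseteq> topspace X \<Longrightarrow> closedin X S"
  using Hausdorff Hausdorff_imp_t1_space t1_space_closedin_finite by blast

lemma open_isolated: "(\<And>x. x \<in> S \<Longrightarrow> openin X {x}) \<Longrightarrow> openin X S"
  by (subst openin_subopen) blast

text \<open>Finitely many base sets suffice to cover \<open>S\<close> inside \<open>U\<close>, and a
  finite union of clopen sets is clopen. This is the source of all cuts with prescribed points on
  either side.\<close>

lemma separate:
  assumes "finite S" "S \<subseteq> U" "openin X U"
  obtains W where "openin X W" "closedin X W" "S \<subseteq> W" "W \<subseteq> U"
proof -
  obtain B where B: "\<And>U. U \<in> B \<Longrightarrow> openin X U \<and> closedin X U"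
    "\<And>U x. openin X U \<Longrightarrow> x \<in> U \<Longrightarrow> \<exists>V\<in>B. x \<in> V \<and> V \<subseteq> U" using clopen_base by metis
  have "\<forall>s\<in>S. \<exists>V\<in>B. s \<in> V \<and> V \<subseteq> U" using B(2) assms by blast
  then obtain V where V: "\<And>s. s \<in> S \<Longrightarrow> V s \<in> B \<and> s \<in> V s \<and> V s \<subseteq> U" by metis
  show thesis
  proof
    show "openin X (\<Union>(V ` S))" "closedin X (\<Union>(V ` S))"
      using V B(1) assms(1) by (auto intro!: closedin_Union)
  qed (use V in auto)
qed

text \<open>A finite open set in a T1 space consists of isolated points; conversely a compact set of
  isolated points is covered by finitely many singletons. Finiteness of a clopen piece can thus be
  read off from its trace on \<open>K \<union> F\<close>.\<close>

lemma finite_clopen_iff: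
  assumes "openin X A" "closedin X A"
  shows "finite A \<longleftrightarrow> A \<inter> (K \<union> F) = {}"
proof
  have AX: "A \<subseteq> topspace X" using assms(1) openin_subset by blast
  assume "finite A"
  have "openin X {a}" if "a \<in> A" for a
  proof -
    have "openin X (A - (A - {a}))"
      by (rule openin_diff[OF assms(1) closed_finite]) (use \<open>finite A\<close> AX in auto)
    also have "A - (A - {a}) = {a}" using that by auto
    finally show ?thesis .
  qed
  then show "A \<inter> (K \<union> F) = {}" using isolated_iff AX by blast
next
  have AX: "A \<subseteq> topspace X" using assms(1) openin_subset by blast
  assume "A \<inter> (K \<union> F) = {}"
  then have iso: "openin X {a}" if "a \<in> A" for a using isolated_iff AX that by blast
  have "compactin X A" using assms(2) closedin_compact_space compact by blast
  then have "\<exists>\<F>. finite \<F> \<and> \<F> \<subseteq> (\<lambda>a. {a}) ` A \<and> A \<subseteq> \<Union>\<F>"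
    unfolding compactin_def using iso by auto
  then obtain \<F> where "finite \<F>" "\<F> \<subseteq> (\<lambda>a. {a}) ` A" "A \<subseteq> \<Union>\<F>" by blast
  moreover from this have "finite (\<Union>\<F>)" by (intro finite_Union) auto
  ultimately show "finite A" using finite_subset by blast
qed

text \<open>If the set \<open>J\<close> of isolated points of \<open>A\<close> is finite, then
  \<open>A - J\<close> is open without isolated points, hence empty by density, and \<open>A\<close>
  equals \<open>J\<close>.\<close>

lemma isolated_subset:
  assumes "openin X A" "infinite A \<or> n \<le> card A"
  obtains I where "finite I" "card I = n" "I \<subseteq> A" "\<And>x. x \<in> I \<Longrightarrow> openin X {x}"
proof -
  define J where "J = {x \<in> A. openin X {x}}"
  have "A \<subseteq> J" if "finite J"
  proof (rule ccontr)
    assume "\<not> A \<subseteq> J"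
    have "openin X (A - J)"
      by (rule openin_diff[OF assms(1) closed_finite]) (use that openin_subset[OF assms(1)] J_def in auto)
    then obtain x where "x \<in> A - J" "openin X {x}" using dense_isolated \<open>\<not> A \<subseteq> J\<close> by blast
    then show False by (auto simp: J_def)
  qed
  then have "infinite J \<or> n \<le> card J"
    using assms(2) by (metis card_mono finite_subset order_trans)
  then obtain I where "finite I" "card I = n" "I \<subseteq> J"
    by (meson infinite_arbitrarily_large obtain_subset_with_card_n)
  then show thesis using that by (auto simp: J_def)
qed

end

text \<open>The cardinal of an infinite set is \<open>0\<close>, so the last two conditions say that \<open>A\<close> and \<open>B\<close> are both
  infinite or have the same finite number of points.\<close>

definition clopen_match :: "'a topology \<Rightarrow> 'a set \<Rightarrow> 'a set \<Rightarrow> 'b topology \<Rightarrow> 'b set \<Rightarrow> 'b set \<Rightarrow> 'a set \<Rightarrow> 'b set \<Rightarrow> bool" where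
  "clopen_match X K F Y L E A B \<longleftrightarrow>
     openin X A \<and> closedin X A \<and> openin Y B \<and> closedin Y B \<and>
     (A \<inter> K = {} \<longleftrightarrow> B \<inter> L = {}) \<and> card (A \<inter> F) = card (B \<inter> E) \<and>
     (finite A \<longleftrightarrow> finite B) \<and> card A = card B"

lemma clopen_match_commute:
  "clopen_match X K F Y L E A B \<longleftrightarrow> clopen_match Y L E X K F B A"
  by (auto simp: clopen_match_def)

locale pelczynski_type_pair = X: pelczynski_type X K F + Y: pelczynski_type Y L E
  for X :: "'a topology" and K F and Y :: "'b topology" and L E
begin

text \<open>A finite clopen piece consists of isolated points, so equally many isolated points of
  \<open>B\<close> answer it, and neither complement loses points of the derived set.\<close>

lemma match_finite:
  assumes AB: "clopen_match X K F Y L E A B" and A1: "openin X A1" "closedin X A1" "A1 \<subseteq> A" "finite A1"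
  shows "\<exists>B1. B1 \<subseteq> B \<and> clopen_match X K F Y L E A1 B1 \<and> clopen_match X K F Y L E (A - A1) (B - B1)"
proof -
  note ab = AB[unfolded clopen_match_def]
  have "infinite B \<or> card A1 \<le> card B" using ab A1 by (metis card_mono)
  then obtain I where I: "finite I" "card I = card A1" "I \<subseteq> B" "\<And>x. x \<in> I \<Longrightarrow> openin Y {x}"
    using Y.isolated_subset ab by metis
  have IY: "I \<subseteq> topspace Y" using I(4) openin_subset by blast
  have cI: "openin Y I" "closedin Y I"
    using Y.open_isolated I Y.closed_finite IY by auto
  have d: "A1 \<inter> (K \<union> F) = {}" "I \<inter> (L \<union> E) = {}"
    using X.finite_clopen_iff Y.finite_clopen_iff A1 cI I by auto
  have e: "A1 \<inter> K = {}" "A1 \<inter> F = {}" "I \<inter> L = {}" "I \<inter> E = {}"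
      "(A - A1) \<inter> K = A \<inter> K" "(A - A1) \<inter> F = A \<inter> F" "(B - I) \<inter> L = B \<inter> L" "(B - I) \<inter> E = B \<inter> E"
    using d by auto
  have m1: "clopen_match X K F Y L E A1 I"
    unfolding clopen_match_def using A1 cI I e by simp
  have "finite (A - A1) \<longleftrightarrow> finite (B - I)" using ab A1 I by simp
  moreover have "card (A - A1) = card (B - I)"
    using ab A1 I by (simp add: card_Diff_subset)
  ultimately have "clopen_match X K F Y L E (A - A1) (B - I)"
    unfolding clopen_match_def using A1 cI ab e by (simp add: openin_diff closedin_diff)
  with m1 I(3) show ?thesis by blast
qed

text \<open>A piece that is finite or has finite complement is left to \<open>match_finite\<close>.
  If both halves are infinite, sizes impose nothing further, and it remains to distribute the points
  of \<open>E\<close> and \<open>L\<close> correctly.\<close>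

lemma match_split:
  assumes AB: "clopen_match X K F Y L E A B" and A1: "openin X A1" "closedin X A1" "A1 \<subseteq> A"
  shows "\<exists>B1. B1 \<subseteq> B \<and> clopen_match X K F Y L E A1 B1 \<and> clopen_match X K F Y L E (A - A1) (B - B1)"
proof -
  note ab = AB[unfolded clopen_match_def]
  define A2 where "A2 = A - A1"
  have A2: "openin X A2" "closedin X A2" "A2 \<subseteq> A" "A - A2 = A1"
    using ab A1 by (auto simp: A2_def openin_diff closedin_diff)
  consider "finite A1" | "finite A2" | "infinite A1" "infinite A2" by blast
  then show ?thesis
  proof cases
    case 1 then show ?thesis using match_finite AB A1 by blast
  next
    case 2
    then obtain B2 where "B2 \<subseteq> B" "clopen_match X K F Y L E A2 B2" "clopen_match X K F Y L E A1 (B - B2)"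
      using match_finite[OF AB A2(1-3)] A2(4) by metis
    moreover from this have "B - (B - B2) = B2" by blast
    ultimately show ?thesis unfolding A2_def by (metis Diff_subset)
  next
    case 3
    have finE: "finite (B \<inter> E)" and finF: "finite (A \<inter> F)" using Y.finite_F X.finite_F by auto
    \<comment> \<open>\<open>S1\<close> collects the points of \<open>E\<close> that go to the side
      of \<open>A1\<close>; the count for the rest \<open>S2\<close> then agrees with
      \<open>A2\<close>.\<close>
    have "card (A1 \<inter> F) \<le> card (B \<inter> E)"
      using ab card_mono[OF finF, of "A1 \<inter> F"] A1(3) by auto
    then obtain S1 where S1: "S1 \<subseteq> B \<inter> E" "card S1 = card (A1 \<inter> F)"
      using obtain_subset_with_card_n by metis
    define S2 where "S2 = B \<inter> E - S1"
    have fS: "finite S1" "finite S2" using finite_subset[OF S1(1) finE] finE by (auto simp: S2_def)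
    have "A2 \<inter> F = A \<inter> F - A1 \<inter> F" by (auto simp: A2_def)
    moreover have "card (A \<inter> F - A1 \<inter> F) = card (A \<inter> F) - card (A1 \<inter> F)"
      using A1(3) X.finite_F by (intro card_Diff_subset) auto
    ultimately have S2: "card S2 = card (A2 \<inter> F)"
      using S1 fS ab by (simp add: S2_def card_Diff_subset)
    have BY: "B \<subseteq> topspace Y" using ab openin_subset by blast
    \<comment> \<open>Both halves of \<open>B\<close> come out infinite: \<open>A1\<close> and
      \<open>A2\<close> are infinite, hence meet \<open>K \<union> F\<close>, and the prescribed
      traces carry this over to \<open>L \<union> E\<close>.\<close>
    have key: ?thesis if "openin Y B1" "closedin Y B1" "B1 \<subseteq> B" "S1 \<subseteq> B1" "B1 \<inter> S2 = {}"
        "A1 \<inter> K = {} \<longleftrightarrow> B1 \<inter> L = {}" "A2 \<inter> K = {} \<longleftrightarrow> (B - B1) \<inter> L = {}" for B1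
    proof -
      have E: "B1 \<inter> E = S1" "(B - B1) \<inter> E = S2" using that S1 by (auto simp: S2_def)
      have cB2: "openin Y (B - B1)" "closedin Y (B - B1)"
        using that ab by (auto simp: openin_diff closedin_diff)
      have fF: "finite (A1 \<inter> F)" "finite (A2 \<inter> F)" using X.finite_F by auto
      have ne: "A1 \<inter> (K \<union> F) \<noteq> {}" "A2 \<inter> (K \<union> F) \<noteq> {}"
        using X.finite_clopen_iff[OF A1(1,2)] X.finite_clopen_iff[OF A2(1,2)] 3 by auto
      have "B1 \<inter> (L \<union> E) \<noteq> {}"
        using ne(1) that(6) S1(2) E(1) fF fS by (metis Int_Un_distrib Un_empty card_0_eq)
      moreover have "(B - B1) \<inter> (L \<union> E) \<noteq> {}"
        using ne(2) that(7) S2 E(2) fF fS by (metis Int_Un_distrib Un_empty card_0_eq)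
      ultimately have inf: "infinite B1" "infinite (B - B1)"
        using Y.finite_clopen_iff that cB2 by blast+
      have "clopen_match X K F Y L E A1 B1" "clopen_match X K F Y L E A2 (B - B1)"
        unfolding clopen_match_def using A1 A2 that cB2 E S1 S2 3 inf by simp_all
      then show ?thesis using that(3) by (auto simp: A2_def)
    qed
    have sub: "S1 \<subseteq> B" "S2 \<subseteq> B" "S1 \<inter> S2 = {}" "S1 \<inter> L = {}" "S2 \<inter> L = {}"
      using S1 Y.disjoint by (auto simp: S2_def)
    have cS: "closedin Y S" if "finite S" "S \<subseteq> B" for S
      using that BY Y.closed_finite by blast
    have AK: "A \<inter> K = (A1 \<inter> K) \<union> (A2 \<inter> K)" using A1 by (auto simp: A2_def)
    \<comment> \<open>The cases decide where \<open>L\<close> goes. If one half of \<open>A\<close>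
      misses \<open>K\<close>, the corresponding half of \<open>B\<close> is built inside the
      complement of \<open>L\<close>; otherwise both halves must receive a point of
      \<open>L\<close>.\<close>
    consider "A1 \<inter> K = {}" | "A1 \<inter> K \<noteq> {}" "A2 \<inter> K = {}" | "A1 \<inter> K \<noteq> {}" "A2 \<inter> K \<noteq> {}" by blast
    then show ?thesis
    proof cases
      case 1
      have o: "openin Y (B - (S2 \<union> L))"
        using ab cS[OF fS(2)] sub Y.closed_K by (auto intro!: openin_diff closedin_Un)
      have s: "S1 \<subseteq> B - (S2 \<union> L)" using sub by auto
      obtain V where V: "openin Y V" "closedin Y V" "S1 \<subseteq> V" "V \<subseteq> B - (S2 \<union> L)"
        by (rule Y.separate[OF fS(1) s o])
      have "V \<inter> L = {}" "(B - V) \<inter> L = B \<inter> L" using V by auto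
      moreover have "V \<subseteq> B" "V \<inter> S2 = {}" using V(4) by auto
      ultimately show ?thesis using key[of V] V(1-3) 1 AK ab by simp
    next
      case 2
      have o: "openin Y (B - (S1 \<union> L))"
        using ab cS[OF fS(1)] sub Y.closed_K by (auto intro!: openin_diff closedin_Un)
      have s: "S2 \<subseteq> B - (S1 \<union> L)" using sub by auto
      obtain V where V: "openin Y V" "closedin Y V" "S2 \<subseteq> V" "V \<subseteq> B - (S1 \<union> L)"
        by (rule Y.separate[OF fS(2) s o])
      have e: "(B - V) \<inter> L = B \<inter> L" "(B - (B - V)) \<inter> L = {}" using V by auto
      show ?thesis
      proof (rule key[of "B - V"])
        show "openin Y (B - V)" "closedin Y (B - V)" using ab V by (auto simp: openin_diff closedin_diff)
        show "S1 \<subseteq> B - V" "(B - V) \<inter> S2 = {}" using V(3,4) sub by auto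
      qed (use 2 AK ab e in auto)
    next
      \<comment> \<open>Perfectness turns one point of \<open>L\<close> in \<open>B\<close> into
        two; \<open>l1\<close> is forced into \<open>V\<close> and \<open>l2\<close> out of
        it.\<close>
      case 3
      then obtain l1 where l1: "l1 \<in> B" "l1 \<in> L" using AK ab by auto
      then obtain l2 where l2: "l2 \<in> B" "l2 \<in> L" "l2 \<noteq> l1" using Y.perfect[of B l1] ab by blast
      have o: "openin Y (B - insert l2 S2)"
        using ab cS[of "insert l2 S2"] fS sub l2 by (intro openin_diff) auto
      have s: "insert l1 S1 \<subseteq> B - insert l2 S2" using sub l1 l2 by auto
      have fin: "finite (insert l1 S1)" using fS by simp
      obtain V where V: "openin Y V" "closedin Y V" "insert l1 S1 \<subseteq> V" "V \<subseteq> B - insert l2 S2"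
        by (rule Y.separate[OF fin s o])
      show ?thesis 
      proof (rule key[of V])
        show "(A1 \<inter> K = {}) = (V \<inter> L = {})" using 3 V(3) l1 by blast
        show "(A2 \<inter> K = {}) = ((B - V) \<inter> L = {})" using 3 V(4) l2 by blast
      qed (use V in auto)
    qed
  qed
qed

end

text \<open>Nonempty \<open>K\<close> and \<open>L\<close> make both whole spaces infinite, so they
  form a matched pair from which the back-and-forth can start.\<close>

theorem pelczynski_type_unique:
  assumes X: "pelczynski_type X K F" and Y: "pelczynski_type Y L E" and c: "card F = card E"
    and KL: "K \<noteq> {}" "L \<noteq> {}"
  shows "X homeomorphic_space Y"
proof -
  interpret XY: pelczynski_type_pair X K F Y L E
    using X Y by (simp add: pelczynski_type_pair_def)
  interpret YX: pelczynski_type_pair Y L E X K F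
    using X Y by (simp add: pelczynski_type_pair_def)
  let ?R = "clopen_match X K F Y L E"
  obtain BX where BX: "countable BX" "\<And>U. U \<in> BX \<Longrightarrow> openin X U \<and> closedin X U"
    "\<And>U x. openin X U \<Longrightarrow> x \<in> U \<Longrightarrow> \<exists>V\<in>BX. x \<in> V \<and> V \<subseteq> U" using XY.X.clopen_base by metis
  obtain BY where BY: "countable BY" "\<And>U. U \<in> BY \<Longrightarrow> openin Y U \<and> closedin Y U"
    "\<And>U x. openin Y U \<Longrightarrow> x \<in> U \<Longrightarrow> \<exists>V\<in>BY. x \<in> V \<and> V \<subseteq> U" using XY.Y.clopen_base by metis
  show ?thesis
  proof (rule back_and_forth_homeomorphic_space[where R = ?R and BX = BX and BY = BY])
    have i: "topspace X \<inter> K = K" "topspace X \<inter> F = F" "topspace Y \<inter> L = L" "topspace Y \<inter> E = E"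
      using XY.X.sub_topspace XY.Y.sub_topspace by auto
    have "infinite (topspace X)" "infinite (topspace Y)"
      using XY.X.finite_clopen_iff[of "topspace X"] XY.Y.finite_clopen_iff[of "topspace Y"] i KL by auto
    then show "?R (topspace X) (topspace Y)"
      using i c KL by (simp add: clopen_match_def)
    show "openin X A \<and> closedin X A \<and> openin Y B \<and> closedin Y B" if "?R A B" for A B
      using that by (simp add: clopen_match_def)
    show "A = {} \<longleftrightarrow> B = {}" if "?R A B" for A B
      using that unfolding clopen_match_def by (cases "finite A") auto
    show "\<exists>V. ?R (A \<inter> U) (B \<inter> V) \<and> ?R (A - U) (B - V)" if "?R A B" "U \<in> BX" for A B U
    proof -
      have "openin X (A \<inter> U)" "closedin X (A \<inter> U)" "A \<inter> U \<subseteq> A"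
        using that BX(2) by (auto simp: clopen_match_def)
      from XY.match_split[OF that(1) this] obtain B1 where
        "B1 \<subseteq> B" "?R (A \<inter> U) B1" "?R (A - A \<inter> U) (B - B1)" by blast
      then show ?thesis by (intro exI[of _ B1]) (simp add: Int_absorb1 Diff_Int)
    qed
    show "\<exists>U. ?R (A \<inter> U) (B \<inter> V) \<and> ?R (A - U) (B - V)" if "?R A B" "V \<in> BY" for A B V
    proof -
      have "openin Y (B \<inter> V)" "closedin Y (B \<inter> V)" "B \<inter> V \<subseteq> B"
        using that BY(2) by (auto simp: clopen_match_def)
      from YX.match_split[OF that(1)[THEN clopen_match_commute[THEN iffD1]] this] obtain A1 where
        "A1 \<subseteq> A" "?R A1 (B \<inter> V)" "?R (A - A1) (B - B \<inter> V)"
        unfolding clopen_match_commute[of Y] by blast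
      then show ?thesis by (intro exI[of _ A1]) (simp add: Int_absorb1 Diff_Int)
    qed
  qed (use XY.X.compact XY.X.Hausdorff XY.Y.compact XY.Y.Hausdorff BX BY in auto)
qed

section \<open>Pelczynski space\<close>

text \<open>An interval whose endpoints lie outside \<open>S\<close> has the same trace on
  \<open>S\<close> whether it is taken open or closed, so the trace is clopen.\<close>

lemma countable_clopen_base_real_subset:
  fixes S :: "real set"
  assumes gaps: "\<And>x y. x < y \<Longrightarrow> \<exists>t. x < t \<and> t < y \<and> t \<notin> S"
  shows "\<exists>B. countable B \<and> (\<forall>U\<in>B. openin (top_of_set S) U \<and> closedin (top_of_set S) U) \<and>
      (\<forall>U x. openin (top_of_set S) U \<longrightarrow> x \<in> U \<longrightarrow> (\<exists>V\<in>B. x \<in> V \<and> V \<subseteq> U))"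
proof -
  define t where "t x y = (SOME t. x < t \<and> t < y \<and> t \<notin> S)" for x y
  have t: "x < t x y \<and> t x y < y \<and> t x y \<notin> S" if "x < y" for x y
    unfolding t_def by (rule someI_ex[OF gaps[OF that]])
  \<comment> \<open>One point outside \<open>S\<close> between any two rationals: a countable set of
    endpoints that is still dense in the line.\<close>
  define D where "D = (\<lambda>(x, y). t x y) ` {(x, y). x \<in> \<rat> \<and> y \<in> \<rat> \<and> x < y}"
  have "countable ((\<rat> :: real set) \<times> (\<rat> :: real set))" by (intro countable_SIGMA countable_rat)
  moreover have "{(x, y). x \<in> \<rat> \<and> y \<in> \<rat> \<and> x < y} \<subseteq> (\<rat> :: real set) \<times> (\<rat> :: real set)" by auto
  ultimately have D: "countable D" unfolding D_def by (meson countable_image countable_subset)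
  have DS: "D \<inter> S = {}" using t by (auto simp: D_def)
  have dense: "\<exists>d\<in>D. x < d \<and> d < y" if xy: "x < y" for x y :: real
  proof -
    obtain q where q: "q \<in> \<rat>" "x < q" "q < y" using Rats_dense_in_real[OF xy] by blast
    obtain r where r: "r \<in> \<rat>" "q < r" "r < y" using Rats_dense_in_real[OF q(3)] by blast
    have "t q r \<in> D" using q r by (force simp: D_def)
    moreover have "x < t q r" "t q r < y" using t[OF r(2)] q r by auto
    ultimately show ?thesis by blast
  qed
  define B where "B = (\<lambda>(c, d). S \<inter> {c<..<d}) ` (D \<times> D)"
  show ?thesis
  proof (intro exI conjI ballI allI impI)
    show "countable B" unfolding B_def using D by simp
  next
    fix U assume "U \<in> B"
    then obtain c d where cd: "c \<in> D" "d \<in> D" "U = S \<inter> {c<..<d}" by (auto simp: B_def)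
    then have "U = S \<inter> {c..d}" using DS by (auto simp: less_le)
    then show "closedin (top_of_set S) U" by (metis closed_atLeastAtMost closedin_closed_Int)
    show "openin (top_of_set S) U" unfolding cd(3) by (simp add: openin_open_Int)
  next
    fix U x assume U: "openin (top_of_set S) U" "x \<in> U"
    then obtain e where e: "e > 0" "\<And>y. y \<in> S \<Longrightarrow> dist y x < e \<Longrightarrow> y \<in> U"
      unfolding openin_euclidean_subtopology_iff by metis
    obtain c where c: "c \<in> D" "x - e < c" "c < x" using dense[of "x - e" x] e by auto
    obtain d where d: "d \<in> D" "x < d" "d < x + e" using dense[of x "x + e"] e by auto
    have "x \<in> S" using U openin_imp_subset by blast
    moreover have "S \<inter> {c<..<d} \<in> B" using c d by (auto simp: B_def)
    moreover have "S \<inter> {c<..<d} \<subseteq> U" using e(2) c d by (auto simp: dist_real_def)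
    ultimately show "\<exists>V\<in>B. x \<in> V \<and> V \<subseteq> U" using c d by (intro bexI[of _ "S \<inter> {c<..<d}"]) auto
  qed
qed

section \<open>The stages of the middle-third construction\<close>

definition cantor_stage :: "nat \<Rightarrow> real set" where
  "cantor_stage k = (\<Union>(a, b) \<in> cantor_intervals k. {a..b})"

lemma cantor_stageI: "(a, b) \<in> cantor_intervals k \<Longrightarrow> a \<le> x \<Longrightarrow> x \<le> b \<Longrightarrow> x \<in> cantor_stage k"
  unfolding cantor_stage_def by (rule UN_I[of "(a, b)"]) simp_all

definition stage_gaps :: "nat \<Rightarrow> (real \<times> real) set" where
  "stage_gaps k = (\<lambda>(a, b). (a + (b - a) / 3, b - (b - a) / 3)) ` cantor_intervals k"

lemma cantor_gaps_eq: "cantor_gaps = (\<Union>k. stage_gaps k)"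
  by (simp add: cantor_gaps_def stage_gaps_def)

text \<open>All intervals of stage \<open>k\<close> are cells of the grid of mesh
  \<open>1 / 3 ^ k\<close>; their length and their separation both follow from this.\<close>

lemma cantor_intervals_triadic:
  "(a, b) \<in> cantor_intervals k \<Longrightarrow> \<exists>c::int. a = c / 3 ^ k \<and> b = (real_of_int c + 1) / 3 ^ k"
proof (induction k arbitrary: a b)
  case 0
  then show ?case by (intro exI[of _ 0]) simp
next
  case (Suc k)
  then obtain a' b' where ab: "(a', b') \<in> cantor_intervals k"
    "a = a' \<and> b = a' + (b' - a') / 3 \<or> a = b' - (b' - a') / 3 \<and> b = b'" by auto
  obtain c :: int where c: "a' = c / 3 ^ k" "b' = (real_of_int c + 1) / 3 ^ k" using Suc.IH ab(1) by blast
  from ab(2) show ?case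
  proof
    assume "a = a' \<and> b = a' + (b' - a') / 3"
    then show ?thesis by (intro exI[of _ "3 * c"]) (simp add: c field_simps)
  next
    assume "a = b' - (b' - a') / 3 \<and> b = b'"
    moreover have "b' - a' = 1 / 3 ^ k" by (simp add: c add_divide_distrib)
    ultimately show ?thesis by (intro exI[of _ "3 * c + 2"]) (simp add: c add_divide_distrib)
  qed
qed

lemma cantor_intervals_length: "(a, b) \<in> cantor_intervals k \<Longrightarrow> b - a = 1 / 3 ^ k"
  using cantor_intervals_triadic by (fastforce simp: field_simps)

lemma cantor_intervals_less: "(a, b) \<in> cantor_intervals k \<Longrightarrow> a < b"
  using cantor_intervals_length[of a b k] by (smt (verit) zero_less_divide_1_iff zero_less_power)

lemma cantor_intervals_separated:
  assumes "(a, b) \<in> cantor_intervals k" "(a', b') \<in> cantor_intervals k" "(a, b) \<noteq> (a', b')"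
  shows "b \<le> a' \<or> b' \<le> a"
proof -
  obtain c :: int where c: "a = c / 3 ^ k" "b = (real_of_int c + 1) / 3 ^ k" using cantor_intervals_triadic assms by blast
  obtain d :: int where d: "a' = d / 3 ^ k" "b' = (real_of_int d + 1) / 3 ^ k" using cantor_intervals_triadic assms by blast
  have "c \<noteq> d" using assms(3) c d by auto
  then have "c + 1 \<le> d \<or> d + 1 \<le> c" by linarith
  then have "real_of_int c + 1 \<le> d \<or> real_of_int d + 1 \<le> c" by linarith
  then show ?thesis unfolding c d by (auto intro: divide_right_mono)
qed

lemma thirds_less:
  fixes a b :: real
  assumes "a < b"
  shows "a < a + (b - a) / 3" "a + (b - a) / 3 < b - (b - a) / 3" "b - (b - a) / 3 < b"
  using assms by (simp_all add: field_simps)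

lemma cantor_stage_Suc_subset: "cantor_stage (Suc k) \<subseteq> cantor_stage k"
proof
  fix x assume "x \<in> cantor_stage (Suc k)"
  then obtain a b where ab: "(a, b) \<in> cantor_intervals k"
    "x \<in> {a..a + (b - a) / 3} \<or> x \<in> {b - (b - a) / 3..b}" by (auto simp: cantor_stage_def)
  have "a < a + (b - a) / 3" "a + (b - a) / 3 < b - (b - a) / 3" "b - (b - a) / 3 < b"
    using thirds_less[OF cantor_intervals_less[OF ab(1)]] .
  then have "x \<in> {a..b}" using ab(2) unfolding atLeastAtMost_iff by linarith
  then show "x \<in> cantor_stage k" using ab(1) unfolding cantor_stage_def by blast
qed

lemma cantor_stage_antimono: "i \<le> j \<Longrightarrow> cantor_stage j \<subseteq> cantor_stage i"
  by (rule lift_Suc_antimono_le[of cantor_stage]) (auto intro: cantor_stage_Suc_subset[THEN subsetD])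

lemma stage_gapE:
  assumes "(l, r) \<in> stage_gaps k"
  obtains a b where "(a, b) \<in> cantor_intervals k" "l = a + (b - a) / 3" "r = b - (b - a) / 3"
    "a < l" "l < r" "r < b"
proof -
  obtain a b where ab: "(a, b) \<in> cantor_intervals k" "l = a + (b - a) / 3" "r = b - (b - a) / 3"
    using assms by (auto simp: stage_gaps_def)
  with thirds_less[OF cantor_intervals_less[OF ab(1)]] show thesis by (intro that[of a b]) auto
qed

lemma stage_gap_subset: "(l, r) \<in> stage_gaps k \<Longrightarrow> {l<..<r} \<subseteq> cantor_stage k"
proof (erule stage_gapE)
  fix a b assume ab: "(a, b) \<in> cantor_intervals k" "a < l" "r < b"
  then show "{l<..<r} \<subseteq> cantor_stage k" using cantor_stageI[OF ab(1)] by auto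
qed

lemma stage_gap_disjoint:
  assumes "(l, r) \<in> stage_gaps k" shows "{l<..<r} \<inter> cantor_stage (Suc k) = {}"
proof (rule ccontr)
  obtain a b where ab: "(a, b) \<in> cantor_intervals k" "l = a + (b - a) / 3" "r = b - (b - a) / 3"
    "a < l" "l < r" "r < b" using assms by (rule stage_gapE)
  assume "\<not> ?thesis"
  then obtain x where x: "l < x" "x < r" "x \<in> cantor_stage (Suc k)" by auto
  then obtain a' b' where x': "(a', b') \<in> cantor_intervals k"
    "x \<in> {a'..a' + (b' - a') / 3} \<or> x \<in> {b' - (b' - a') / 3..b'}"
    unfolding cantor_stage_def by auto
  have "(a, b) \<noteq> (a', b')" using x x' ab by auto
  then have "b \<le> a' \<or> b' \<le> a" by (rule cantor_intervals_separated[OF ab(1) x'(1)])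
  moreover have "a' \<le> x \<and> x \<le> b'"
    using x'(2) thirds_less[OF cantor_intervals_less[OF x'(1)]] unfolding atLeastAtMost_iff by linarith
  ultimately show False using x(1,2) ab(4-6) by linarith
qed

text \<open>A gap of stage \<open>i\<close> misses stage \<open>Suc i\<close>, which contains every
  later gap; gaps of equal stage lie in separated intervals.\<close>

lemma stage_gap_unique:
  assumes "(l, r) \<in> stage_gaps j" "(l', r') \<in> stage_gaps k" "x \<in> {l<..<r}" "x \<in> {l'<..<r'}"
  shows "l = l' \<and> r = r'"
proof -
  have False if "i < j" "(l, r) \<in> stage_gaps i" "(l', r') \<in> stage_gaps j" "x \<in> {l<..<r}" "x \<in> {l'<..<r'}"
    for i j l r l' r'
  proof -
    have "x \<in> cantor_stage j" using stage_gap_subset that by blast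
    then have "x \<in> cantor_stage (Suc i)" using cantor_stage_antimono[of "Suc i" j] that by auto
    then show False using stage_gap_disjoint that by blast
  qed
  then have "j = k" using assms by (metis linorder_neqE_nat)
  obtain a b where ab: "(a, b) \<in> cantor_intervals k" "l = a + (b - a) / 3" "r = b - (b - a) / 3"
    "a < l" "l < r" "r < b" using assms(1) \<open>j = k\<close> stage_gapE by metis
  obtain a' b' where ab': "(a', b') \<in> cantor_intervals k" "l' = a' + (b' - a') / 3" "r' = b' - (b' - a') / 3"
    "a' < l'" "l' < r'" "r' < b'" using assms(2) by (rule stage_gapE)
  have "(a, b) = (a', b')"
    using cantor_intervals_separated[OF ab(1) ab'(1)] assms(3,4) ab ab' by fastforce
  then show ?thesis using ab ab' by simp
qed

lemma cantor_set_eq: "cantor_set = (\<Inter>k. cantor_stage k)"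
proof (intro equalityI subsetI)
  fix x assume x: "x \<in> cantor_set"
  have "x \<in> cantor_stage k" for k
  proof (induction k)
    case 0
    then show ?case using x by (auto simp: cantor_set_def cantor_stage_def)
  next
    case (Suc k)
    then obtain a b where ab: "(a, b) \<in> cantor_intervals k" "a \<le> x" "x \<le> b" by (auto simp: cantor_stage_def)
    then have "(a + (b - a) / 3, b - (b - a) / 3) \<in> cantor_gaps"
      by (auto simp: cantor_gaps_def)
    then have "x \<notin> {a + (b - a) / 3 <..< b - (b - a) / 3}"
      using x unfolding cantor_set_def by blast
    then have "x \<in> {a..a + (b - a) / 3} \<or> x \<in> {b - (b - a) / 3..b}" using ab by auto
    then show ?case using ab(1) unfolding cantor_stage_def by fastforce
  qed
  then show "x \<in> (\<Inter>k. cantor_stage k)" by blast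
next
  fix x assume x: "x \<in> (\<Inter>k. cantor_stage k)"
  then have "x \<in> cantor_stage 0" by blast
  then have "x \<in> {0..1}" by (simp add: cantor_stage_def)
  moreover have "x \<notin> {l<..<r}" if "(l, r) \<in> cantor_gaps" for l r
    using that x stage_gap_disjoint unfolding cantor_gaps_eq by blast
  ultimately show "x \<in> cantor_set" unfolding cantor_set_def by blast
qed

text \<open>Subdivision keeps outer endpoints: the left end of an interval is the left end of its
  first third, and likewise on the right. So an endpoint belongs to all later stages.\<close>

lemma cantor_intervals_endpoints:
  assumes "(a, b) \<in> cantor_intervals k" shows "a \<in> cantor_set" "b \<in> cantor_set"
proof -
  have ex: "(\<exists>b'. (a, b') \<in> cantor_intervals (k + i)) \<and> (\<exists>a'. (a', b) \<in> cantor_intervals (k + i))" for i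
  proof (induction i)
    case 0
    then show ?case using assms by auto
  next
    case (Suc i)
    then obtain a' b' where "(a, b') \<in> cantor_intervals (k + i)" "(a', b) \<in> cantor_intervals (k + i)" by blast
    then have "(a, a + (b' - a) / 3) \<in> cantor_intervals (k + Suc i)"
      "(b - (b - a') / 3, b) \<in> cantor_intervals (k + Suc i)" by auto
    then show ?case by blast
  qed
  have "a \<in> cantor_stage (k + i)" "b \<in> cantor_stage (k + i)" for i
  proof -
    obtain a' b' where e: "(a, b') \<in> cantor_intervals (k + i)" "(a', b) \<in> cantor_intervals (k + i)"
      using ex by blast
    then show "a \<in> cantor_stage (k + i)" "b \<in> cantor_stage (k + i)"
      using cantor_intervals_less[OF e(1)] cantor_intervals_less[OF e(2)]
      by (auto intro: cantor_stageI[OF e(1)] cantor_stageI[OF e(2)])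
  qed
  then have "a \<in> cantor_stage i" "b \<in> cantor_stage i" for i
    using cantor_stage_antimono[of i "k + i"] by auto
  then show "a \<in> cantor_set" "b \<in> cantor_set" by (auto simp: cantor_set_eq)
qed

lemma cantor_set_small_interval:
  assumes "x \<in> cantor_set" "e > 0"
  obtains a b k where "(a, b) \<in> cantor_intervals k" "a \<le> x" "x \<le> b" "x - e < a" "b < x + e"
proof -
  obtain k where "(1/3) ^ k < e" using real_arch_pow_inv[of e "1/3"] assms by auto
  moreover obtain a b where "(a, b) \<in> cantor_intervals k" "a \<le> x" "x \<le> b"
    using assms(1) by (fastforce simp: cantor_set_eq cantor_stage_def)
  ultimately show thesis using that[of a b k] cantor_intervals_length[of a b k] by (simp add: power_one_over)
qed

section \<open>The Cantor set together with the midpoints of its gaps\<close>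

definition pelczynski_set :: "real set" where
  "pelczynski_set = cantor_set \<union> (\<lambda>(l, r). midpoint l r) ` cantor_gaps"

lemma midpoint_between: "l < r \<Longrightarrow> l < midpoint l r \<and> midpoint l r < (r::real)"
  by (simp add: midpoint_def)

lemma cantor_gap_less: "(l, r) \<in> cantor_gaps \<Longrightarrow> l < r"
  unfolding cantor_gaps_eq by (blast elim: stage_gapE)

text \<open>Cantor points avoid all gaps, and a midpoint determines the gap it lies in. Hence the
  midpoints are isolated.\<close>

lemma pelczynski_set_gap:
  assumes "(l, r) \<in> cantor_gaps"
  shows "pelczynski_set \<inter> {l<..<r} = {midpoint l r}"
proof
  show "{midpoint l r} \<subseteq> pelczynski_set \<inter> {l<..<r}"
    using assms midpoint_between[OF cantor_gap_less[OF assms]] by (auto simp: pelczynski_set_def)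
  show "pelczynski_set \<inter> {l<..<r} \<subseteq> {midpoint l r}"
  proof
    fix x assume x: "x \<in> pelczynski_set \<inter> {l<..<r}"
    then have "x \<notin> cantor_set" using assms unfolding cantor_set_def by blast
    then obtain l' r' where lr: "(l', r') \<in> cantor_gaps" "x = midpoint l' r'"
      using x by (auto simp: pelczynski_set_def)
    then have "x \<in> {l'<..<r'}" using midpoint_between cantor_gap_less by auto
    then have "l = l' \<and> r = r'"
      using x lr assms stage_gap_unique unfolding cantor_gaps_eq by blast
    then show "x \<in> {midpoint l r}" using lr by simp
  qed
qed

lemma cantor_gap_bounds: "(l, r) \<in> cantor_gaps \<Longrightarrow> 0 \<le> l \<and> r \<le> 1"
proof -
  assume "(l, r) \<in> cantor_gaps"
  then obtain k where "(l, r) \<in> stage_gaps k" by (auto simp: cantor_gaps_eq)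
  then obtain a b where ab: "(a, b) \<in> cantor_intervals k" "a < l" "r < b" by (blast elim: stage_gapE)
  then have "a \<in> {0..1}" "b \<in> {0..1}" using cantor_intervals_endpoints[OF ab(1)] unfolding cantor_set_def by blast+
  then show "0 \<le> l \<and> r \<le> 1" using ab by auto
qed

lemma closed_cantor_set: "closed cantor_set"
  unfolding cantor_set_def by (intro closed_Diff open_UN ballI) auto

lemma compact_pelczynski_set: "compact pelczynski_set"
proof -
  \<comment> \<open>Deleting the two open halves of each gap leaves exactly its midpoint, which
    exhibits the set as closed.\<close>
  have "pelczynski_set = {0..1} - (\<Union>(l, r)\<in>cantor_gaps. {l<..<midpoint l r} \<union> {midpoint l r<..<r})"
  proof (intro equalityI subsetI)
    fix x assume x: "x \<in> pelczynski_set"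
    have "x \<in> {0..1}"
    proof (cases "x \<in> cantor_set")
      case False
      then obtain l r where lr: "(l, r) \<in> cantor_gaps" "x = midpoint l r" using x by (auto simp: pelczynski_set_def)
      then show ?thesis
        using midpoint_between[OF cantor_gap_less[OF lr(1)]] cantor_gap_bounds[OF lr(1)] by auto
    qed (auto simp: cantor_set_def)
    moreover have "x \<notin> {l<..<midpoint l r} \<union> {midpoint l r<..<r}" if "(l, r) \<in> cantor_gaps" for l r
    proof -
      have "x \<in> {l<..<r} \<Longrightarrow> x = midpoint l r" using pelczynski_set_gap[OF that] x by blast
      then show ?thesis using midpoint_between[OF cantor_gap_less[OF that]] by auto
    qed
    ultimately show "x \<in> {0..1} - (\<Union>(l, r)\<in>cantor_gaps. {l<..<midpoint l r} \<union> {midpoint l r<..<r})" by blast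
  next
    fix x assume x: "x \<in> {0..1} - (\<Union>(l, r)\<in>cantor_gaps. {l<..<midpoint l r} \<union> {midpoint l r<..<r})"
    show "x \<in> pelczynski_set"
    proof (cases "x \<in> cantor_set")
      case False
      then obtain l r where lr: "(l, r) \<in> cantor_gaps" "x \<in> {l<..<r}" using x by (auto simp: cantor_set_def)
      then have "x \<notin> {l<..<midpoint l r} \<union> {midpoint l r<..<r}" using x by blast
      then have "x = midpoint l r" using lr(2) by auto
      then show ?thesis using lr(1) by (auto simp: pelczynski_set_def)
    qed (auto simp: pelczynski_set_def)
  qed
  moreover have "closed ({0..1} - (\<Union>(l, r)\<in>cantor_gaps. {l<..<midpoint l r} \<union> {midpoint l r<..<r}))"
    by (intro closed_Diff open_UN ballI) auto
  moreover have "bounded ({0..1} - (\<Union>(l, r)\<in>cantor_gaps. {l<..<midpoint l r} \<union> {midpoint l r<..<r}))"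
    by (rule bounded_subset[OF bounded_closed_interval[of 0 1]]) auto
  ultimately show ?thesis by (simp add: compact_eq_bounded_closed)
qed

lemma finite_cantor_intervals: "finite (cantor_intervals k)"
  by (induction k) auto

text \<open>An interval inside the set would be uncountable, so it would contain a Cantor point
  besides the countably many midpoints. Close to a Cantor point there are whole gaps, and these are
  not contained in the set.\<close>

lemma pelczynski_set_complement_dense:
  assumes "x < (y::real)" shows "\<exists>t. x < t \<and> t < y \<and> t \<notin> pelczynski_set"
proof (rule ccontr)
  assume neg: "\<not> ?thesis"
  have "countable cantor_gaps"
    unfolding cantor_gaps_eq stage_gaps_def by (intro countable_UN countableI_type countable_image)
      (simp_all add: countable_finite finite_cantor_intervals)
  then have "countable ((\<lambda>(l, r). midpoint l r) ` cantor_gaps)" by simp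
  moreover have "uncountable {x<..<y}" using assms uncountable_open_interval by blast
  ultimately obtain z where z: "z \<in> {x<..<y}" "z \<notin> (\<lambda>(l, r). midpoint l r) ` cantor_gaps"
    by (meson countable_subset subsetI)
  then have zC: "z \<in> cantor_set" using neg by (auto simp: pelczynski_set_def)
  obtain a b k where ab: "(a, b) \<in> cantor_intervals k" "a \<le> z" "z \<le> b"
    "z - min (z - x) (y - z) < a" "b < z + min (z - x) (y - z)"
    using cantor_set_small_interval[OF zC, of "min (z - x) (y - z)"] z(1) by auto
  define l where "l = a + (b - a) / 3"
  define r where "r = b - (b - a) / 3"
  have lr: "(l, r) \<in> cantor_gaps" using ab(1) by (auto simp: cantor_gaps_def l_def r_def)
  have "a < b" using cantor_intervals_less ab by blast
  then have o: "a < l" "l < r" "r < b" unfolding l_def r_def by (rule thirds_less)+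
  \<comment> \<open>Any point of the gap other than its midpoint would do; this one bisects the left
    half.\<close>
  define t where "t = midpoint l (midpoint l r)"
  have "l < t" "t < midpoint l r" "midpoint l r < r"
    unfolding t_def using midpoint_between o(2) by blast+
  then have "t \<in> {l<..<r}" "t \<noteq> midpoint l r" using o by auto
  then have "t \<notin> pelczynski_set" using pelczynski_set_gap[OF lr] by blast
  moreover have "x < t" "t < y" using \<open>t \<in> {l<..<r}\<close> o ab(4,5) by auto
  ultimately show False using neg by blast
qed

text \<open>A short stage interval around a Cantor point \<open>x\<close> settles two conditions:
  its two endpoints are Cantor points, at least one of them different from \<open>x\<close>, and the
  midpoint of its middle third is an isolated point near \<open>x\<close>.\<close>

lemma pelczynski_type_pelczynski_space: "pelczynski_type pelczynski_space cantor_set {}"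
proof -
  let ?P = pelczynski_set
  have P: "pelczynski_space = top_of_set ?P" by (simp add: pelczynski_space_def pelczynski_set_def)
  have CP: "cantor_set \<subseteq> ?P" by (auto simp: pelczynski_set_def)
  have iso: "openin (top_of_set ?P) {midpoint l r}" if "(l, r) \<in> cantor_gaps" for l r
    using pelczynski_set_gap[OF that] by (metis open_greaterThanLessThan openin_open_Int)
  have perfect: "\<exists>y\<in>U \<inter> cantor_set. y \<noteq> x" if U: "openin (top_of_set ?P) U" "x \<in> U" "x \<in> cantor_set" for U x
  proof -
    obtain e where e: "e > 0" "\<And>y. y \<in> ?P \<Longrightarrow> dist y x < e \<Longrightarrow> y \<in> U"
      using U unfolding openin_euclidean_subtopology_iff by metis
    obtain a b k where ab: "(a, b) \<in> cantor_intervals k" "a \<le> x" "x \<le> b" "x - e < a" "b < x + e"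
      by (rule cantor_set_small_interval[OF U(3) e(1)])
    have "a \<in> U \<inter> cantor_set" "b \<in> U \<inter> cantor_set" "a \<noteq> b"
      using e(2) ab CP cantor_intervals_endpoints[OF ab(1)] cantor_intervals_less[OF ab(1)]
      by (auto simp: dist_real_def)
    then show ?thesis by metis
  qed
  show ?thesis
    unfolding P
  proof
    show "compact_space (top_of_set ?P)" using compact_pelczynski_set by (simp add: compact_space_subtopology)
    show "Hausdorff_space (top_of_set ?P)" by (simp add: Hausdorff_space_subtopology)
    show "\<exists>B. countable B \<and> (\<forall>U\<in>B. openin (top_of_set ?P) U \<and> closedin (top_of_set ?P) U) \<and>
      (\<forall>U x. openin (top_of_set ?P) U \<longrightarrow> x \<in> U \<longrightarrow> (\<exists>V\<in>B. x \<in> V \<and> V \<subseteq> U))"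
      using countable_clopen_base_real_subset pelczynski_set_complement_dense by blast
    show "non_isolated_points (top_of_set ?P) = cantor_set \<union> {}"
    proof -
      have "openin (top_of_set ?P) {x} \<longleftrightarrow> x \<notin> cantor_set" if "x \<in> ?P" for x
      proof
        assume "openin (top_of_set ?P) {x}" then show "x \<notin> cantor_set" using perfect by blast
      next
        assume "x \<notin> cantor_set"
        then show "openin (top_of_set ?P) {x}" using that iso by (auto simp: pelczynski_set_def)
      qed
      then show ?thesis using CP by (auto simp: non_isolated_points_def)
    qed
    show "closedin (top_of_set ?P) cantor_set" using CP closed_cantor_set closed_subset by blast
    show "\<exists>x\<in>U. openin (top_of_set ?P) {x}" if U: "openin (top_of_set ?P) U" "U \<noteq> {}" for U
    proof -
      obtain x where x: "x \<in> U" using U by blast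
      then have xP: "x \<in> ?P" using U openin_imp_subset by blast
      show ?thesis
      proof (cases "x \<in> cantor_set")
        case False
        then show ?thesis using x xP iso by (auto simp: pelczynski_set_def)
      next
        case True
        obtain e where e: "e > 0" "\<And>y. y \<in> ?P \<Longrightarrow> dist y x < e \<Longrightarrow> y \<in> U"
          using U x unfolding openin_euclidean_subtopology_iff by metis
        obtain a b k where ab: "(a, b) \<in> cantor_intervals k" "a \<le> x" "x \<le> b" "x - e < a" "b < x + e"
          by (rule cantor_set_small_interval[OF True e(1)])
        define l where "l = a + (b - a) / 3"
        define r where "r = b - (b - a) / 3"
        have lr: "(l, r) \<in> cantor_gaps" using ab(1) by (auto simp: cantor_gaps_def l_def r_def)
        have "a < b" using cantor_intervals_less ab by blast
        then have "a < l" "r < b" unfolding l_def r_def by (rule thirds_less)+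
        moreover have "l < midpoint l r" "midpoint l r < r" using midpoint_between cantor_gap_less[OF lr] by auto
        moreover have "midpoint l r \<in> ?P" using lr by (auto simp: pelczynski_set_def)
        ultimately have "midpoint l r \<in> U" using e(2) ab by (simp add: dist_real_def)
        then show ?thesis using iso[OF lr] by blast
      qed
    qed
  qed (use perfect in auto)
qed

section \<open>The ordinal \<open>\<omega>n + 1\<close> and disjoint unions\<close>

text \<open>The pair \<open>(Suc i, 0)\<close> stands for the limit ordinal \<omega>(i + 1),
  approached by the copy \<open>{i} \<times> UNIV\<close> of \<omega>. All other points are isolated
  and impose no condition.\<close>

lemma openin_omega_mult_plus_one:
  "openin (omega_mult_plus_one n) W \<longleftrightarrow> W \<subseteq> {..<n} \<times> UNIV \<union> {(n, 0)} \<and>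
     (\<forall>i<n. (Suc i, 0) \<in> W \<longrightarrow> (\<exists>k. \<forall>m\<ge>k. (i, m) \<in> W))"
proof -
  let ?A = "{..<n} \<times> UNIV \<union> {(n, 0 :: nat)}"
  let ?r = "less_than <*lex*> less_than"
  let ?B = "{?A} \<union> {{x \<in> ?A. (x, a) \<in> ?r} | a. a \<in> ?A} \<union> {{x \<in> ?A. (a, x) \<in> ?r} | a. a \<in> ?A}"
  let ?T = "omega_mult_plus_one n"
  have T: "openin ?T U \<longleftrightarrow> generate_topology_on ?B U" for U
    by (simp only: omega_mult_plus_one_def order_topology_on_def openin_topology_generated_by_iff)
  have r: "((a, b), (c, d)) \<in> ?r \<longleftrightarrow> a < c \<or> a = c \<and> b < d" for a b c d :: nat by auto
  have "W \<subseteq> ?A \<and> (\<forall>i<n. (Suc i, 0) \<in> W \<longrightarrow> (\<exists>k. \<forall>m\<ge>k. (i, m) \<in> W))"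
    if "generate_topology_on ?B W" for W
    using that
  proof induction
    case (Int U V)
    show ?case
    proof (intro conjI allI impI)
      show "U \<inter> V \<subseteq> ?A" using Int by blast
      fix i assume "i < n" "(Suc i, 0) \<in> U \<inter> V"
      then obtain k where "\<forall>m\<ge>k. (i, m) \<in> U" using Int.IH(1) by auto
      moreover obtain l where "\<forall>m\<ge>l. (i, m) \<in> V" using Int.IH(2) \<open>i < n\<close> \<open>(Suc i, 0) \<in> U \<inter> V\<close> by auto
      ultimately show "\<exists>k. \<forall>m\<ge>k. (i, m) \<in> U \<inter> V" by (intro exI[of _ "max k l"]) auto
    qed
  next
    case (UN K)
    show ?case
    proof (intro conjI allI impI)
      show "\<Union>K \<subseteq> ?A" using UN.IH by blast
      fix i assume "i < n" "(Suc i, 0) \<in> \<Union>K"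
      then obtain U where U: "U \<in> K" "(Suc i, 0) \<in> U" by blast
      then obtain k where "\<forall>m\<ge>k. (i, m) \<in> U" using UN.IH[OF U(1)] \<open>i < n\<close> by simp metis
      then show "\<exists>k. \<forall>m\<ge>k. (i, m) \<in> \<Union>K" using U by blast
    qed
  next
    case (Basis U)
    then consider "U = ?A" | a where "U = {x \<in> ?A. (x, a) \<in> ?r}" | a where "U = {x \<in> ?A. (a, x) \<in> ?r}" by blast
    then show ?case
    proof cases
      case 1 then show ?thesis by auto
    next
      case 2 then show ?thesis by (cases a) auto
    next
      case 3
      obtain c d where a: "a = (c, d)" by (cases a)
      \<comment> \<open>If \<open>(c, d)\<close> lies below \<open>(Suc i, 0)\<close>, then
        \<open>c \<le> i\<close>, so \<open>(i, m)\<close> lies above \<open>(c, d)\<close> as soon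
        as \<open>m > d\<close>.\<close>
      have "\<exists>k. \<forall>m\<ge>k. (i, m) \<in> U" if "i < n" "(Suc i, 0) \<in> U" for i
        using that by (intro exI[of _ "Suc d"]) (auto simp: 3 a)
      then show ?thesis using 3 by blast
    qed
  qed simp
  moreover have "openin ?T W"
    if W: "W \<subseteq> ?A" "\<forall>i<n. (Suc i, 0) \<in> W \<longrightarrow> (\<exists>k. \<forall>m\<ge>k. (i, m) \<in> W)"
  proof (subst openin_subopen, intro ballI)
    have A: "openin ?T ?A" unfolding T by (rule generate_topology_on.Basis) blast
    have lt: "openin ?T {x \<in> ?A. (x, a) \<in> ?r}" and gt: "openin ?T {x \<in> ?A. (a, x) \<in> ?r}" if "a \<in> ?A" for a
      unfolding T using that by (blast intro: generate_topology_on.Basis)+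
    \<comment> \<open>This is the closed lower ray up to \<open>(i, j)\<close>, written with the
      successor as strict bound. At the top point the successor \<open>(n, 1)\<close> is outside the
      space and the ray is everything.\<close>
    have upto: "openin ?T {x \<in> ?A. (x, (i, Suc j)) \<in> ?r}" if "(i, j) \<in> ?A" for i j
    proof (cases "i = n")
      case True
      then have "{x \<in> ?A. (x, (i, Suc j)) \<in> ?r} = ?A" using that by auto
      then show ?thesis using A by simp
    next
      case False
      then show ?thesis using that by (intro lt) auto
    qed
    fix x assume x: "x \<in> W"
    obtain i j where ij: "x = (i, j)" by (cases x)
    have ijA: "(i, j) \<in> ?A" using x W ij by blast
    show "\<exists>U. openin ?T U \<and> x \<in> U \<and> U \<subseteq> W"
    proof (cases j)
      case (Suc j')
      have "openin ?T ({x \<in> ?A. ((i, j'), x) \<in> ?r} \<inter> {x \<in> ?A. (x, (i, Suc j)) \<in> ?r})"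
        using ijA Suc by (intro openin_Int gt upto) auto
      moreover have "{x \<in> ?A. ((i, j'), x) \<in> ?r} \<inter> {x \<in> ?A. (x, (i, Suc j)) \<in> ?r} = {x}"
        using ijA Suc ij by auto
      ultimately show ?thesis using x by auto
    next
      case j: 0
      show ?thesis
      proof (cases i)
        case 0
        have "openin ?T {x \<in> ?A. (x, (i, Suc j)) \<in> ?r}" using ijA by (rule upto)
        moreover have "{x \<in> ?A. (x, (i, Suc j)) \<in> ?r} = {x}" using ijA 0 j ij by auto
        ultimately show ?thesis using x by auto
      next
        case (Suc i')
        then have "i' < n" using ijA by auto
        then obtain k where k: "\<And>m. m \<ge> k \<Longrightarrow> (i', m) \<in> W" using W(2) x ij j Suc by blast
        have "openin ?T ({x \<in> ?A. ((i', k), x) \<in> ?r} \<inter> {x \<in> ?A. (x, (i, Suc j)) \<in> ?r})"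
          using ijA Suc \<open>i' < n\<close> by (intro openin_Int gt upto) auto
        moreover have "x \<in> {x \<in> ?A. ((i', k), x) \<in> ?r} \<inter> {x \<in> ?A. (x, (i, Suc j)) \<in> ?r}"
          using ijA Suc ij by auto
        moreover have "{x \<in> ?A. ((i', k), x) \<in> ?r} \<inter> {x \<in> ?A. (x, (i, Suc j)) \<in> ?r} \<subseteq> W"
        proof
          fix y assume y: "y \<in> {x \<in> ?A. ((i', k), x) \<in> ?r} \<inter> {x \<in> ?A. (x, (i, Suc j)) \<in> ?r}"
          obtain c d where cd: "y = (c, d)" by (cases y)
          have "c = i' \<and> d > k \<or> c = i \<and> d = 0" using y cd Suc j by (auto simp: less_Suc_eq)
          then show "y \<in> W" using k cd x ij j by auto
        qed
        ultimately show ?thesis by blast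
      qed
    qed
  qed
  ultimately show ?thesis using T by blast
qed

lemma topspace_omega_mult_plus_one: "topspace (omega_mult_plus_one n) = {..<n} \<times> UNIV \<union> {(n, 0)}"
proof
  show "topspace (omega_mult_plus_one n) \<subseteq> {..<n} \<times> UNIV \<union> {(n, 0)}"
    using openin_omega_mult_plus_one openin_topspace by blast
  have "openin (omega_mult_plus_one n) ({..<n} \<times> UNIV \<union> {(n, 0)})"
    by (auto simp: openin_omega_mult_plus_one)
  then show "{..<n} \<times> UNIV \<union> {(n, 0)} \<subseteq> topspace (omega_mult_plus_one n)" by (rule openin_subset)
qed

lemma Hausdorff_clopen_base:
  assumes base: "\<And>U x. openin X U \<Longrightarrow> x \<in> U \<Longrightarrow> \<exists>V. openin X V \<and> closedin X V \<and> x \<in> V \<and> V \<subseteq> U"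
    and t1: "\<And>x. x \<in> topspace X \<Longrightarrow> closedin X {x}"
  shows "Hausdorff_space X"
  unfolding Hausdorff_space_def
proof (intro allI impI)
  fix x y assume xy: "x \<in> topspace X \<and> y \<in> topspace X \<and> x \<noteq> y"
  then have "openin X (topspace X - {y})" using t1 by blast
  then obtain V where V: "openin X V" "closedin X V" "x \<in> V" "V \<subseteq> topspace X - {y}"
    using base[of "topspace X - {y}" x] xy by blast
  then show "\<exists>U V. openin X U \<and> openin X V \<and> x \<in> U \<and> y \<in> V \<and> disjnt U V"
    using xy by (intro exI[of _ V] exI[of _ "topspace X - V"]) (auto simp: disjnt_def)
qed

lemma pelczynski_type_omega:
  "pelczynski_type (omega_mult_plus_one n) {} ((\<lambda>i. (Suc i, 0)) ` {..<n})"
proof -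
  let ?T = "omega_mult_plus_one n"
  let ?A = "{..<n} \<times> UNIV \<union> {(n, 0 :: nat)}"
  let ?F = "(\<lambda>i. (Suc i, 0)) ` {..<n}"
  note o = openin_omega_mult_plus_one
  note ts = topspace_omega_mult_plus_one
  have FA: "?F \<subseteq> ?A" by auto
  have iso: "openin ?T {x} \<longleftrightarrow> x \<notin> ?F" if "x \<in> ?A" for x
  proof
    assume "openin ?T {x}"
    then show "x \<notin> ?F" unfolding o by fastforce
  next
    assume "x \<notin> ?F" then show "openin ?T {x}" unfolding o using that by auto
  qed
  have del: "openin ?T (?A - {x})" for x
    unfolding o
  proof (intro conjI allI impI)
    fix i assume "i < n"
    then show "\<exists>k. \<forall>m\<ge>k. (i, m) \<in> ?A - {x}" by (intro exI[of _ "Suc (snd x)"]) auto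
  qed blast
  \<comment> \<open>The tail starts at \<open>Suc k\<close> so as to leave out
    \<open>(i, 0)\<close>, which for \<open>i > 0\<close> is itself a limit point and would spoil
    openness.\<close>
  define tail where "tail i k = insert (Suc i, 0) {(i, m) | m. m \<ge> Suc k}" for i k :: nat
  have tail: "openin ?T (tail i k)" "closedin ?T (tail i k)" if "i < n" for i k
  proof -
    show "openin ?T (tail i k)" unfolding o using that by (auto simp: tail_def intro: exI[of _ "Suc k"])
    have "openin ?T (?A - tail i k)"
      unfolding o
    proof (intro conjI allI impI)
      fix j assume j: "j < n" "(Suc j, 0) \<in> ?A - tail i k"
      then have "j \<noteq> i" by (auto simp: tail_def)
      then show "\<exists>l. \<forall>m\<ge>l. (j, m) \<in> ?A - tail i k" using j(1) by (intro exI[of _ 1]) (auto simp: tail_def)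
    qed blast
    then show "closedin ?T (tail i k)"
      unfolding closedin_def ts using that by (auto simp: tail_def)
  qed
  have single: "closedin ?T {x}" if "x \<in> ?A" for x
    unfolding closedin_def ts using del that by simp
  let ?B = "(\<lambda>x. {x}) ` (?A - ?F) \<union> (\<lambda>(i, k). tail i k) ` ({..<n} \<times> UNIV)"
  have B1: "openin ?T U \<and> closedin ?T U" if "U \<in> ?B" for U
    using that tail iso single by auto
  have B2: "\<exists>V\<in>?B. x \<in> V \<and> V \<subseteq> U" if U: "openin ?T U" "x \<in> U" for U x
  proof (cases "x \<in> ?F")
    case True
    then obtain i where i: "i < n" "x = (Suc i, 0)" by auto
    then obtain k where k: "\<And>m. m \<ge> k \<Longrightarrow> (i, m) \<in> U" using U unfolding o by blast
    have "tail i k \<in> ?B" using i by auto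
    moreover have "x \<in> tail i k \<and> tail i k \<subseteq> U" using i k U by (auto simp: tail_def)
    ultimately show ?thesis by (rule rev_bexI)
  next
    case False
    have "x \<in> ?A" using U unfolding o by blast
    then have "{x} \<in> ?B" using False by blast
    moreover have "x \<in> {x} \<and> {x} \<subseteq> U" using U by blast
    ultimately show ?thesis by (rule rev_bexI)
  qed
  show ?thesis
  proof
    show "Hausdorff_space ?T"
    proof (rule Hausdorff_clopen_base)
      show "\<exists>V. openin ?T V \<and> closedin ?T V \<and> x \<in> V \<and> V \<subseteq> U" if "openin ?T U" "x \<in> U" for U x
        using B1 B2[OF that] by meson
    qed (use single ts in auto)
    show "\<exists>B. countable B \<and> (\<forall>U\<in>B. openin ?T U \<and> closedin ?T U) \<and>
      (\<forall>U x. openin ?T U \<longrightarrow> x \<in> U \<longrightarrow> (\<exists>V\<in>B. x \<in> V \<and> V \<subseteq> U))"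
    proof (intro exI conjI)
      show "countable ?B" by (intro countable_Un countable_image countableI_type)
    qed (use B1 B2 in blast)+
    show "non_isolated_points ?T = {} \<union> ?F"
      unfolding non_isolated_points_def ts using iso FA by blast
    show "compact_space ?T"
      unfolding compact_space_alt ts
    proof (intro allI impI)
      fix \<U> assume U: "(\<forall>U\<in>\<U>. openin ?T U) \<and> ?A \<subseteq> \<Union>\<U>"
      have "\<exists>V k. V \<in> \<U> \<and> (Suc i, 0) \<in> V \<and> (\<forall>m\<ge>k. (i, m) \<in> V)" if "i < n" for i
      proof -
        have "(Suc i, 0) \<in> ?A" using that by auto
        then obtain V where "V \<in> \<U>" "(Suc i, 0) \<in> V" using U by blast
        moreover from this have "openin ?T V" using U by blast
        ultimately show ?thesis using that unfolding o by blast
      qed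
      then obtain V k where V: "\<And>i. i < n \<Longrightarrow> V i \<in> \<U> \<and> (Suc i, 0) \<in> V i \<and> (\<forall>m\<ge>k i. (i, m) \<in> V i)" by metis
      \<comment> \<open>The points that the tails inside the chosen \<open>V i\<close> may leave
        out. \<open>(0, 0)\<close> is added for \<open>n = 0\<close>, when it is the whole space and
        no tail exists.\<close>
      define R where "R = insert (0, 0) (\<Union>i<n. {i} \<times> {..<k i})"
      have "\<forall>x\<in>R \<inter> ?A. \<exists>U. U \<in> \<U> \<and> x \<in> U" using U by blast
      then obtain g where g: "\<And>x. x \<in> R \<inter> ?A \<Longrightarrow> g x \<in> \<U> \<and> x \<in> g x" by metis
      have "?A \<subseteq> \<Union>(V ` {..<n} \<union> g ` (R \<inter> ?A))"
      proof
        fix x assume x: "x \<in> ?A"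
        show "x \<in> \<Union>(V ` {..<n} \<union> g ` (R \<inter> ?A))"
        proof (cases "x \<in> R")
          case True then show ?thesis using g x by blast
        next
          case False
          obtain i j where ij: "x = (i, j)" by (cases x)
          show ?thesis
          proof (cases "i < n")
            case True
            then have "j \<ge> k i" using False ij by (auto simp: R_def)
            then have "x \<in> V i" using V True ij by blast
            then show ?thesis using True by blast
          next
            case False
            then have "i = n" "j = 0" "i \<noteq> 0" using x ij \<open>x \<notin> R\<close> by (auto simp: R_def)
            then obtain i' where "i' < n" "x = (Suc i', 0)" using ij by (cases i) auto
            then show ?thesis using V[of i'] by blast
          qed
        qed
      qed
      moreover have "finite (V ` {..<n} \<union> g ` (R \<inter> ?A))" by (simp add: R_def)
      moreover have "V ` {..<n} \<union> g ` (R \<inter> ?A) \<subseteq> \<U>" using V g by blast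
      ultimately show "\<exists>\<F>. finite \<F> \<and> \<F> \<subseteq> \<U> \<and> ?A \<subseteq> \<Union>\<F>" by blast
    qed
    show "\<exists>x\<in>U. openin ?T {x}" if U: "openin ?T U" "U \<noteq> {}" for U
    proof -
      obtain x where x: "x \<in> U" using U by blast
      show ?thesis
      proof (cases "x \<in> ?F")
        case True
        then obtain i where i: "i < n" "(Suc i, 0) \<in> U" using x by auto
        then obtain k where k: "\<And>m. m \<ge> k \<Longrightarrow> (i, m) \<in> U" using U unfolding o by blast
        \<comment> \<open>The second coordinate must be positive, for \<open>(i, 0)\<close> need not
          be isolated.\<close>
        have "(i, Suc k) \<in> U" "openin ?T {(i, Suc k)}" using k iso[of "(i, Suc k)"] i(1) by auto
        then show ?thesis by blast
      next
        case False
        have "U \<subseteq> ?A" using U(1) unfolding o by (rule conjunct1)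
        then have "openin ?T {x}" using iso[of x] x False by blast
        then show ?thesis using x by blast
      qed
    qed
  qed auto
qed

section \<open>Topological sums\<close>

lemma vimage_sum_images [simp]:
  "Inl -` (Inl ` A \<union> Inr ` B) = A" "Inr -` (Inl ` A \<union> Inr ` B) = B"
  "Inl -` (Inl ` A) = A" "Inr -` (Inr ` B) = B" "Inl -` (Inr ` B) = {}" "Inr -` (Inl ` A) = {}"
  "Inl -` {Inl a} = {a}" "Inr -` {Inr b} = {b}" "Inl -` {Inr b} = {}" "Inr -` {Inl a} = {}"
  by auto

lemma topspace_disjoint_union_topology:
  "topspace (disjoint_union_topology X Y) = Inl ` topspace X \<union> Inr ` topspace Y"
proof
  show "Inl ` topspace X \<union> Inr ` topspace Y \<subseteq> topspace (disjoint_union_topology X Y)"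
    by (rule openin_subset) (simp add: openin_disjoint_union_topology del: vimage_Un)
  show "topspace (disjoint_union_topology X Y) \<subseteq> Inl ` topspace X \<union> Inr ` topspace Y"
  proof
    fix z assume z: "z \<in> topspace (disjoint_union_topology X Y)"
    have "openin (disjoint_union_topology X Y) (topspace (disjoint_union_topology X Y))" by simp
    then have "Inl -` topspace (disjoint_union_topology X Y) \<subseteq> topspace X"
      "Inr -` topspace (disjoint_union_topology X Y) \<subseteq> topspace Y"
      unfolding openin_disjoint_union_topology by (auto dest: openin_subset)
    then show "z \<in> Inl ` topspace X \<union> Inr ` topspace Y" using z by (cases z) auto
  qed
qed

lemma closedin_disjoint_union_topology:
  "closedin (disjoint_union_topology X Y) C \<longleftrightarrow> closedin X (Inl -` C) \<and> closedin Y (Inr -` C)"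
proof -
  have "C \<subseteq> Inl ` topspace X \<union> Inr ` topspace Y \<longleftrightarrow> Inl -` C \<subseteq> topspace X \<and> Inr -` C \<subseteq> topspace Y"
  proof
    assume C: "Inl -` C \<subseteq> topspace X \<and> Inr -` C \<subseteq> topspace Y"
    show "C \<subseteq> Inl ` topspace X \<union> Inr ` topspace Y"
    proof
      fix z assume "z \<in> C"
      then show "z \<in> Inl ` topspace X \<union> Inr ` topspace Y" using C by (cases z) auto
    qed
  qed auto
  then show ?thesis
    unfolding closedin_def openin_disjoint_union_topology topspace_disjoint_union_topology
    by (auto simp: vimage_Diff)
qed

lemma pelczynski_type_disjoint_union:
  assumes "pelczynski_type X K F" "pelczynski_type Y L E"
  shows "pelczynski_type (disjoint_union_topology X Y) (Inl ` K \<union> Inr ` L) (Inl ` F \<union> Inr ` E)"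
proof -
  interpret X: pelczynski_type X K F by fact
  interpret Y: pelczynski_type Y L E by fact
  let ?D = "disjoint_union_topology X Y"
  note o = openin_disjoint_union_topology and c = closedin_disjoint_union_topology
  note ts = topspace_disjoint_union_topology
  obtain BX where BX: "countable BX" "\<And>U. U \<in> BX \<Longrightarrow> openin X U \<and> closedin X U"
    "\<And>U x. openin X U \<Longrightarrow> x \<in> U \<Longrightarrow> \<exists>V\<in>BX. x \<in> V \<and> V \<subseteq> U" using X.clopen_base by metis
  obtain BY where BY: "countable BY" "\<And>U. U \<in> BY \<Longrightarrow> openin Y U \<and> closedin Y U"
    "\<And>U x. openin Y U \<Longrightarrow> x \<in> U \<Longrightarrow> \<exists>V\<in>BY. x \<in> V \<and> V \<subseteq> U" using Y.clopen_base by metis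
  let ?B = "image Inl ` BX \<union> image Inr ` BY"
  have B1: "openin ?D U \<and> closedin ?D U" if "U \<in> ?B" for U
    using that BX(2) BY(2) by (auto simp: o c)
  have B2: "\<exists>V\<in>?B. x \<in> V \<and> V \<subseteq> U" if U: "openin ?D U" "x \<in> U" for U x
  proof (cases x)
    case (Inl a)
    then obtain V where "V \<in> BX" "a \<in> V" "V \<subseteq> Inl -` U" using BX(3)[of "Inl -` U" a] U by (auto simp: o)
    then show ?thesis using Inl by (intro bexI[of _ "Inl ` V"]) auto
  next
    case (Inr a)
    then obtain V where "V \<in> BY" "a \<in> V" "V \<subseteq> Inr -` U" using BY(3)[of "Inr -` U" a] U by (auto simp: o)
    then show ?thesis using Inr by (intro bexI[of _ "Inr ` V"]) auto
  qed
  show ?thesis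
  proof
    have "compactin ?D (Inl ` topspace X \<union> Inr ` topspace Y)"
    proof (rule compactin_Un)
      have "continuous_map X ?D Inl" "continuous_map Y ?D Inr"
        unfolding continuous_map_def by (auto simp: ts o vimage_def Collect_conj_eq Int_absorb1 openin_subset)
      then show "compactin ?D (Inl ` topspace X)" "compactin ?D (Inr ` topspace Y)"
        using image_compactin X.compact Y.compact unfolding compact_space_def by blast+
    qed
    then show "compact_space ?D" by (simp add: compact_space_def ts)
    show "Hausdorff_space ?D"
    proof (rule Hausdorff_clopen_base)
      show "\<exists>V. openin ?D V \<and> closedin ?D V \<and> x \<in> V \<and> V \<subseteq> U" if "openin ?D U" "x \<in> U" for U x
        using B1 B2[OF that] by meson
      show "closedin ?D {x}" if "x \<in> topspace ?D" for x
        using that X.closed_finite[of "{_}"] Y.closed_finite[of "{_}"] by (auto simp: c ts)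
    qed
    show "\<exists>B. countable B \<and> (\<forall>U\<in>B. openin ?D U \<and> closedin ?D U) \<and>
      (\<forall>U x. openin ?D U \<longrightarrow> x \<in> U \<longrightarrow> (\<exists>V\<in>B. x \<in> V \<and> V \<subseteq> U))"
    proof (intro exI conjI)
      show "countable ?B" using BX(1) BY(1) by simp
    qed (use B1 B2 in blast)+
    have "non_isolated_points ?D = Inl ` non_isolated_points X \<union> Inr ` non_isolated_points Y"
      unfolding non_isolated_points_def ts by (auto simp: o)
    then show "non_isolated_points ?D = Inl ` K \<union> Inr ` L \<union> (Inl ` F \<union> Inr ` E)"
      unfolding X.derived Y.derived by auto
    show "(Inl ` K \<union> Inr ` L) \<inter> (Inl ` F \<union> Inr ` E) = {}" using X.disjoint Y.disjoint by auto
    show "finite (Inl ` F \<union> Inr ` E)" using X.finite_F Y.finite_F by simp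
    show "closedin ?D (Inl ` K \<union> Inr ` L)" using X.closed_K Y.closed_K by (simp add: c)
    show "\<exists>x\<in>U. openin ?D {x}" if U: "openin ?D U" "U \<noteq> {}" for U
    proof -
      obtain z where z: "z \<in> U" using U by blast
      show ?thesis
      proof (cases z)
        case (Inl a)
        then obtain x where "x \<in> Inl -` U" "openin X {x}"
          using X.dense_isolated[of "Inl -` U"] U(1) z by (auto simp: o)
        then show ?thesis by (intro bexI[of _ "Inl x"]) (auto simp: o)
      next
        case (Inr a)
        then obtain x where "x \<in> Inr -` U" "openin Y {x}"
          using Y.dense_isolated[of "Inr -` U"] U(1) z by (auto simp: o)
        then show ?thesis by (intro bexI[of _ "Inr x"]) (auto simp: o)
      qed
    qed
    show "\<exists>y\<in>U \<inter> (Inl ` K \<union> Inr ` L). y \<noteq> x"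
      if U: "openin ?D U" "x \<in> U" "x \<in> Inl ` K \<union> Inr ` L" for U x
    proof (cases x)
      case (Inl a)
      then obtain y where "y \<in> Inl -` U \<inter> K" "y \<noteq> a"
        using X.perfect[of "Inl -` U" a] U by (auto simp: o)
      then show ?thesis using Inl by (intro bexI[of _ "Inl y"]) auto
    next
      case (Inr a)
      then obtain y where "y \<in> Inr -` U \<inter> L" "y \<noteq> a"
        using Y.perfect[of "Inr -` U" a] U by (auto simp: o)
      then show ?thesis using Inr by (intro bexI[of _ "Inr y"]) auto
    qed
  qed
qed

lemma cantor_set_nonempty: "cantor_set \<noteq> {}"
  using cantor_intervals_endpoints[of 0 1 0] by auto

text \<open>In the model the Cantor set provides the perfect part and the nonzero limit ordinals up
  to \<omega>n provide the \<open>n\<close> extra points, so uniqueness applies.\<close>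

theorem pelczynski_type_homeomorphic:
  assumes "pelczynski_type X K F" "K \<noteq> {}"
  shows "X homeomorphic_space disjoint_union_topology pelczynski_space (omega_mult_plus_one (card F))"
proof (rule pelczynski_type_unique[OF assms(1) pelczynski_type_disjoint_union])
  show "pelczynski_type pelczynski_space cantor_set {}" by (rule pelczynski_type_pelczynski_space)
  show "pelczynski_type (omega_mult_plus_one (card F)) {} ((\<lambda>i. (Suc i, 0)) ` {..<card F})"
    by (rule pelczynski_type_omega)
  show "card F = card (Inl ` {} \<union> Inr ` (\<lambda>i. (Suc i, 0 :: nat)) ` {..<card F})"
    by (simp add: card_image inj_on_def)
qed (use assms(2) cantor_set_nonempty in auto)

section \<open>The space of closed subgroups of a filtered compact group\<close>

text \<open>The chain \<open>N\<close> replaces the family of all open normal subgroups: compactness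
  turns trivial intersection into a countable neighbourhood base of the identity.\<close>

locale filtered_group = group G for G (structure) +
  fixes T :: "'a topology" and N :: "nat \<Rightarrow> 'a set"
  assumes top: "topological_group G T"
    and compact: "compact_space T" and Hausdorff: "Hausdorff_space T"
    and normal: "N k \<lhd> G" and open_N: "openin T (N k)"
    and dec: "N (Suc k) \<subseteq> N k" and Inter: "(\<Inter>k. N k) = {\<one>}"
begin

lemma topspace_eq: "topspace T = carrier G"
  using top by (simp add: topological_group_def)

lemma antimono_N: "i \<le> j \<Longrightarrow> N j \<subseteq> N i"
  by (rule lift_Suc_antimono_le[of N]) (rule dec)

lemma subgroup_N: "subgroup (N k) G"
  using normal by (rule normal_imp_subgroup)

lemma continuous_mult: 
  assumes "x \<in> carrier G"
  shows "continuous_map T T (\<lambda>y. x \<otimes> y)" "continuous_map T T (\<lambda>y. y \<otimes> x)"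
proof -
  have m: "continuous_map (prod_topology T T) T (\<lambda>(x, y). x \<otimes> y)"
    using top by (simp add: topological_group_def)
  have "continuous_map T (prod_topology T T) (\<lambda>y. (x, y))" "continuous_map T (prod_topology T T) (\<lambda>y. (y, x))"
    using assms by (simp_all add: continuous_map_paired topspace_eq)
  from this[THEN continuous_map_compose, OF m]
  show "continuous_map T T (\<lambda>y. x \<otimes> y)" "continuous_map T T (\<lambda>y. y \<otimes> x)" by (simp_all add: o_def)
qed

lemma l_coset_eq_preimage:
  assumes U: "U \<subseteq> carrier G" and x: "x \<in> carrier G"
  shows "x <# U = {y \<in> topspace T. inv x \<otimes> y \<in> U}"
proof (intro equalityI subsetI)
  fix y assume "y \<in> {y \<in> topspace T. inv x \<otimes> y \<in> U}"
  then have "y \<in> carrier G" "inv x \<otimes> y \<in> U" by (auto simp: topspace_eq)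
  moreover from this have "y = x \<otimes> (inv x \<otimes> y)" using x by (simp add: m_assoc[symmetric])
  ultimately show "y \<in> x <# U" by (auto simp: l_coset_def)
next
  fix y assume "y \<in> x <# U"
  then obtain u where "u \<in> U" "y = x \<otimes> u" by (auto simp: l_coset_def)
  then show "y \<in> {y \<in> topspace T. inv x \<otimes> y \<in> U}"
    using U x by (auto simp: m_assoc[symmetric] topspace_eq)
qed

lemma open_translate:
  assumes "openin T U" "x \<in> carrier G" shows "openin T (x <# U)"
  using openin_continuous_map_preimage[OF continuous_mult(1) assms(1)] assms openin_subset[OF assms(1)]
  by (simp add: l_coset_eq_preimage topspace_eq)

lemma closed_translate:
  assumes "closedin T U" "x \<in> carrier G" shows "closedin T (x <# U)"
  using closedin_continuous_map_preimage[OF continuous_mult(1) assms(1)] assms closedin_subset[OF assms(1)]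
  by (simp add: l_coset_eq_preimage topspace_eq)

lemma open_subgroup_closed:
  assumes H: "subgroup H G" "openin T H" shows "closedin T H"
proof -
  have HG: "H \<subseteq> carrier G" using H subgroup.subset by blast
  have "openin T (carrier G - H)"
  proof (subst openin_subopen, intro ballI)
    fix x assume x: "x \<in> carrier G - H"
    have "x <# H \<subseteq> carrier G - H"
    proof
      fix y assume "y \<in> x <# H"
      then obtain h where h: "h \<in> H" "y = x \<otimes> h" by (auto simp: l_coset_def)
      then have "h \<in> carrier G" using HG by blast
      have "y \<notin> H"
      proof
        assume "y \<in> H"
        then have "y \<otimes> inv h \<in> H" using h H by (simp add: subgroup.m_closed subgroup.m_inv_closed)
        moreover have "y \<otimes> inv h = x" using h x \<open>h \<in> carrier G\<close> by (simp add: m_assoc)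
        ultimately show False using x by blast
      qed
      then show "y \<in> carrier G - H" using h x \<open>h \<in> carrier G\<close> by simp
    qed
    moreover have "x \<in> x <# H" using x subgroup.one_closed[OF H(1)] by (force simp: l_coset_def)
    ultimately show "\<exists>U. openin T U \<and> x \<in> U \<and> U \<subseteq> carrier G - H"
      using open_translate[OF H(2)] x by blast
  qed
  then show ?thesis unfolding closedin_def topspace_eq using HG by blast
qed

lemma closed_N: "closedin T (N k)"
  by (rule open_subgroup_closed[OF subgroup_N open_N])

text \<open>Otherwise the nested closed sets \<open>N k - U\<close> would be nonempty and, by
  compactness, have a common point; but only the identity lies in every \<open>N k\<close>.\<close>

lemma N_nhd_base:
  assumes "openin T U" "\<one> \<in> U" shows "\<exists>k. N k \<subseteq> U"
proof (rule ccontr)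
  assume "\<not> ?thesis"
  then have ne: "N k - U \<noteq> {}" for k by blast
  have "(\<Inter>k. N k - U) \<noteq> {}"
  proof (rule compact_space_imp_nest[OF compact])
    show "closedin T (N k - U)" for k by (rule closedin_diff[OF closed_N assms(1)])
    show "decseq (\<lambda>k. N k - U)" using antimono_N by (auto simp: decseq_def)
  qed (rule ne)
  moreover have "(\<Inter>k. N k - U) \<subseteq> (\<Inter>k. N k) - U" by blast
  ultimately show False using Inter assms(2) by auto
qed

lemma coset_nhd_base:
  assumes "openin T U" "x \<in> U" shows "\<exists>k. \<forall>n\<in>N k. x \<otimes> n \<in> U"
proof -
  have x: "x \<in> carrier G" using assms openin_subset topspace_eq by blast
  have "openin T {y \<in> topspace T. x \<otimes> y \<in> U}"
    by (rule openin_continuous_map_preimage[OF continuous_mult(1)[OF x] assms(1)])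
  moreover have "\<one> \<in> {y \<in> topspace T. x \<otimes> y \<in> U}" using assms x by (simp add: topspace_eq)
  ultimately show ?thesis using N_nhd_base by blast
qed

lemma mem_set_mult: "x \<in> A <#> B \<longleftrightarrow> (\<exists>a\<in>A. \<exists>b\<in>B. x = a \<otimes> b)"
  by (auto simp: set_mult_def)

lemma set_mult_absorb:
  assumes "subgroup A G" "subgroup B G" "A \<subseteq> B" shows "A <#> B = B" "B <#> A = B"
proof -
  have "b = \<one> \<otimes> b" "b = b \<otimes> \<one>" "b \<in> carrier G" if "b \<in> B" for b
    using that subgroup.mem_carrier[OF assms(2)] by auto
  moreover have "\<one> \<in> A" using assms by (simp add: subgroup.one_closed)
  ultimately have "B \<subseteq> A <#> B" "B \<subseteq> B <#> A" unfolding subset_iff mem_set_mult by blast+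
  moreover have "A <#> B \<subseteq> B" "B <#> A \<subseteq> B"
    using assms(3) subgroup.m_closed[OF assms(2)] unfolding subset_iff mem_set_mult by blast+
  ultimately show "A <#> B = B" "B <#> A = B" by auto
qed

lemma subgroup_mult_N:
  assumes "subgroup H G"
  shows "subgroup (H <#> N k) G" "openin T (H <#> N k)" "closedin T (H <#> N k)"
    "H \<subseteq> H <#> N k" "N k \<subseteq> H <#> N k"
proof -
  show s: "subgroup (H <#> N k) G"
    using mult_norm_subgroup[OF normal assms] commut_normal[OF assms normal] by simp
  have "H <#> N k = (\<Union>h\<in>H. h <# N k)" by (auto simp: set_mult_def l_coset_def)
  then show o: "openin T (H <#> N k)"
    using open_translate[OF open_N] subgroup.mem_carrier[OF assms] by auto
  show "closedin T (H <#> N k)" by (rule open_subgroup_closed[OF s o])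
  have one: "\<one> \<in> H" "\<one> \<in> N k" using assms subgroup_N subgroup.one_closed by blast+
  show "H \<subseteq> H <#> N k"
  proof
    fix h assume h: "h \<in> H"
    then have "h = h \<otimes> \<one>" using subgroup.mem_carrier[OF assms] by simp
    then show "h \<in> H <#> N k" using h one unfolding mem_set_mult by blast
  qed
  show "N k \<subseteq> H <#> N k"
  proof
    fix h assume h: "h \<in> N k"
    then have "h = \<one> \<otimes> h" using subgroup.mem_carrier[OF subgroup_N] by simp
    then show "h \<in> H <#> N k" using h one unfolding mem_set_mult by blast
  qed
qed

lemma set_mult_N_N:
  assumes "H \<subseteq> carrier G" "i \<le> j"
  shows "(H <#> N i) <#> N j = H <#> N i" "(H <#> N j) <#> N i = H <#> N i"
  using set_mult_absorb[OF subgroup_N subgroup_N antimono_N[OF assms(2)]]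
    set_mult_assoc[OF assms(1) subgroup.subset[OF subgroup_N] subgroup.subset[OF subgroup_N]] by simp_all

lemma closed_subgroupsD:
  assumes "H \<in> closed_subgroups G T"
  shows "subgroup H G" "closedin T H" "H \<subseteq> carrier G"
  using assms subgroup.subset by (auto simp: closed_subgroups_def)

lemma mult_N_closed_subgroup:
  "H \<in> closed_subgroups G T \<Longrightarrow> H <#> N k \<in> closed_subgroups G T"
  using subgroup_mult_N(1,3)[OF closed_subgroupsD(1)] unfolding closed_subgroups_def by blast

text \<open>A closed subgroup is the intersection of its thickenings \<open>H <#> N k\<close>, since
  a point outside \<open>H\<close> has a coset of some \<open>N k\<close> disjoint from
  \<open>H\<close>.\<close>

lemma closed_subgroup_memI:
  assumes H: "H \<in> closed_subgroups G T" and x: "\<And>k. x \<in> H <#> N k"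
  shows "x \<in> H"
proof (rule ccontr)
  note h = closed_subgroupsD[OF H]
  assume "x \<notin> H"
  have xG: "x \<in> carrier G" using x[of 0] subgroup.mem_carrier[OF subgroup_mult_N(1)[OF h(1)]] by blast
  then have "openin T (carrier G - H)" using h(2) unfolding closedin_def topspace_eq by blast
  then obtain k where k: "\<forall>n\<in>N k. x \<otimes> n \<in> carrier G - H" using coset_nhd_base \<open>x \<notin> H\<close> xG by blast
  obtain a n where an: "a \<in> H" "n \<in> N k" "x = a \<otimes> n" using x[of k] unfolding mem_set_mult by blast
  then have "n \<in> carrier G" "a \<in> carrier G" using h(3) subgroup.mem_carrier[OF subgroup_N] by blast+
  then have "x \<otimes> inv n = a" using an by (simp add: m_assoc)
  then show False using k an subgroup.m_inv_closed[OF subgroup_N an(2)] by auto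
qed

lemma closed_subgroup_eqI:
  assumes H: "H \<in> closed_subgroups G T" and K: "K \<in> closed_subgroups G T"
    and eq: "\<And>k. H <#> N k = K <#> N k"
  shows "H = K"
  using closed_subgroup_memI[OF H] closed_subgroup_memI[OF K] eq
    subgroup_mult_N(4)[OF closed_subgroupsD(1)[OF H]] subgroup_mult_N(4)[OF closed_subgroupsD(1)[OF K]]
  by blast

lemma finite_rcosets_N: "finite (rcosets (N k))"
proof -
  have cov: "\<Union>(rcosets (N k)) = carrier G" by (rule rcosets_part_G[OF subgroup_N])
  have "openin T c" if "c \<in> rcosets (N k)" for c
  proof -
    obtain x where "x \<in> carrier G" "c = N k #> x" using \<open>c \<in> _\<close> by (auto simp: RCOSETS_def)
    then have "c = x <# N k" using normal.coset_eq[OF normal] by auto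
    then show ?thesis using open_translate[OF open_N \<open>x \<in> carrier G\<close>] by simp
  qed
  then obtain \<F> where F: "finite \<F>" "\<F> \<subseteq> rcosets (N k)" "carrier G \<subseteq> \<Union>\<F>"
    using compact cov unfolding compact_space_alt topspace_eq by (metis order_refl)
  have "rcosets (N k) \<subseteq> \<F>"
  proof
    fix c assume c: "c \<in> rcosets (N k)"
    then obtain x where x: "x \<in> carrier G" "c = N k #> x" by (auto simp: RCOSETS_def)
    then have xc: "x \<in> c" using rcos_self subgroup_N by blast
    obtain d where d: "d \<in> \<F>" "x \<in> d" using F x by blast
    have "c = d" using rcos_disjoint[OF subgroup_N] c d F xc
      by (meson disjointD disjnt_iff pairwiseD subsetD disjoint_iff)
    then show "c \<in> \<F>" using d by simp
  qed
  then show ?thesis using F finite_subset by blast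
qed

text \<open>Each \<open>H <#> N k\<close> is a union of cosets of \<open>N k\<close>, of which there
  are finitely many. This makes the space of closed subgroups profinite.\<close>

lemma finite_mult_N: "finite ((\<lambda>H. H <#> N k) ` closed_subgroups G T)"
proof -
  have "(\<lambda>H. H <#> N k) ` closed_subgroups G T \<subseteq> Union ` Pow (rcosets (N k))"
  proof
    fix A assume "A \<in> (\<lambda>H. H <#> N k) ` closed_subgroups G T"
    then obtain H where H: "H \<in> closed_subgroups G T" "A = H <#> N k" by blast
    have "A = N k <#> H" using commut_normal[OF closed_subgroupsD(1)[OF H(1)] normal] H by simp
    also have "\<dots> = \<Union>((\<lambda>h. N k #> h) ` H)" by (auto simp: set_mult_def r_coset_def)
    finally show "A \<in> Union ` Pow (rcosets (N k))"
      using closed_subgroupsD(3)[OF H(1)] by (auto simp: RCOSETS_def)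
  qed
  then show ?thesis using finite_rcosets_N by (meson finite_Pow_iff finite_imageI finite_subset)
qed

section \<open>The topology of the space of closed subgroups\<close>

abbreviation X where "X \<equiv> subgroup_space G T"
abbreviation nhd where "nhd k H \<equiv> subgroup_nhd G T H (N k)"

lemma mem_nhd: "K \<in> nhd k H \<longleftrightarrow> K \<in> closed_subgroups G T \<and> K <#> N k = H <#> N k"
  by (simp add: subgroup_nhd_def)

lemma open_normal_N: "open_normal G T (N k)"
  using normal open_N by (simp add: open_normal_def)

lemma nhd_antimono: "i \<le> j \<Longrightarrow> H \<in> closed_subgroups G T \<Longrightarrow> nhd j H \<subseteq> nhd i H"
  unfolding mem_nhd subset_iff by (metis closed_subgroupsD(3) set_mult_N_N(2))

text \<open>Every open normal subgroup contains some \<open>N k\<close>, and a smaller subgroup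
  gives a smaller neighbourhood.\<close>

lemma openin_X:
  "openin X U \<longleftrightarrow> U \<subseteq> closed_subgroups G T \<and> (\<forall>H\<in>U. \<exists>k. nhd k H \<subseteq> U)"
proof
  assume U: "openin X U"
  then have sub: "U \<subseteq> closed_subgroups G T" unfolding openin_subgroup_space[OF top] by blast
  moreover have "\<exists>k. nhd k H \<subseteq> U" if "H \<in> U" for H
  proof -
    obtain M where M: "open_normal G T M" "subgroup_nhd G T H M \<subseteq> U"
      using U \<open>H \<in> U\<close> unfolding openin_subgroup_space[OF top] by blast
    then have M': "M \<lhd> G" "openin T M" by (auto simp: open_normal_def)
    then have "\<one> \<in> M" by (simp add: normal_imp_subgroup subgroup.one_closed)
    then obtain k where "N k \<subseteq> M" using N_nhd_base[OF M'(2)] by blast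
    then have "M \<inter> N k = N k" by blast
    then have "nhd k H \<subseteq> subgroup_nhd G T H M"
      using subgroup_nhd_Int(2)[OF is_group M(1) open_normal_N[of k], of H] \<open>H \<in> U\<close> sub by auto
    then show ?thesis using M(2) by blast
  qed
  ultimately show "U \<subseteq> closed_subgroups G T \<and> (\<forall>H\<in>U. \<exists>k. nhd k H \<subseteq> U)" by blast
next
  assume "U \<subseteq> closed_subgroups G T \<and> (\<forall>H\<in>U. \<exists>k. nhd k H \<subseteq> U)"
  then show "openin X U" unfolding openin_subgroup_space[OF top] using open_normal_N by blast
qed

lemma nhd_self: "H \<in> closed_subgroups G T \<Longrightarrow> H \<in> nhd k H"
  by (simp add: mem_nhd)

lemma open_nhd: "openin X (nhd k H)"
proof -
  have "nhd k K = nhd k H" if "K \<in> nhd k H" for K using that by (auto simp: mem_nhd)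
  then show ?thesis unfolding openin_X mem_nhd by (metis mem_nhd subsetI)
qed

lemma topspace_X: "topspace X = closed_subgroups G T"
proof
  show "topspace X \<subseteq> closed_subgroups G T" using openin_X openin_topspace by blast
  have "openin X (closed_subgroups G T)" unfolding openin_X by (auto simp: mem_nhd)
  then show "closed_subgroups G T \<subseteq> topspace X" by (rule openin_subset)
qed

lemma closed_nhd: "closedin X (nhd k H)"
proof -
  have "openin X (closed_subgroups G T - nhd k H)"
    unfolding openin_X
  proof (intro conjI ballI)
    fix K assume "K \<in> closed_subgroups G T - nhd k H"
    then show "\<exists>j. nhd j K \<subseteq> closed_subgroups G T - nhd k H"
      by (intro exI[of _ k]) (auto simp: mem_nhd)
  qed blast
  then show ?thesis unfolding closedin_def topspace_X by (auto simp: mem_nhd)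
qed

text \<open>A Koenig argument. Without a finite subcover one can descend through neighbourhoods
  \<open>nhd k (H k)\<close> none of which is finitely covered. They are the neighbourhoods of a
  single closed subgroup \<open>L\<close>, and a member of the cover containing \<open>L\<close>
  contains one of them.\<close>

lemma compact_X: "compact_space X"
  unfolding compact_space_alt topspace_X
proof (intro allI impI, rule ccontr)
  fix \<U> assume U: "(\<forall>U\<in>\<U>. openin X U) \<and> closed_subgroups G T \<subseteq> \<Union>\<U>"
    and nofin: "\<nexists>\<F>. finite \<F> \<and> \<F> \<subseteq> \<U> \<and> closed_subgroups G T \<subseteq> \<Union>\<F>"
  define bad where "bad A \<longleftrightarrow> \<not> (\<exists>\<F>. finite \<F> \<and> \<F> \<subseteq> \<U> \<and> A \<subseteq> \<Union>\<F>)" for A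
  have badUn: "\<exists>A\<in>\<A>. bad A" if fin: "finite \<A>" and b: "bad (\<Union>\<A>)" for \<A>
  proof (rule ccontr)
    assume "\<not> ?thesis"
    then obtain \<F> where F: "\<And>A. A \<in> \<A> \<Longrightarrow> finite (\<F> A) \<and> \<F> A \<subseteq> \<U> \<and> A \<subseteq> \<Union>(\<F> A)"
      unfolding bad_def by metis
    let ?F = "\<Union>(\<F> ` \<A>)"
    have "finite ?F" "?F \<subseteq> \<U>" using F fin by (intro finite_UN_I, simp_all, blast)
    moreover have "\<Union>\<A> \<subseteq> \<Union>?F"
    proof
      fix x assume "x \<in> \<Union>\<A>"
      then obtain A where A: "A \<in> \<A>" "x \<in> A" by blast
      then have "x \<in> \<Union>(\<F> A)" using F[OF A(1)] by (meson subsetD)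
      then show "x \<in> \<Union>?F" using A(1) by (meson UN_I UnionE UnionI)
    qed
    ultimately have "\<exists>\<F>. finite \<F> \<and> \<F> \<subseteq> \<U> \<and> \<Union>\<A> \<subseteq> \<Union>\<F>" by (intro exI[of _ ?F] conjI)
    then show False using b unfolding bad_def by (rule notE[rotated])
  qed
  have finnhd: "finite (nhd k ` closed_subgroups G T)" for k
  proof -
    have "nhd k ` closed_subgroups G T = (\<lambda>A. {K \<in> closed_subgroups G T. K <#> N k = A}) ` (\<lambda>H. H <#> N k) ` closed_subgroups G T"
      by (simp add: image_image subgroup_nhd_def)
    then show ?thesis using finite_mult_N by simp
  qed
  \<comment> \<open>Level \<open>k\<close> cuts \<open>A\<close> into finitely many pieces, so one
    of them inherits the badness of \<open>A\<close>.\<close>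
  have step: "\<exists>K \<in> A. bad (nhd k K \<inter> A)" if "A \<subseteq> closed_subgroups G T" "bad A" for A k
  proof -
    have "(\<lambda>K. nhd k K \<inter> A) ` A = (\<lambda>U. U \<inter> A) ` nhd k ` A" by (simp add: image_image)
    then have "finite ((\<lambda>K. nhd k K \<inter> A) ` A)"
      using finite_subset[OF image_mono[OF that(1)] finnhd[of k]] by simp
    moreover have "\<Union>((\<lambda>K. nhd k K \<inter> A) ` A) = A" using that nhd_self by blast
    ultimately show ?thesis using badUn[of "(\<lambda>K. nhd k K \<inter> A) ` A"] \<open>bad A\<close> by auto
  qed
  have "\<exists>H. \<forall>k. (H k \<in> closed_subgroups G T \<and> bad (nhd k (H k))) \<and> H (Suc k) \<in> nhd k (H k)"
  proof (rule dependent_nat_choice)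
    have "bad (closed_subgroups G T)" using nofin by (simp add: bad_def)
    then obtain K where "K \<in> closed_subgroups G T" "bad (nhd 0 K \<inter> closed_subgroups G T)"
      using step by blast
    moreover have "nhd 0 K \<inter> closed_subgroups G T = nhd 0 K" by (auto simp: mem_nhd)
    ultimately show "\<exists>H. H \<in> closed_subgroups G T \<and> bad (nhd 0 H)" by metis
  next
    fix H k assume H: "H \<in> closed_subgroups G T \<and> bad (nhd k H)"
    then obtain K where K: "K \<in> nhd k H" "bad (nhd (Suc k) K \<inter> nhd k H)"
      using step[of "nhd k H" "Suc k"] by (force simp: subgroup_nhd_def)
    have KC: "K \<in> closed_subgroups G T" using K by (simp add: mem_nhd)
    have "nhd (Suc k) K \<subseteq> nhd k H" using nhd_antimono[of k "Suc k" K] K KC by (auto simp: mem_nhd)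
    then show "\<exists>K. (K \<in> closed_subgroups G T \<and> bad (nhd (Suc k) K)) \<and> K \<in> nhd k H"
      using K KC by (metis inf.absorb1)
  qed
  then obtain H where H: "\<And>k. H k \<in> closed_subgroups G T" "\<And>k. bad (nhd k (H k))"
    "\<And>k. H (Suc k) \<in> nhd k (H k)" by blast
  \<comment> \<open>\<open>nhd k (H k)\<close> depends on \<open>H k\<close> only through
    \<open>A k\<close>. The \<open>A k\<close> are compatible from level to level, and their
    intersection \<open>L\<close> is to satisfy \<open>L <#> N k = A k\<close>.\<close>
  define A where "A k = H k <#> N k" for k
  have sA: "subgroup (A k) G" "closedin T (A k)" for k
    using subgroup_mult_N closed_subgroupsD(1)[OF H(1)] by (auto simp: A_def)
  have AG: "A k \<subseteq> carrier G" for k using sA subgroup.subset by blast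
  have AS: "A (Suc k) <#> N k = A k" for k
    using H(3)[of k] set_mult_N_N(2)[OF closed_subgroupsD(3)[OF H(1)], of k "Suc k" "Suc k"]
    by (simp add: A_def mem_nhd)
  have Adec: "A (Suc k) \<subseteq> A k" for k
    using subgroup_mult_N(4)[OF sA(1), of "Suc k" k] AS by simp
  have Aanti: "i \<le> j \<Longrightarrow> A j \<subseteq> A i" for i j
    by (rule lift_Suc_antimono_le[of A]) (rule Adec)
  have AN: "A (k + j) <#> N k = A k" for k j
  proof (induction j)
    case 0
    have "A k <#> N k = A k" unfolding A_def by (rule set_mult_N_N(1)[OF closed_subgroupsD(3)[OF H(1)]]) simp
    then show ?case by simp
  next
    case (Suc j)
    have "A (k + Suc j) <#> N k = (A (k + Suc j) <#> N (k + j)) <#> N k"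
      using set_mult_N_N(2)[OF AG, of k "k + j"] by simp
    then show ?case using AS[of "k + j"] Suc by simp
  qed
  define L where "L = (\<Inter>k. A k)"
  have L: "L \<in> closed_subgroups G T"
  proof -
    have "subgroup L G" unfolding L_def by (rule subgroups_Inter) (use sA in auto)
    moreover have "closedin T L" unfolding L_def by (rule closedin_Inter) (use sA in auto)
    ultimately show ?thesis by (simp add: closed_subgroups_def)
  qed
  have LN: "L <#> N k = A k" for k
  proof
    have "L <#> N k \<subseteq> A k <#> N k" by (rule mono_set_mult) (auto simp: L_def)
    then show "L <#> N k \<subseteq> A k" using AN[of k 0] by simp
    show "A k \<subseteq> L <#> N k"
    proof
      fix x assume x: "x \<in> A k"
      then have xG: "x \<in> carrier G" using AG by blast
      \<comment> \<open>An element common to all \<open>D j\<close> lies in \<open>L\<close> and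
        differs from \<open>x\<close> by an element of \<open>N k\<close>. Each \<open>D j\<close>
        is nonempty because \<open>A (k + j) <#> N k = A k\<close>.\<close>
      define D where "D j = (x <# N k) \<inter> A (k + j)" for j
      have "closedin T (x <# N k)" by (rule closed_translate[OF closed_N xG])
      then have clD: "closedin T (D j)" for j using sA by (simp add: D_def closedin_Int)
      have neD: "D j \<noteq> {}" for j
      proof -
        obtain a n where an: "a \<in> A (k + j)" "n \<in> N k" "x = a \<otimes> n"
          using x AN[of k j] unfolding mem_set_mult[symmetric] by (metis mem_set_mult)
        then have "n \<in> carrier G" "a \<in> carrier G"
          using AG subgroup.mem_carrier[OF subgroup_N] by blast+
        then have "a = x \<otimes> inv n" using an by (simp add: m_assoc)
        then have "a \<in> x <# N k" using subgroup.m_inv_closed[OF subgroup_N an(2)] by (auto simp: l_coset_def)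
        then show ?thesis using an unfolding D_def by blast
      qed
      have "decseq D"
        unfolding decseq_def D_def by (intro allI impI Int_mono Aanti) auto
      then have "(\<Inter>j. D j) \<noteq> {}" using compact_space_imp_nest[OF compact, of D] clD neD by simp
      then obtain y where y: "\<And>j. y \<in> D j" by blast
      have "y \<in> L" unfolding L_def
      proof
        fix j show "y \<in> A j" using y[of j] Aanti[of j "k + j"] by (auto simp: D_def)
      qed
      obtain n where n: "n \<in> N k" "y = x \<otimes> n" using y[of 0] by (auto simp: D_def l_coset_def)
      then have nG: "n \<in> carrier G" using subgroup.mem_carrier[OF subgroup_N] by blast
      then have "x = y \<otimes> inv n" using n xG by (simp add: m_assoc)
      then show "x \<in> L <#> N k"
        using \<open>y \<in> L\<close> subgroup.m_inv_closed[OF subgroup_N n(1)] unfolding mem_set_mult by blast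
    qed
  qed
  obtain V where V: "V \<in> \<U>" "L \<in> V" using U L by blast
  then obtain k where "nhd k L \<subseteq> V" using U unfolding openin_X by blast
  moreover have "nhd k (H k) = nhd k L" unfolding subgroup_nhd_def LN A_def ..
  ultimately have "finite {V} \<and> {V} \<subseteq> \<U> \<and> nhd k (H k) \<subseteq> \<Union>{V}" using V by simp
  then show False using H(2)[of k] unfolding bad_def by blast
qed

lemma clopen_base_X:
  "\<exists>B. countable B \<and> (\<forall>U\<in>B. openin X U \<and> closedin X U) \<and>
      (\<forall>U x. openin X U \<longrightarrow> x \<in> U \<longrightarrow> (\<exists>V\<in>B. x \<in> V \<and> V \<subseteq> U))"
proof (intro exI conjI ballI allI impI)
  let ?B = "\<Union>k. (\<lambda>A. {K \<in> closed_subgroups G T. K <#> N k = A}) ` (\<lambda>H. H <#> N k) ` closed_subgroups G T"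
  show "countable ?B"
    by (intro countable_UN countableI_type countable_image countable_finite finite_mult_N)
  have B: "?B = (\<Union>k. nhd k ` closed_subgroups G T)" by (simp add: image_image subgroup_nhd_def)
  show "openin X U" "closedin X U" if "U \<in> ?B" for U
    using that unfolding B using open_nhd closed_nhd by auto
  show "\<exists>V\<in>?B. H \<in> V \<and> V \<subseteq> U" if "openin X U" "H \<in> U" for U H
    using that nhd_self unfolding B openin_X by blast
qed

lemma Hausdorff_X: "Hausdorff_space X"
proof (rule Hausdorff_clopen_base)
  show "\<exists>V. openin X V \<and> closedin X V \<and> H \<in> V \<and> V \<subseteq> U" if "openin X U" "H \<in> U" for U H
    using clopen_base_X that by metis
  fix H assume "H \<in> topspace X"
  then have H: "H \<in> closed_subgroups G T" by (simp add: topspace_X)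
  have "openin X (closed_subgroups G T - {H})"
    unfolding openin_X
  proof (intro conjI ballI)
    fix K assume K: "K \<in> closed_subgroups G T - {H}"
    then obtain k where "H <#> N k \<noteq> K <#> N k" using closed_subgroup_eqI[OF H] by blast
    then show "\<exists>k. nhd k K \<subseteq> closed_subgroups G T - {H}" by (intro exI[of _ k]) (auto simp: mem_nhd)
  qed blast
  then show "closedin X {H}" using H unfolding closedin_def topspace_X by simp
qed

end

section \<open>Subgroups meeting \<open>N 0\<close> trivially\<close>

text \<open>What is retained of the p-adic integers. \<open>closed_dichotomy\<close> expresses that
  an element of valuation at most \<open>k\<close> topologically generates a subgroup containing
  \<open>N k\<close>.\<close>

locale padic_filtered_group = filtered_group +
  assumes strict: "N (Suc k) \<noteq> N k"
    and comm: "x \<in> N 0 \<Longrightarrow> y \<in> N 0 \<Longrightarrow> x \<otimes> y = y \<otimes> x"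
    and torsion_free: "z \<in> N 0 \<Longrightarrow> (m::nat) > 0 \<Longrightarrow> z [^] m = \<one> \<Longrightarrow> z = \<one>"
    and closed_dichotomy: "H \<in> closed_subgroups G T \<Longrightarrow> h \<in> H \<Longrightarrow> h \<in> N 0 \<Longrightarrow> h \<notin> N (Suc k) \<Longrightarrow> N k \<subseteq> H"
begin

lemma inv_mult_cancel:
  assumes "x \<in> carrier G" "y \<in> carrier G"
  shows "inv x \<otimes> (x \<otimes> y) = y" "x \<otimes> (inv x \<otimes> y) = y"
  using assms by (simp_all add: m_assoc[symmetric])

text \<open>The name is justified by the finite index of \<open>N 0\<close>: some power of each
  element of \<open>H\<close> lies in \<open>N 0\<close>, hence is the identity. Conversely a
  torsion subgroup meets the torsion-free \<open>N 0\<close> trivially.\<close>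

definition torsion_subgroups where
  "torsion_subgroups = {H \<in> closed_subgroups G T. H \<inter> N 0 = {\<one>}}"

lemma N_not_trivial: "\<not> N k \<subseteq> {\<one>}"
proof
  assume "N k \<subseteq> {\<one>}"
  moreover have "\<one> \<in> N (Suc k)" using subgroup_N subgroup.one_closed by blast
  ultimately have "N (Suc k) = N k" using dec by blast
  then show False using strict by blast
qed

lemma not_torsion_subgroup:
  assumes "H \<in> closed_subgroups G T" "H \<notin> torsion_subgroups" shows "\<exists>k. N k \<subseteq> H"
proof -
  have "\<one> \<in> H \<inter> N 0" using subgroup.one_closed subgroup_N closed_subgroupsD(1)[OF assms(1)] by blast
  then obtain h where h: "h \<in> H" "h \<in> N 0" "h \<noteq> \<one>" using assms by (auto simp: torsion_subgroups_def)
  then obtain k where k: "h \<notin> N k" using Inter by blast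
  then obtain j where "k = Suc j" using h by (cases k) auto
  then show ?thesis using closed_dichotomy[OF assms(1) h(1,2)] k by blast
qed

lemma torsion_subgroup_not_N: "H \<in> torsion_subgroups \<Longrightarrow> \<not> N k \<subseteq> H"
  using antimono_N[of 0 k] N_not_trivial[of k] by (auto simp: torsion_subgroups_def)

lemma isolated_iff_torsion:
  assumes H: "H \<in> closed_subgroups G T"
  shows "openin X {H} \<longleftrightarrow> H \<notin> torsion_subgroups"
proof
  assume "openin X {H}"
  then obtain k where "nhd k H \<subseteq> {H}" unfolding openin_X by blast
  moreover have "H <#> N k \<in> nhd k H"
    using mult_N_closed_subgroup[OF H] set_mult_N_N(1)[OF closed_subgroupsD(3)[OF H], of k k]
    by (simp add: mem_nhd)
  ultimately have "H <#> N k = H" by blast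
  then have "N k \<subseteq> H" using subgroup_mult_N(5)[OF closed_subgroupsD(1)[OF H]] by metis
  then show "H \<notin> torsion_subgroups" using torsion_subgroup_not_N by blast
next
  assume "H \<notin> torsion_subgroups"
  then obtain k where k: "N k \<subseteq> H" using not_torsion_subgroup[OF H] by blast
  then have HN: "H <#> N j = H" if "j \<ge> k" for j
    using set_mult_absorb(2)[OF subgroup_N closed_subgroupsD(1)[OF H]] antimono_N[OF that] by blast
  \<comment> \<open>One level beyond \<open>k\<close>: a subgroup \<open>K\<close> agreeing with
    \<open>H\<close> modulo \<open>N (Suc k)\<close> contains an element of \<open>N k\<close>
    outside \<open>N (Suc k)\<close>. By \<open>closed_dichotomy\<close> it contains all of
    \<open>N k\<close>, so that thickening by \<open>N (Suc k)\<close> changes neither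
    \<open>K\<close> nor \<open>H\<close>.\<close>
  have "nhd (Suc k) H \<subseteq> {H}"
  proof
    fix K assume "K \<in> nhd (Suc k) H"
    then have K: "K \<in> closed_subgroups G T" "K <#> N (Suc k) = H" using HN by (auto simp: mem_nhd)
    obtain h where h: "h \<in> N k" "h \<notin> N (Suc k)" using strict dec by blast
    then have "h \<in> K <#> N (Suc k)" using k K by blast
    then obtain x n where xn: "x \<in> K" "n \<in> N (Suc k)" "h = x \<otimes> n" unfolding mem_set_mult by blast
    have nk: "n \<in> N k" using xn dec by blast
    have c: "x \<in> carrier G" "n \<in> carrier G" "h \<in> carrier G"
      using xn h closed_subgroupsD(3)[OF K(1)] subgroup.mem_carrier[OF subgroup_N] by blast+
    then have "x = h \<otimes> inv n" using xn(3) by (simp add: m_assoc)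
    then have "x \<in> N k"
      using subgroup.m_closed[OF subgroup_N h(1) subgroup.m_inv_closed[OF subgroup_N nk]] by simp
    moreover have "x \<notin> N (Suc k)" using xn h subgroup.m_closed[OF subgroup_N] by blast
    ultimately have "N k \<subseteq> K" using closed_dichotomy[OF K(1) xn(1)] antimono_N[of 0 k] by blast
    then have "K <#> N (Suc k) = K"
      using set_mult_absorb(2)[OF subgroup_N closed_subgroupsD(1)[OF K(1)], of "Suc k"] dec by blast
    then show "K \<in> {H}" using K by simp
  qed
  then show "openin X {H}" unfolding openin_X using H by blast
qed

lemma non_isolated_X: "non_isolated_points X = torsion_subgroups"
  unfolding non_isolated_points_def topspace_X using isolated_iff_torsion
  by (auto simp: torsion_subgroups_def)

lemma dense_isolated_X:
  assumes "openin X U" "U \<noteq> {}" shows "\<exists>H\<in>U. openin X {H}"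
proof -
  obtain H where H: "H \<in> U" using assms by blast
  obtain k where k: "nhd k H \<subseteq> U" using assms H unfolding openin_X by blast
  have HC: "H \<in> closed_subgroups G T" using H assms(1) unfolding openin_X by blast
  have "H <#> N k \<in> nhd k H"
    using mult_N_closed_subgroup[OF HC] set_mult_N_N(1)[OF closed_subgroupsD(3)[OF HC], of k k]
    by (simp add: mem_nhd)
  moreover have "H <#> N k \<notin> torsion_subgroups"
    using torsion_subgroup_not_N subgroup_mult_N(5)[OF closed_subgroupsD(1)[OF HC]] by blast
  ultimately show ?thesis using k isolated_iff_torsion mult_N_closed_subgroup[OF HC] by blast
qed

section \<open>Torsion subgroups inside and outside the centralizer\<close>

abbreviation C where "C \<equiv> group_centralizer G (N 0)"

lemma subgroup_C: "subgroup C G"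
proof
  show "C \<subseteq> carrier G" by (auto simp: group_centralizer_def)
  show "\<one> \<in> C" using subgroup.mem_carrier[OF subgroup_N] by (auto simp: group_centralizer_def)
next
  fix x y assume xy: "x \<in> C" "y \<in> C"
  then have c: "x \<in> carrier G" "y \<in> carrier G" by (auto simp: group_centralizer_def)
  have "x \<otimes> y \<otimes> z = z \<otimes> (x \<otimes> y)" if z: "z \<in> N 0" for z
  proof -
    have zc: "z \<in> carrier G" using z subgroup.mem_carrier[OF subgroup_N] by blast
    have e: "x \<otimes> z = z \<otimes> x" "y \<otimes> z = z \<otimes> y" using xy z by (auto simp: group_centralizer_def)
    have "x \<otimes> y \<otimes> z = x \<otimes> (z \<otimes> y)" using c zc e by (simp add: m_assoc)
    also have "\<dots> = (z \<otimes> x) \<otimes> y" using c zc by (simp add: m_assoc[symmetric] e)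
    finally show ?thesis using c zc by (simp add: m_assoc)
  qed
  then show "x \<otimes> y \<in> C" using c by (auto simp: group_centralizer_def)
next
  fix x assume x: "x \<in> C"
  then have c: "x \<in> carrier G" by (auto simp: group_centralizer_def)
  have "inv x \<otimes> z = z \<otimes> inv x" if z: "z \<in> N 0" for z
  proof -
    have zc: "z \<in> carrier G" using z subgroup.mem_carrier[OF subgroup_N] by blast
    have e: "x \<otimes> z = z \<otimes> x" using x z by (auto simp: group_centralizer_def)
    have "inv x \<otimes> z = inv x \<otimes> (z \<otimes> x) \<otimes> inv x" using c zc by (simp add: m_assoc)
    also have "\<dots> = inv x \<otimes> (x \<otimes> z) \<otimes> inv x" by (simp add: e)
    also have "\<dots> = z \<otimes> inv x" using c zc by (simp add: m_assoc[symmetric])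
    finally show ?thesis .
  qed
  then show "inv x \<in> C" using c by (auto simp: group_centralizer_def)
qed

lemma N_subset_C: "N k \<subseteq> C"
  using antimono_N[of 0 k] comm subgroup.mem_carrier[OF subgroup_N]
  by (auto simp: group_centralizer_def)

definition central_torsion where "central_torsion = {H \<in> torsion_subgroups. H \<subseteq> C}"
definition noncentral_torsion where "noncentral_torsion = {H \<in> torsion_subgroups. \<not> H \<subseteq> C}"

text \<open>Two powers of \<open>g\<close> fall into the same coset, as there are finitely many
  cosets; their quotient is the required power.\<close>

lemma power_in_N:
  assumes g: "g \<in> carrier G" shows "\<exists>m>0. g [^] (m::nat) \<in> N k"
proof -
  let ?f = "\<lambda>i::nat. N k #> (g [^] i)"
  have "range ?f \<subseteq> rcosets (N k)" using g by (auto simp: RCOSETS_def)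
  then have "\<not> inj ?f" using finite_rcosets_N[of k] finite_subset finite_imageD infinite_UNIV_nat by blast
  then obtain i j where "i \<noteq> j" "?f i = ?f j" unfolding inj_def by blast
  then obtain i j where ij: "i < j" "?f i = ?f j" by (metis nat_neq_iff)
  have "g [^] j \<in> ?f j" by (rule rcos_self[OF _ subgroup_N]) (use g in simp)
  then obtain n where n: "n \<in> N k" "g [^] j = n \<otimes> g [^] i" using ij(2) by (auto simp: r_coset_def)
  have nc: "n \<in> carrier G" using n subgroup.mem_carrier[OF subgroup_N] by blast
  have "g [^] (j - i) \<otimes> g [^] i = n \<otimes> g [^] i" using n ij g by (simp add: nat_pow_mult)
  then have "g [^] (j - i) = n" using g nc by simp
  then show ?thesis using n ij by (intro exI[of _ "j - i"]) auto
qed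

lemma torsion_subgroup_exponent:
  assumes "H \<in> torsion_subgroups" "h \<in> H" shows "\<exists>m>0. h [^] (m::nat) = \<one>"
proof -
  have H: "H \<in> closed_subgroups G T" "H \<inter> N 0 = {\<one>}" using assms by (auto simp: torsion_subgroups_def)
  obtain m :: nat where "m > 0" "h [^] m \<in> N 0"
    using power_in_N closed_subgroupsD(3)[OF H(1)] assms by blast
  moreover have "h [^] m \<in> H"
    by (induction m) (use closed_subgroupsD(1)[OF H(1)] assms in
      \<open>auto intro: subgroup.one_closed subgroup.m_closed\<close>)
  ultimately show ?thesis using H by blast
qed

text \<open>Write \<open>f = h \<otimes> z\<close> with \<open>h\<close> in \<open>H\<close> and
  \<open>z\<close> in \<open>N 0\<close>. The factors commute, and \<open>f\<close> and
  \<open>h\<close> have finite order, so \<open>z\<close> has finite order too and is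
  trivial.\<close>

lemma central_torsion_subset:
  assumes F: "F \<in> central_torsion" and H: "H \<in> central_torsion" and eq: "F <#> N 0 = H <#> N 0"
  shows "F \<subseteq> H"
proof
  have F': "F \<in> torsion_subgroups" "F \<subseteq> C" "F \<in> closed_subgroups G T"
    and H': "H \<in> torsion_subgroups" "H \<subseteq> C" "H \<in> closed_subgroups G T"
    using F H by (auto simp: central_torsion_def torsion_subgroups_def)
  fix f assume f: "f \<in> F"
  then have "f \<in> H <#> N 0" using subgroup_mult_N(4)[OF closed_subgroupsD(1)[OF F'(3)]] eq by blast
  then obtain h z where hz: "h \<in> H" "z \<in> N 0" "f = h \<otimes> z" unfolding mem_set_mult by blast
  have c: "h \<in> carrier G" "z \<in> carrier G" "f \<in> carrier G"
    using f hz closed_subgroupsD(3)[OF F'(3)] closed_subgroupsD(3)[OF H'(3)] subgroup.mem_carrier[OF subgroup_N]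
    by blast+
  have com: "h \<otimes> z = z \<otimes> h" using hz H'(2) by (auto simp: group_centralizer_def)
  obtain m :: nat where m: "m > 0" "f [^] m = \<one>" using torsion_subgroup_exponent[OF F'(1) f] by blast
  obtain n :: nat where n: "n > 0" "h [^] n = \<one>" using torsion_subgroup_exponent[OF H'(1) hz(1)] by blast
  have "f [^] (m * n) = \<one>" "h [^] (m * n) = \<one>"
    using m n c by (simp_all add: nat_pow_pow[symmetric], simp add: nat_pow_pow mult.commute[of m n] nat_pow_pow[of h n m, symmetric])
  moreover have "f [^] (m * n) = h [^] (m * n) \<otimes> z [^] (m * n)"
    unfolding hz(3) by (rule pow_mult_distrib[OF com c(1,2)])
  ultimately have "z [^] (m * n) = \<one>" using c by simp
  then have "z = \<one>" using torsion_free[OF hz(2), of "m * n"] m n by simp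
  then show "f \<in> H" using hz c by simp
qed

lemma finite_central_torsion: "finite central_torsion"
proof -
  have "inj_on (\<lambda>H. H <#> N 0) central_torsion"
    by (rule inj_onI) (use central_torsion_subset in blast)
  moreover have "(\<lambda>H. H <#> N 0) ` central_torsion \<subseteq> (\<lambda>H. H <#> N 0) ` closed_subgroups G T"
    by (auto simp: central_torsion_def torsion_subgroups_def)
  ultimately show ?thesis using finite_mult_N finite_subset finite_imageD by blast
qed

text \<open>Being contained in \<open>C\<close> is decided at level 0: if
  \<open>H \<subseteq> C\<close>, every \<open>K\<close> in \<open>nhd 0 H\<close> lies in
  \<open>H <#> N 0\<close>, hence in \<open>C\<close>. The other points of the complement are
  isolated.\<close>

lemma closed_noncentral: "closedin X noncentral_torsion"
proof -
  have "openin X (closed_subgroups G T - noncentral_torsion)"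
    unfolding openin_X
  proof (intro conjI ballI)
    fix H assume H: "H \<in> closed_subgroups G T - noncentral_torsion"
    show "\<exists>k. nhd k H \<subseteq> closed_subgroups G T - noncentral_torsion"
    proof (cases "H \<in> torsion_subgroups")
      case False
      then obtain k where "nhd k H \<subseteq> {H}" using isolated_iff_torsion H unfolding openin_X by blast
      then show ?thesis using H by blast
    next
      case True
      then have HC: "H \<subseteq> C" using H by (auto simp: noncentral_torsion_def)
      have "K \<subseteq> C" if "K \<in> nhd 0 H" for K
      proof -
        have K: "K \<in> closed_subgroups G T" "K <#> N 0 = H <#> N 0" using that by (auto simp: mem_nhd)
        have "K \<subseteq> H <#> N 0" using subgroup_mult_N(4)[OF closed_subgroupsD(1)[OF K(1)]] K(2) by metis
        also have "\<dots> \<subseteq> C <#> C" by (rule mono_set_mult[OF HC N_subset_C])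
        also have "\<dots> = C" by (rule set_mult_absorb(1)[OF subgroup_C subgroup_C order_refl])
        finally show ?thesis .
      qed
      then have "nhd 0 H \<inter> noncentral_torsion = {}" by (auto simp: noncentral_torsion_def)
      moreover have "nhd 0 H \<subseteq> closed_subgroups G T" by (auto simp: mem_nhd)
      ultimately show ?thesis by blast
    qed
  qed blast
  then show ?thesis
    unfolding closedin_def topspace_X by (auto simp: noncentral_torsion_def torsion_subgroups_def)
qed

text \<open>If \<open>f\<close> centralized \<open>N k\<close>, then \<open>z\<close> and its
  conjugate by \<open>f\<close> would have equal \<open>m\<close>-th powers for some
  \<open>m > 0\<close>. Roots are unique in the commutative torsion-free \<open>N 0\<close>, so
  \<open>f\<close> would centralize \<open>N 0\<close> as well.\<close>

lemma noncommuting_in_N: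
  assumes f: "f \<in> carrier G" "f \<notin> C" shows "\<exists>z\<in>N k. f \<otimes> z \<noteq> z \<otimes> f"
proof (rule ccontr)
  assume neg: "\<not> ?thesis"
  have "f \<otimes> z = z \<otimes> f" if z: "z \<in> N 0" for z
  proof -
    have zc: "z \<in> carrier G" using z subgroup.mem_carrier[OF subgroup_N] by blast
    obtain m :: nat where m: "m > 0" "z [^] m \<in> N k" using power_in_N[OF zc] by blast
    define w where "w = f \<otimes> z \<otimes> inv f"
    have w: "w \<in> N 0" unfolding w_def using normal_invE(2)[OF normal f(1) z] .
    have wc: "w \<in> carrier G" using w subgroup.mem_carrier[OF subgroup_N] by blast
    have "w [^] i = f \<otimes> z [^] i \<otimes> inv f" for i :: nat
    proof (induction i)
      case (Suc i)
      have "w [^] Suc i = (f \<otimes> z [^] i \<otimes> inv f) \<otimes> (f \<otimes> z \<otimes> inv f)" using Suc by (simp add: w_def[symmetric])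
      also have "\<dots> = f \<otimes> z [^] i \<otimes> (inv f \<otimes> f) \<otimes> z \<otimes> inv f" using f zc by (simp add: m_assoc inv_mult_cancel)
      also have "\<dots> = f \<otimes> z [^] Suc i \<otimes> inv f" using f zc by (simp add: m_assoc)
      finally show ?case .
    qed (use f in simp)
    then have "w [^] m = f \<otimes> z [^] m \<otimes> inv f" .
    also have "\<dots> = z [^] m \<otimes> f \<otimes> inv f" using neg m(2) by auto
    also have "\<dots> = z [^] m" using f zc by (simp add: m_assoc)
    finally have wm: "w [^] m = z [^] m" .
    have iz: "inv z \<in> N 0" using z subgroup.m_inv_closed[OF subgroup_N] by blast
    have "(w \<otimes> inv z) [^] m = w [^] m \<otimes> inv z [^] m"
      by (rule pow_mult_distrib[OF comm[OF w iz]]) (use wc zc in auto)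
    also have "\<dots> = \<one>" using wm zc by (simp add: nat_pow_inv)
    finally have "w \<otimes> inv z = \<one>"
      using torsion_free[OF subgroup.m_closed[OF subgroup_N w iz] m(1)] by blast
    then have "w = z" using wc zc by (metis inv_closed inv_equality inv_inv)
    then have "f \<otimes> z \<otimes> inv f \<otimes> f = z \<otimes> f" by (simp add: w_def)
    then show ?thesis using f zc by (simp add: m_assoc)
  qed
  then show False using f by (auto simp: group_centralizer_def)
qed

section \<open>Conjugates as approximations\<close>

definition conj_subgroup where "conj_subgroup z H = (\<lambda>h. z \<otimes> h \<otimes> inv z) ` H"

lemma conj_closed_subgroup:
  assumes H: "H \<in> closed_subgroups G T" and z: "z \<in> carrier G"
  shows "conj_subgroup z H \<in> closed_subgroups G T"
proof -
  note h = closed_subgroupsD[OF H]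
  have hc: "x \<in> carrier G" if "x \<in> H" for x using h that by blast
  have eq: "conj_subgroup z H = {y \<in> topspace T. inv z \<otimes> y \<otimes> z \<in> H}"
  proof (intro equalityI subsetI)
    fix y assume "y \<in> conj_subgroup z H"
    then obtain x where x: "x \<in> H" "y = z \<otimes> x \<otimes> inv z" by (auto simp: conj_subgroup_def)
    have "inv z \<otimes> y \<otimes> z = (inv z \<otimes> z) \<otimes> x \<otimes> (inv z \<otimes> z)"
      unfolding x(2) using z hc[OF x(1)] by (simp add: m_assoc inv_mult_cancel)
    then show "y \<in> {y \<in> topspace T. inv z \<otimes> y \<otimes> z \<in> H}" using x z hc[OF x(1)] by (simp add: topspace_eq)
  next
    fix y assume "y \<in> {y \<in> topspace T. inv z \<otimes> y \<otimes> z \<in> H}"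
    then have y: "y \<in> carrier G" "inv z \<otimes> y \<otimes> z \<in> H" by (auto simp: topspace_eq)
    have "y = (z \<otimes> inv z) \<otimes> y \<otimes> (z \<otimes> inv z)" using y z by simp
    also have "\<dots> = z \<otimes> (inv z \<otimes> y \<otimes> z) \<otimes> inv z" using y z by (simp add: m_assoc inv_mult_cancel)
    finally show "y \<in> conj_subgroup z H" using y(2) unfolding conj_subgroup_def by blast
  qed
  have cont: "continuous_map T T (\<lambda>y. inv z \<otimes> y \<otimes> z)"
    using continuous_map_compose[OF continuous_mult(1)[OF inv_closed[OF z]] continuous_mult(2)[OF z]]
    by (simp add: o_def)
  have "closedin T (conj_subgroup z H)"
    unfolding eq by (rule closedin_continuous_map_preimage[OF cont h(2)])
  moreover have "subgroup (conj_subgroup z H) G"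
  proof
    show "conj_subgroup z H \<subseteq> carrier G" using z hc by (auto simp: conj_subgroup_def)
    have "\<one> = z \<otimes> \<one> \<otimes> inv z" using z by simp
    then show "\<one> \<in> conj_subgroup z H" using subgroup.one_closed[OF h(1)] unfolding conj_subgroup_def by blast
  next
    fix a b assume "a \<in> conj_subgroup z H" "b \<in> conj_subgroup z H"
    then obtain x y where xy: "x \<in> H" "y \<in> H" "a = z \<otimes> x \<otimes> inv z" "b = z \<otimes> y \<otimes> inv z"
      by (auto simp: conj_subgroup_def)
    have "a \<otimes> b = z \<otimes> x \<otimes> (inv z \<otimes> z) \<otimes> y \<otimes> inv z"
      unfolding xy(3,4) using z hc[OF xy(1)] hc[OF xy(2)] by (simp add: m_assoc inv_mult_cancel)
    also have "\<dots> = z \<otimes> (x \<otimes> y) \<otimes> inv z" using z hc[OF xy(1)] hc[OF xy(2)] by (simp add: m_assoc)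
    finally show "a \<otimes> b \<in> conj_subgroup z H"
      using subgroup.m_closed[OF h(1) xy(1,2)] unfolding conj_subgroup_def by blast
  next
    fix a assume "a \<in> conj_subgroup z H"
    then obtain x where x: "x \<in> H" "a = z \<otimes> x \<otimes> inv z" by (auto simp: conj_subgroup_def)
    have "inv a = z \<otimes> inv x \<otimes> inv z"
      unfolding x(2) using z hc[OF x(1)] by (simp add: inv_mult_group m_assoc)
    then show "inv a \<in> conj_subgroup z H"
      using subgroup.m_inv_closed[OF h(1) x(1)] unfolding conj_subgroup_def by blast
  qed
  ultimately show ?thesis by (simp add: closed_subgroups_def)
qed

lemma perfect_noncentral:
  assumes U: "openin X U" "H \<in> U" "H \<in> noncentral_torsion"
  shows "\<exists>K\<in>U \<inter> noncentral_torsion. K \<noteq> H"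
proof -
  have H: "H \<in> closed_subgroups G T" "H \<inter> N 0 = {\<one>}" "\<not> H \<subseteq> C"
    using U(3) by (auto simp: noncentral_torsion_def torsion_subgroups_def)
  note h = closed_subgroupsD[OF H(1)]
  have hc: "x \<in> carrier G" if "x \<in> H" for x using h that by blast
  obtain f where f: "f \<in> H" "f \<notin> C" using H by blast
  obtain k where k: "nhd k H \<subseteq> U" using U unfolding openin_X by blast
  \<comment> \<open>The point of \<open>U\<close> other than \<open>H\<close> is the conjugate of \<open>H\<close> by \<open>z\<close>.\<close>
  obtain z where z: "z \<in> N k" "f \<otimes> z \<noteq> z \<otimes> f" using noncommuting_in_N[OF hc[OF f(1)] f(2)] by blast
  have zc: "z \<in> carrier G" and fc: "f \<in> carrier G" using z subgroup.mem_carrier[OF subgroup_N] hc f by blast+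
  have z0: "z \<in> N 0" using z antimono_N[of 0 k] by blast
  let ?K = "conj_subgroup z H"
  have K: "?K \<in> closed_subgroups G T" by (rule conj_closed_subgroup[OF H(1) zc])
  have "?K <#> N k = H <#> N k"
  proof
    \<comment> \<open>Conjugation by an element of \<open>N k\<close> moves nothing out of the
      subgroup \<open>L <#> N k\<close>. It is applied to \<open>H\<close> with \<open>z\<close> and
      to the conjugate with \<open>inv z\<close>, one for each inclusion.\<close>
    have sub: "conj_subgroup y L \<subseteq> L <#> N k"
      if y: "y \<in> N k" and L: "L \<in> closed_subgroups G T" for y L
    proof -
      note l = closed_subgroupsD[OF L]
      have "y \<otimes> x \<otimes> inv y \<in> L <#> N k" if "x \<in> L" for x
      proof -
        have "y \<in> L <#> N k" "x \<in> L <#> N k" using subgroup_mult_N(4,5)[OF l(1)] y that by blast+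
        then show ?thesis using subgroup_mult_N(1)[OF l(1)]
          by (meson subgroup.m_closed subgroup.m_inv_closed)
      qed
      then show ?thesis by (auto simp: conj_subgroup_def)
    qed
    have "?K <#> N k \<subseteq> (H <#> N k) <#> N k" by (rule mono_set_mult[OF sub[OF z(1) H(1)] order_refl])
    then show "?K <#> N k \<subseteq> H <#> N k" using set_mult_N_N(1)[OF h(3), of k k] by simp
    have iz: "inv z \<in> N k" using z subgroup.m_inv_closed[OF subgroup_N] by blast
    have "H \<subseteq> conj_subgroup (inv z) ?K"
    proof
      fix x assume x: "x \<in> H"
      have "inv z \<otimes> (z \<otimes> x \<otimes> inv z) \<otimes> inv (inv z) = (inv z \<otimes> z) \<otimes> x \<otimes> (inv z \<otimes> z)"
        using zc hc[OF x] by (simp add: m_assoc inv_mult_cancel)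
      then have "x = inv z \<otimes> (z \<otimes> x \<otimes> inv z) \<otimes> inv (inv z)" using zc hc[OF x] by simp
      then show "x \<in> conj_subgroup (inv z) ?K" using x unfolding conj_subgroup_def by blast
    qed
    also have "\<dots> \<subseteq> ?K <#> N k" by (rule sub[OF iz K])
    finally have "H <#> N k \<subseteq> (?K <#> N k) <#> N k" by (rule mono_set_mult[OF _ order_refl])
    then show "H <#> N k \<subseteq> ?K <#> N k" using set_mult_N_N(1)[OF closed_subgroupsD(3)[OF K], of k k] by simp
  qed
  then have KU: "?K \<in> U" using K k by (auto simp: mem_nhd)
  have tors: "?K \<inter> N 0 \<subseteq> {\<one>}"
  proof
    fix y assume y: "y \<in> ?K \<inter> N 0"
    then obtain x where x: "x \<in> H" "y = z \<otimes> x \<otimes> inv z" by (auto simp: conj_subgroup_def)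
    have "inv z \<otimes> y \<otimes> inv (inv z) \<in> N 0" by (rule normal_invE(2)[OF normal]) (use y zc in auto)
    moreover have "inv z \<otimes> y \<otimes> inv (inv z) = (inv z \<otimes> z) \<otimes> x \<otimes> (inv z \<otimes> z)"
      unfolding x(2) using zc hc[OF x(1)] by (simp add: m_assoc inv_mult_cancel)
    ultimately have "x \<in> N 0" using zc hc[OF x(1)] by simp
    then have "x = \<one>" using H x by blast
    then show "y \<in> {\<one>}" using x zc by simp
  qed
  have "\<one> \<in> ?K \<inter> N 0" using subgroup.one_closed[OF subgroup_N] subgroup.one_closed[OF closed_subgroupsD(1)[OF K]] by blast
  then have torsK: "?K \<in> torsion_subgroups" using tors K by (auto simp: torsion_subgroups_def)
  have conj_f: "z \<otimes> f \<otimes> inv z \<in> ?K" using f by (auto simp: conj_subgroup_def)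
  \<comment> \<open>If the conjugate of \<open>f\<close> commuted with \<open>z\<close>, so would
    \<open>f\<close>.\<close>
  have "\<not> ?K \<subseteq> C"
  proof
    assume "?K \<subseteq> C"
    then have "(z \<otimes> f \<otimes> inv z) \<otimes> z = z \<otimes> (z \<otimes> f \<otimes> inv z)"
      using conj_f z0 by (auto simp: group_centralizer_def)
    then have "z \<otimes> f = z \<otimes> (z \<otimes> f \<otimes> inv z)" using zc fc by (simp add: m_assoc)
    then have "f = z \<otimes> f \<otimes> inv z" using zc fc by simp
    then have "f \<otimes> z = z \<otimes> f \<otimes> inv z \<otimes> z" by simp
    then show False using z(2) zc fc by (simp add: m_assoc)
  qed
  \<comment> \<open>If the two were equal, the commutator of \<open>z\<close> and \<open>f\<close>
    would lie in \<open>H\<close>, and also in the normal subgroup \<open>N 0\<close>; it would be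
    trivial, against the choice of \<open>z\<close>.\<close>
  moreover have "?K \<noteq> H"
  proof
    assume "?K = H"
    then have "z \<otimes> f \<otimes> inv z \<in> H" using conj_f by simp
    then have "z \<otimes> f \<otimes> inv z \<otimes> inv f \<in> H"
      using f(1) h(1) by (simp add: subgroup.m_closed subgroup.m_inv_closed)
    moreover have "z \<otimes> (f \<otimes> inv z \<otimes> inv f) \<in> N 0"
      using subgroup.m_closed[OF subgroup_N z0] normal_invE(2)[OF normal fc]
        subgroup.m_inv_closed[OF subgroup_N z0] by blast
    ultimately have "z \<otimes> f \<otimes> inv z \<otimes> inv f = \<one>"
      using H(2) zc fc by (auto simp: m_assoc)
    then have "z \<otimes> f \<otimes> inv z = f" using zc fc by (metis inv_closed inv_equality inv_inv m_closed)
    then have "f \<otimes> z = z \<otimes> f \<otimes> inv z \<otimes> z" by simp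
    then show False using z(2) zc fc by (simp add: m_assoc)
  qed
  ultimately show ?thesis using KU torsK by (auto simp: noncentral_torsion_def)
qed

lemma pelczynski_type_X: "pelczynski_type X noncentral_torsion central_torsion"
proof
  show "non_isolated_points X = noncentral_torsion \<union> central_torsion"
    unfolding non_isolated_X by (auto simp: noncentral_torsion_def central_torsion_def)
  show "noncentral_torsion \<inter> central_torsion = {}"
    by (auto simp: noncentral_torsion_def central_torsion_def)
  show "\<exists>H\<in>U. openin X {H}" if "openin X U" "U \<noteq> {}" for U
    using that by (rule dense_isolated_X)
  show "\<exists>K\<in>U \<inter> noncentral_torsion. K \<noteq> H" if "openin X U" "H \<in> U" "H \<in> noncentral_torsion" for U H
    using that by (rule perfect_noncentral)
qed (rule compact_X Hausdorff_X clopen_base_X finite_central_torsion closed_noncentral)+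

text \<open>Each isolated point is by itself a member of any base, so a countable base leaves only
  countably many; without noncentral subgroups the derived set is finite.\<close>

lemma noncentral_nonempty:
  assumes "uncountable (topspace X)" shows "noncentral_torsion \<noteq> {}"
proof
  assume e: "noncentral_torsion = {}"
  obtain B where B: "countable B" "\<forall>U x. openin X U \<longrightarrow> x \<in> U \<longrightarrow> (\<exists>V\<in>B. x \<in> V \<and> V \<subseteq> U)"
    using clopen_base_X by metis
  have "topspace X - torsion_subgroups \<subseteq> the_elem ` B"
  proof
    fix H assume "H \<in> topspace X - torsion_subgroups"
    then have "openin X {H}" using isolated_iff_torsion by (simp add: topspace_X)
    from B(2)[rule_format, OF this singletonI]
    obtain V where V: "V \<in> B" "H \<in> V \<and> V \<subseteq> {H}" by (rule bexE)
    then have "V = {H}" by auto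
    then show "H \<in> the_elem ` B" using V(1) by (intro image_eqI[of _ _ V]) simp_all
  qed
  then have "countable (topspace X - torsion_subgroups)" using B(1) by (meson countable_image countable_subset)
  moreover have "torsion_subgroups = central_torsion"
    using e by (auto simp: noncentral_torsion_def central_torsion_def)
  then have "countable torsion_subgroups" using finite_central_torsion by (simp add: countable_finite)
  ultimately have c: "countable ((topspace X - torsion_subgroups) \<union> torsion_subgroups)"
    by (intro countable_Un)
  have "countable (topspace X)" by (rule countable_subset[OF _ c]) auto
  then show False using assms by blast
qed

end

section \<open>The filtration of the \<open>p\<close>-adic integers\<close>

text \<open>A subgroup containing \<open>N 0\<close> is open, hence closed, so closedness within
  \<open>D\<close> and within \<open>G\<close> agree. It will be applied to the centralizer.\<close>

lemma (in filtered_group) filtered_group_restrict: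
  assumes D: "subgroup D G" "N 0 \<subseteq> D"
  shows "filtered_group (G\<lparr>carrier := D\<rparr>) (subtopology T D) N"
    and "closed_subgroups (G\<lparr>carrier := D\<rparr>) (subtopology T D) = {H \<in> closed_subgroups G T. H \<subseteq> D}"
proof -
  have ND: "N k \<subseteq> D" for k using antimono_N[of 0 k] D(2) by blast
  have DG: "D \<subseteq> carrier G" using D(1) subgroup.subset by blast
  have "D <#> N 0 = D" by (rule set_mult_absorb(2)[OF subgroup_N D])
  then have D': "openin T D" "closedin T D" using subgroup_mult_N(2,3)[OF D(1), of 0] by simp_all
  interpret R: group "G\<lparr>carrier := D\<rparr>" by (rule subgroup.subgroup_is_group[OF D(1) is_group])
  show "filtered_group (G\<lparr>carrier := D\<rparr>) (subtopology T D) N"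
  proof (intro filtered_group.intro filtered_group_axioms.intro R.is_group)
    show "topological_group (G\<lparr>carrier := D\<rparr>) (subtopology T D)"
      unfolding topological_group_def
    proof (intro conjI)
      show "Group.group (G\<lparr>carrier := D\<rparr>)" by (rule R.is_group)
      show "topspace (subtopology T D) = carrier (G\<lparr>carrier := D\<rparr>)"
        using DG by (simp add: topspace_eq Int_absorb1)
      have "continuous_map (subtopology (prod_topology T T) (D \<times> D)) (subtopology T D) (\<lambda>(x, y). x \<otimes> y)"
        by (rule continuous_map_into_subtopology[OF continuous_map_from_subtopology])
          (use top subgroup.m_closed[OF D(1)] in \<open>auto simp: topological_group_def\<close>)
      then show "continuous_map (prod_topology (subtopology T D) (subtopology T D)) (subtopology T D)
          (\<lambda>(x, y). x \<otimes>\<^bsub>G\<lparr>carrier := D\<rparr>\<^esub> y)"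
        by (simp add: subtopology_Times)
      have "continuous_map (subtopology T D) (subtopology T D) (\<lambda>x. inv x)"
        by (rule continuous_map_into_subtopology[OF continuous_map_from_subtopology])
          (use top subgroup.m_inv_closed[OF D(1)] in \<open>auto simp: topological_group_def\<close>)
      then show "continuous_map (subtopology T D) (subtopology T D) (\<lambda>x. inv\<^bsub>G\<lparr>carrier := D\<rparr>\<^esub> x)"
        by (rule continuous_map_eq) (simp add: m_inv_consistent[OF D(1)])
    qed
    show "compact_space (subtopology T D)"
      using closedin_compact_space[OF compact D'(2)] by (simp add: compact_space_subtopology)
    show "Hausdorff_space (subtopology T D)" by (rule Hausdorff_space_subtopology[OF Hausdorff])
    show "N k \<lhd> G\<lparr>carrier := D\<rparr>" for k
      unfolding R.normal_inv_iff
    proof (intro conjI ballI)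
      show "subgroup (N k) (G\<lparr>carrier := D\<rparr>)" by (rule subgroup_incl[OF subgroup_N D(1) ND])
      fix x h assume x: "x \<in> carrier (G\<lparr>carrier := D\<rparr>)" "h \<in> N k"
      then have "x \<otimes> h \<otimes> inv x \<in> N k" using normal_invE(2)[OF normal] DG by auto
      then show "x \<otimes>\<^bsub>G\<lparr>carrier := D\<rparr>\<^esub> h \<otimes>\<^bsub>G\<lparr>carrier := D\<rparr>\<^esub> inv\<^bsub>G\<lparr>carrier := D\<rparr>\<^esub> x \<in> N k"
        using x m_inv_consistent[OF D(1)] by simp
    qed
    show "openin (subtopology T D) (N k)" for k
      unfolding openin_open_subtopology[OF D'(1)] using open_N ND by blast
    show "(\<Inter>k. N k) = {\<one>\<^bsub>G\<lparr>carrier := D\<rparr>\<^esub>}" using Inter by simp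
  qed (rule dec)
  show "closed_subgroups (G\<lparr>carrier := D\<rparr>) (subtopology T D) = {H \<in> closed_subgroups G T. H \<subseteq> D}"
    unfolding closed_subgroups_def closedin_closed_subtopology[OF D'(2)]
    using incl_subgroup[OF D(1)] subgroup_incl[OF _ D(1)] by blast
qed

lemma (in padic_filtered_group) padic_filtered_group_restrict:
  assumes D: "subgroup D G" "N 0 \<subseteq> D"
  shows "padic_filtered_group (G\<lparr>carrier := D\<rparr>) (subtopology T D) N"
proof -
  interpret R: filtered_group "G\<lparr>carrier := D\<rparr>" "subtopology T D" N
    by (rule filtered_group_restrict(1)[OF D])
  show ?thesis
  proof
    show "x \<otimes>\<^bsub>G\<lparr>carrier := D\<rparr>\<^esub> y = y \<otimes>\<^bsub>G\<lparr>carrier := D\<rparr>\<^esub> x" if "x \<in> N 0" "y \<in> N 0" for x y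
      using comm[OF that] by simp
    show "z = \<one>\<^bsub>G\<lparr>carrier := D\<rparr>\<^esub>"
      if "z \<in> N 0" "m > 0" "z [^]\<^bsub>G\<lparr>carrier := D\<rparr>\<^esub> m = \<one>\<^bsub>G\<lparr>carrier := D\<rparr>\<^esub>" for z and m :: nat
      using torsion_free[of z m] that by (simp add: nat_pow_consistent[symmetric])
    show "N k \<subseteq> H"
      if "H \<in> closed_subgroups (G\<lparr>carrier := D\<rparr>) (subtopology T D)" "h \<in> H" "h \<in> N 0" "h \<notin> N (Suc k)" for H h k
      using that closed_dichotomy unfolding filtered_group_restrict(2)[OF D] by blast
  qed (rule strict)
qed

text \<open>Inside the group \<open>C\<close> the derived set again consists of the closed subgroups
  meeting \<open>N 0\<close> trivially; as subgroups of \<open>G\<close> these are the central ones.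
  This identifies \<open>n\<close>.\<close>

lemma (in padic_filtered_group) non_isolated_centralizer:
  "non_isolated_points (subgroup_space (G\<lparr>carrier := C\<rparr>) (subtopology T C)) = central_torsion"
proof -
  interpret R: padic_filtered_group "G\<lparr>carrier := C\<rparr>" "subtopology T C" N
    by (rule padic_filtered_group_restrict[OF subgroup_C N_subset_C])
  show ?thesis
    unfolding R.non_isolated_X R.torsion_subgroups_def
      filtered_group_restrict(2)[OF subgroup_C N_subset_C] central_torsion_def torsion_subgroups_def
    by auto
qed

section \<open>Arithmetic of p-adic integers\<close>

lemma mem_padic_carrier_iff:
  assumes "p > 0"
  shows "x \<in> padic_carrier p \<longleftrightarrow> (\<forall>k. 0 \<le> x k \<and> x k < int (p ^ k) \<and> x (Suc k) mod int (p ^ k) = x k)"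
  using assms by (auto simp: padic_carrier_def carrier_integer_mod_group)

lemma padic_mod:
  assumes "p > 0" "x \<in> padic_carrier p" "k \<le> j"
  shows "x j mod int (p ^ k) = x k"
  using assms(3)
proof (induction j rule: dec_induct)
  case base
  then show ?case using assms by (simp add: mem_padic_carrier_iff)
next
  case (step j)
  have "int (p ^ k) dvd int (p ^ j)" using step.hyps by (simp add: le_imp_power_dvd)
  moreover have "x (Suc j) mod int (p ^ j) = x j" using assms by (simp add: mem_padic_carrier_iff)
  ultimately show ?case using step.IH by (metis mod_mod_cancel)
qed

text \<open>Division by \<open>p ^ k\<close>: the quotient modulo \<open>p ^ m\<close> is determined
  by \<open>x\<close> modulo \<open>p ^ (m + k)\<close>, whence the shift of the index.\<close>

lemma padic_shift:
  assumes p: "p > 0" and x: "x \<in> padic_carrier p" "x k = 0"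
  obtains y where "y \<in> padic_carrier p" "\<And>m. x m = int (p ^ k) * y m mod int (p ^ m)"
proof
  define y where "y m = x (m + k) div int (p ^ k)" for m
  have dv: "x (m + k) = int (p ^ k) * y m" for m
  proof -
    have "x (m + k) mod int (p ^ k) = 0" using padic_mod[OF p x(1), of k "m + k"] x(2) by simp
    then show ?thesis unfolding y_def by auto
  qed
  have pk: "int (p ^ k) > 0" using p by simp
  have "0 \<le> y m \<and> y m < int (p ^ m) \<and> y (Suc m) mod int (p ^ m) = y m" for m
  proof -
    have b: "0 \<le> x (m + k)" "x (m + k) < int (p ^ (m + k))" "x (Suc m + k) mod int (p ^ (m + k)) = x (m + k)"
      using x(1) by (simp_all add: mem_padic_carrier_iff[OF p])
    have "int (p ^ (m + k)) = int (p ^ k) * int (p ^ m)" by (simp add: power_add)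
    then have "int (p ^ k) * y m < int (p ^ k) * int (p ^ m)"
      "(int (p ^ k) * y (Suc m)) mod (int (p ^ k) * int (p ^ m)) = int (p ^ k) * y m"
      using b(2,3) unfolding dv by simp_all
    moreover have "0 \<le> y m" using b(1) pk unfolding y_def by (simp add: pos_imp_zdiv_nonneg_iff)
    ultimately show ?thesis using pk p by (simp add: mult_mod_right[symmetric])
  qed
  then show "y \<in> padic_carrier p" unfolding mem_padic_carrier_iff[OF p] by blast
  show "x m = int (p ^ k) * y m mod int (p ^ m)" for m
    using padic_mod[OF p x(1), of m "m + k"] unfolding dv by simp
qed

text \<open>The number \<open>p ^ k\<close> as a p-adic integer; it witnesses that the filtration is
  strictly decreasing.\<close>

lemma padic_power_mem:
  assumes "p > 0" shows "(\<lambda>m. int (p ^ k) mod int (p ^ m)) \<in> padic_carrier p"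
  unfolding mem_padic_carrier_iff[OF assms]
proof (intro allI conjI)
  fix m
  show "int (p ^ k) mod int (p ^ Suc m) mod int (p ^ m) = int (p ^ k) mod int (p ^ m)"
    by (rule mod_mod_cancel) simp
qed (use assms in simp_all)

lemma padic_torsion_free:
  assumes p: "prime p" and x: "x \<in> padic_carrier p" and m: "m > 0"
    and 0: "\<And>k. int m * x k mod int (p ^ k) = 0"
  shows "x k = 0"
proof -
  have p0: "p > 0" using p prime_gt_0_nat by blast
  \<comment> \<open>\<open>p ^ a\<close> is too large to divide \<open>m\<close>. So when
    \<open>p ^ (k + a)\<close> divides the product, the factor \<open>x (k + a)\<close> keeps more
    than \<open>k\<close> powers of \<open>p\<close>.\<close>
  obtain a where a: "m < p ^ a"
    using prime_ge_2_nat[OF p] m by (metis less_exp one_less_numeral_iff order_less_le_trans power_mono zero_le_numeral of_nat_0_le_iff)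
  have "int p ^ (k + a) dvd int m * x (k + a)" using 0[of "k + a"] by (simp add: dvd_eq_mod_eq_0)
  moreover have "prime_elem (int p)" using p by simp
  ultimately have "int p ^ a dvd int m \<or> int p ^ Suc k dvd x (k + a)"
    using prime_elem_power_dvd_cases[of "int p" "k + a" "int m" "x (k + a)" a "Suc k"] by simp
  moreover have "\<not> int p ^ a dvd int m"
    using a m by (metis nat_dvd_not_less of_nat_dvd_iff of_nat_power)
  ultimately have "int p ^ Suc k dvd x (k + a)" by blast
  then have "int (p ^ k) dvd x (k + a)" by (metis le_imp_power_dvd lessI less_imp_le_nat dvd_trans of_nat_power)
  then show "x k = 0" using padic_mod[OF p0 x, of k "k + a"] by (simp add: dvd_eq_mod_eq_0)
qed

text \<open>\<open>h (Suc k) \<noteq> 0\<close> bounds the valuation of \<open>h\<close> by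
  \<open>k\<close>. Hence the gcd of \<open>h m\<close> and \<open>p ^ m\<close> divides
  \<open>p ^ k\<close>, which divides \<open>x m\<close>, and Bezout solves the congruence. Reducing
  the multiplier modulo \<open>p ^ m\<close> makes it a natural number, fit to be an
  exponent.\<close>

lemma padic_multiple:
  assumes p: "prime p" and h: "h \<in> padic_carrier p" "h (Suc k) \<noteq> 0" and x: "x \<in> padic_carrier p" "x k = 0"
    and m: "k < m"
  obtains a :: nat where "int a * h m mod int (p ^ m) = x m"
proof -
  have p0: "p > 0" using p prime_gt_0_nat by blast
  let ?q = "int (p ^ m)"
  have "gcd (h m) ?q dvd int p ^ m" by simp
  moreover have "gcd (h m) ?q = int (nat (gcd (h m) ?q))" by simp
  ultimately have "nat (gcd (h m) ?q) dvd p ^ m" by (metis of_nat_dvd_iff of_nat_power)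
  then obtain j where "nat (gcd (h m) ?q) = p ^ j" using divides_primepow_nat[OF p] by blast
  then have j: "gcd (h m) ?q = int p ^ j" by (metis gcd_ge_0_int nat_0_le of_nat_power)
  have "j \<le> k"
  proof (rule ccontr)
    assume "\<not> j \<le> k"
    then have "int p ^ Suc k dvd int p ^ j" by (intro le_imp_power_dvd) simp
    then have "int (p ^ Suc k) dvd h m" using j by (metis dvd_trans gcd_dvd1 of_nat_power)
    then show False using padic_mod[OF p0 h(1), of "Suc k" m] m h(2) by (simp add: dvd_eq_mod_eq_0)
  qed
  moreover have "int (p ^ k) dvd x m" using padic_mod[OF p0 x(1), of k m] m x(2) by (simp add: dvd_eq_mod_eq_0)
  ultimately have "gcd (h m) ?q dvd x m" unfolding j by (metis dvd_trans le_imp_power_dvd of_nat_power)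
  then obtain c where c: "x m = gcd (h m) ?q * c" by blast
  obtain u v where uv: "u * h m + v * ?q = gcd (h m) ?q" using bezout_int by blast
  define a where "a = nat ((c * u) mod ?q)"
  have "int a = (c * u) mod ?q" using p0 by (simp add: a_def)
  then have "int a * h m mod ?q = (c * u) * h m mod ?q" by (simp add: mod_mult_left_eq)
  also have "\<dots> = (c * u * h m + c * v * ?q) mod ?q" by simp
  also have "c * u * h m + c * v * ?q = x m" unfolding c uv[symmetric] by (simp add: algebra_simps)
  also have "x m mod ?q = x m" using x(1) by (simp add: mem_padic_carrier_iff[OF p0])
  finally show thesis by (rule that)
qed

lemma padic_filtered_groupI:
  assumes G: "profinite_group G T" and p: "prime p" and Z: "open_normal G T Z"
    and pad: "subgroup_is_padic p G T Z"
  obtains N where "padic_filtered_group G T N" "N 0 = Z"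
proof -
  have top: "topological_group G T" and cpt: "compact_space T" and Haus: "Hausdorff_space T"
    using G by (auto simp: profinite_group_def)
  interpret group G using top by (simp add: topological_group_def)
  have p0: "p > 0" using p prime_gt_0_nat by blast
  have nZ: "Z \<lhd> G" and oZ: "openin T Z" using Z by (auto simp: open_normal_def)
  have sZ: "subgroup Z G" using nZ by (rule normal_imp_subgroup)
  have ZG: "z \<in> carrier G" if "z \<in> Z" for z using subgroup.mem_carrier[OF sZ that] .
  obtain f where f: "f \<in> iso (G\<lparr>carrier := Z\<rparr>) (padic_group p)"
    "homeomorphic_map (subtopology T Z) (padic_topology p) f"
    using pad by (auto simp: subgroup_is_padic_def topologically_isomorphic_def)
  have bij: "bij_betw f Z (padic_carrier p)" using f(1) by (auto simp: iso_def padic_group_def)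
  have fc: "f z \<in> padic_carrier p" if "z \<in> Z" for z using bij that by (auto simp: bij_betw_def)
  have inj: "x = y" if "x \<in> Z" "y \<in> Z" "\<And>k. f x k = f y k" for x y
    using bij that by (metis bij_betw_def ext inj_onD)
  have surj: "\<exists>z\<in>Z. f z = x" if "x \<in> padic_carrier p" for x
    using bij that by (metis bij_betw_def imageE)
  have fm: "f (x \<otimes>\<^bsub>G\<^esub> y) k = (f x k + f y k) mod int (p ^ k)" if "x \<in> Z" "y \<in> Z" for x y k
  proof -
    have "f (x \<otimes>\<^bsub>G\<^esub> y) = f x \<otimes>\<^bsub>padic_group p\<^esub> f y"
      using f(1) that by (auto simp: iso_def hom_def)
    then show ?thesis by (simp add: padic_group_def)
  qed
  have fb: "f z k mod int (p ^ k) = f z k" if "z \<in> Z" for z k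
    using fc[OF that] by (simp add: mem_padic_carrier_iff[OF p0])
  have one: "\<one>\<^bsub>G\<^esub> \<in> Z" using sZ by (rule subgroup.one_closed)
  have f1: "f \<one>\<^bsub>G\<^esub> k = 0" for k
  proof -
    have e: "f \<one>\<^bsub>G\<^esub> k = (f \<one>\<^bsub>G\<^esub> k + f \<one>\<^bsub>G\<^esub> k) mod int (p ^ k)" using fm[OF one one, of k] by simp
    then have "int (p ^ k) dvd f \<one>\<^bsub>G\<^esub> k"
      using fb[OF one, of k] by (metis add_diff_cancel_left' mod_eq_dvd_iff)
    then show ?thesis using fb[OF one, of k] by (simp add: dvd_eq_mod_eq_0)
  qed
  have fpow: "z [^]\<^bsub>G\<^esub> m \<in> Z \<and> f (z [^]\<^bsub>G\<^esub> m) k = int m * f z k mod int (p ^ k)" if "z \<in> Z" for z k and m :: nat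
  proof (induction m)
    case 0
    then show ?case using one f1 by simp
  next
    case (Suc m)
    then have "z [^]\<^bsub>G\<^esub> m \<otimes>\<^bsub>G\<^esub> z \<in> Z" using that sZ by (simp add: subgroup.m_closed)
    moreover have "f (z [^]\<^bsub>G\<^esub> m \<otimes>\<^bsub>G\<^esub> z) k = (int m * f z k mod int (p ^ k) + f z k) mod int (p ^ k)"
      using fm[of "z [^]\<^bsub>G\<^esub> m" z k] Suc that by simp
    ultimately show ?case by (simp add: mod_simps algebra_simps)
  qed
  \<comment> \<open>The kernel of reduction modulo \<open>p ^ k\<close>, pulled back along
    \<open>f\<close>.\<close>
  define N where "N k = {z \<in> Z. f z k = 0}" for k
  have N0: "N 0 = Z"
  proof -
    have "f z 0 = 0" if "z \<in> Z" for z using fb[OF that, of 0] by simp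
    then show ?thesis by (auto simp: N_def)
  qed
  have sN: "subgroup (N k) G" for k
  proof
    show "N k \<subseteq> carrier G" using ZG by (auto simp: N_def)
    show "\<one>\<^bsub>G\<^esub> \<in> N k" using one f1 by (simp add: N_def)
    show "x \<otimes>\<^bsub>G\<^esub> y \<in> N k" if "x \<in> N k" "y \<in> N k" for x y
      using that fm subgroup.m_closed[OF sZ] by (simp add: N_def)
    show "inv\<^bsub>G\<^esub> x \<in> N k" if "x \<in> N k" for x
    proof -
      have x: "x \<in> Z" "f x k = 0" using that by (auto simp: N_def)
      have ix: "inv\<^bsub>G\<^esub> x \<in> Z" using subgroup.m_inv_closed[OF sZ x(1)] .
      have "f (x \<otimes>\<^bsub>G\<^esub> inv\<^bsub>G\<^esub> x) k = (f x k + f (inv\<^bsub>G\<^esub> x) k) mod int (p ^ k)" by (rule fm[OF x(1) ix])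
      then have "f (inv\<^bsub>G\<^esub> x) k = 0" using x ZG[OF x(1)] f1 fb[OF ix] by simp
      then show ?thesis using ix by (simp add: N_def)
    qed
  qed
  interpret filtered_group G T N
  proof (intro filtered_group.intro filtered_group_axioms.intro is_group)
    show "N k \<lhd> G" for k
      unfolding normal_inv_iff
    proof (intro conjI ballI)
      show "subgroup (N k) G" by (rule sN)
      fix g z assume g: "g \<in> carrier G" and z: "z \<in> N k"
      then have z': "z \<in> Z" "f z k = 0" by (auto simp: N_def)
      \<comment> \<open>\<open>N k\<close> consists of the \<open>p ^ k\<close>-th powers of elements of \<open>Z\<close>, and so is invariant under conjugation.\<close>
      obtain y where y: "y \<in> padic_carrier p" "\<And>m. f z m = int (p ^ k) * y m mod int (p ^ m)"
        using padic_shift[OF p0 fc[OF z'(1)] z'(2)] by blast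
      obtain w where w: "w \<in> Z" "f w = y" using surj[OF y(1)] by blast
      have wp: "w [^]\<^bsub>G\<^esub> (p ^ k) \<in> Z" using fpow[OF w(1)] by blast
      have zw: "z = w [^]\<^bsub>G\<^esub> (p ^ k)"
        by (rule inj[OF z'(1) wp]) (use fpow[OF w(1)] w(2) y(2) in simp)
      define v where "v = g \<otimes>\<^bsub>G\<^esub> w \<otimes>\<^bsub>G\<^esub> inv\<^bsub>G\<^esub> g"
      have v: "v \<in> Z" unfolding v_def by (rule normal_invE(2)[OF nZ g w(1)])
      have wc: "w \<in> carrier G" using ZG w by blast
      have "v [^]\<^bsub>G\<^esub> i = g \<otimes>\<^bsub>G\<^esub> w [^]\<^bsub>G\<^esub> i \<otimes>\<^bsub>G\<^esub> inv\<^bsub>G\<^esub> g" for i :: nat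
      proof (induction i)
        case (Suc i)
        have "v [^]\<^bsub>G\<^esub> Suc i = (g \<otimes>\<^bsub>G\<^esub> w [^]\<^bsub>G\<^esub> i \<otimes>\<^bsub>G\<^esub> inv\<^bsub>G\<^esub> g) \<otimes>\<^bsub>G\<^esub> (g \<otimes>\<^bsub>G\<^esub> w \<otimes>\<^bsub>G\<^esub> inv\<^bsub>G\<^esub> g)"
          using Suc by (simp add: v_def[symmetric])
        also have "\<dots> = g \<otimes>\<^bsub>G\<^esub> w [^]\<^bsub>G\<^esub> i \<otimes>\<^bsub>G\<^esub> (inv\<^bsub>G\<^esub> g \<otimes>\<^bsub>G\<^esub> g) \<otimes>\<^bsub>G\<^esub> w \<otimes>\<^bsub>G\<^esub> inv\<^bsub>G\<^esub> g"
          using g wc by (simp only: m_assoc m_closed nat_pow_closed inv_closed)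
        also have "\<dots> = g \<otimes>\<^bsub>G\<^esub> w [^]\<^bsub>G\<^esub> Suc i \<otimes>\<^bsub>G\<^esub> inv\<^bsub>G\<^esub> g" using g wc by (simp add: m_assoc)
        finally show ?case .
      qed (use g in simp)
      then have "v [^]\<^bsub>G\<^esub> (p ^ k) = g \<otimes>\<^bsub>G\<^esub> z \<otimes>\<^bsub>G\<^esub> inv\<^bsub>G\<^esub> g" by (simp add: zw)
      moreover have "v [^]\<^bsub>G\<^esub> (p ^ k) \<in> N k" using fpow[OF v, of "p ^ k" k] by (simp add: N_def)
      ultimately show "g \<otimes>\<^bsub>G\<^esub> z \<otimes>\<^bsub>G\<^esub> inv\<^bsub>G\<^esub> g \<in> N k" by simp
    qed
    show "openin T (N k)" for k
    proof (rule openin_trans_full[OF _ oZ])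
      let ?D = "discrete_topology (carrier (integer_mod_group (p ^ k)))"
      have "continuous_map (padic_topology p) ?D (\<lambda>x. x k)"
        unfolding padic_topology_def
        by (intro continuous_map_from_subtopology continuous_map_product_projection) simp
      from continuous_map_compose[OF homeomorphic_imp_continuous_map[OF f(2)] this]
      have "continuous_map (subtopology T Z) ?D (\<lambda>z. f z k)" by (simp add: o_def)
      moreover have "openin ?D {0}" using p0 by (simp add: carrier_integer_mod_group)
      ultimately have "openin (subtopology T Z) {z \<in> topspace (subtopology T Z). f z k \<in> {0}}"
        by (rule openin_continuous_map_preimage)
      moreover have Z: "topspace (subtopology T Z) = Z"
        using openin_subset[OF oZ] by (rule topspace_subtopology_subset)
      moreover have "{z \<in> topspace (subtopology T Z). f z k \<in> {0}} = N k" unfolding Z N_def by simp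
      ultimately show "openin (subtopology T Z) (N k)" by (simp only:)
    qed
    show "N (Suc k) \<subseteq> N k" for k
    proof
      fix z assume "z \<in> N (Suc k)"
      then have z: "z \<in> Z" "f z (Suc k) = 0" by (auto simp: N_def)
      then show "z \<in> N k" using padic_mod[OF p0 fc[OF z(1)], of k "Suc k"] by (simp add: N_def)
    qed
    show "(\<Inter>k. N k) = {\<one>\<^bsub>G\<^esub>}"
    proof
      show "{\<one>\<^bsub>G\<^esub>} \<subseteq> (\<Inter>k. N k)" using one f1 by (simp add: N_def)
      show "(\<Inter>k. N k) \<subseteq> {\<one>\<^bsub>G\<^esub>}" using inj[OF _ one] f1 by (auto simp: N_def)
    qed
  qed (use top cpt Haus in auto)
  have "padic_filtered_group G T N"
  proof
    show "N (Suc k) \<noteq> N k" for k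
    proof
      assume e: "N (Suc k) = N k"
      obtain z where z: "z \<in> Z" "f z = (\<lambda>m. int (p ^ k) mod int (p ^ m))"
        using surj[OF padic_power_mem[OF p0]] by blast
      have "z \<in> N k" using z by (simp add: N_def)
      then have "f z (Suc k) = 0" unfolding e[symmetric] by (simp add: N_def)
      then have "int (p ^ k) mod int (p ^ Suc k) = 0" unfolding z(2) .
      moreover have "p ^ k < p ^ Suc k" using prime_gt_1_nat[OF p] by (simp add: power_strict_increasing)
      ultimately show False using p0 by (metis mod_less of_nat_mod of_nat_0_eq_iff power_not_zero not_gr_zero)
    qed
    show "x \<otimes>\<^bsub>G\<^esub> y = y \<otimes>\<^bsub>G\<^esub> x" if "x \<in> N 0" "y \<in> N 0" for x y
    proof -
      have xy: "x \<in> Z" "y \<in> Z" using that N0 by auto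
      show ?thesis
        by (rule inj) (use xy sZ fm in \<open>simp_all add: subgroup.m_closed add.commute\<close>)
    qed
    show "z = \<one>\<^bsub>G\<^esub>" if "z \<in> N 0" "m > 0" "z [^]\<^bsub>G\<^esub> m = \<one>\<^bsub>G\<^esub>" for z and m :: nat
    proof -
      have z: "z \<in> Z" using that N0 by auto
      have "int m * f z k mod int (p ^ k) = 0" for k using fpow[OF z, of m k] that(3) f1 by simp
      then have "f z k = 0" for k using padic_torsion_free[OF p fc[OF z] that(2)] by blast
      then show ?thesis using inj[OF z one] f1 by simp
    qed
    show "N k \<subseteq> H"
      if H: "H \<in> closed_subgroups G T" "h \<in> H" "h \<in> N 0" "h \<notin> N (Suc k)" for H h k
    proof
      fix x assume "x \<in> N k"
      then have x: "x \<in> Z" "f x k = 0" by (auto simp: N_def)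
      have h: "h \<in> Z" "f h (Suc k) \<noteq> 0" using H N0 by (auto simp: N_def)
      note Hs = closed_subgroupsD[OF H(1)]
      show "x \<in> H"
      proof (rule closed_subgroup_memI[OF H(1)])
        fix i
        \<comment> \<open>\<open>i \<le> m\<close> places the error term \<open>w\<close> in
          \<open>N i\<close>; \<open>k < m\<close> is required by
          \<open>padic_multiple\<close>.\<close>
        define m where "m = max i (Suc k)"
        have m: "k < m" "i \<le> m" by (auto simp: m_def)
        obtain a :: nat where a: "int a * f h m mod int (p ^ m) = f x m"
          using padic_multiple[OF p fc[OF h(1)] h(2) fc[OF x(1)] x(2) m(1)] by blast
        define y where "y = h [^]\<^bsub>G\<^esub> a"
        have yH: "y \<in> H" unfolding y_def
          by (induction a) (use Hs(1) H(2) in \<open>auto intro: subgroup.one_closed subgroup.m_closed\<close>)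
        have y: "y \<in> Z" "f y m = f x m" using fpow[OF h(1), of a m] a by (auto simp: y_def)
        have iy: "inv\<^bsub>G\<^esub> y \<in> Z" using subgroup.m_inv_closed[OF sZ y(1)] .
        define w where "w = inv\<^bsub>G\<^esub> y \<otimes>\<^bsub>G\<^esub> x"
        have w: "w \<in> Z" unfolding w_def by (rule subgroup.m_closed[OF sZ iy x(1)])
        have yw: "x = y \<otimes>\<^bsub>G\<^esub> w" using ZG[OF y(1)] ZG[OF x(1)] by (simp add: w_def m_assoc[symmetric])
        have "f x m = (f x m + f w m) mod int (p ^ m)" using fm[OF y(1) w, of m] yw y(2) by simp
        then have "int (p ^ m) dvd f w m"
          using fb[OF x(1), of m] by (metis add_diff_cancel_left' mod_eq_dvd_iff)
        then have "f w m = 0" using fb[OF w, of m] by (simp add: dvd_eq_mod_eq_0)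
        then have "w \<in> N m" using w by (simp add: N_def)
        then have "w \<in> N i" using antimono_N[OF m(2)] by blast
        then show "x \<in> H <#>\<^bsub>G\<^esub> N i" unfolding mem_set_mult using yw yH by blast
      qed
    qed
  qed
  then show thesis using N0 by (rule that)
qed

text \<open>Since \<open>card\<close> is 0 on infinite sets, \<open>finite D\<close> is asserted as
  well, so that \<open>card D\<close> is the actual number of non-isolated points.\<close>

theorem corollary4p15:
  fixes G :: "('a, 'b) monoid_scheme" and T :: "'a topology" and p :: nat and Z :: "'a set"
  assumes "profinite_group G T"
    and "prime p"
    and "virtually_padic p G T"
    and "open_normal G T Z"
    and "subgroup_is_padic p G T Z"
    and "uncountable (topspace (subgroup_space G T))"
  shows "let C = group_centralizer G Z;
             D = non_isolated_points (subgroup_space (G\<lparr>carrier := C\<rparr>) (subtopology T C))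
         in finite D \<and>
            subgroup_space G T homeomorphic_space
              disjoint_union_topology pelczynski_space (omega_mult_plus_one (card D))"
proof -
  obtain N where N: "padic_filtered_group G T N" "N 0 = Z"
    using padic_filtered_groupI assms(1,2,4,5) by metis
  interpret padic_filtered_group G T N by (rule N(1))
  show ?thesis
    using non_isolated_centralizer finite_central_torsion
      pelczynski_type_homeomorphic[OF pelczynski_type_X noncentral_nonempty[OF assms(6)]]
    unfolding N(2) Let_def by simp
qed

end
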